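(* Let $(M,g)$ be an $n$-dimensional $LP$-Kenmotsu manifold with constant scalar curvature $r$, admitting a Ricci-Yamabe soliton $(g,K,\Lambda,\sigma,\rho)$, i.e. there are a vector field $K$ on $M$ and real numbers $\Lambda,\sigma,\rho$ with $\mathcal{L}_K g+2\sigma S+(2\Lambda-\rho r)g=0$. Then $$\Lambda=\frac{\rho\, n(n-1)}{2}-\sigma(n-1).$$
   Context: A Lorentzian almost paracontact metric manifold is an $n$-dimensional smooth manifold $M$ ($n\ge 2$) with a $(1,1)$-tensor field $\varphi$, a vector field $\zeta$, a 1-form $\nu$ and a Lorentzian metric $g$ such that for all vector fields $E,F$: $\nu(\zeta)=-1$; $\varphi^2E=E+\nu(E)\zeta$; $\varphi\zeta=0$; $\nu(\varphi E)=0$; $g(\varphi E,\varphi F)=g(E,F)+\nu(E)\nu(F)$; $g(E,\zeta)=\nu(E)$; and $g(E,\varphi F)=g(\varphi E,F)$. It is a Lorentzian para-Kenmotsu ($LP$-Kenmotsu) manifold if in addition $(\nabla_E\varphi)F=-g(\varphi E,F)\zeta-\nu(F)\varphi E$ for all vector fields $E,F$, where $\nabla$ is the Levi-Civita connection of $g$. Here $S$ is the Ricci tensor of $g$ (curvature convention $R(E,F)=[\nabla_E,\nabla_F]-\nabla_{[E,F]}$, under which $S(\zeta,\zeta)=-(n-1)$), $r$ is the scalar curvature (the $g$-trace of $S$), and $\mathcal{L}_K$ is the Lie derivative along $K$. *)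

theory Defs
  imports "HOL-Analysis.Analysis"
begin

subsection \<open>Smooth maps on open subsets of normed spaces\<close>

primrec Ck_on :: "nat \<Rightarrow> 'b::real_normed_vector set \<Rightarrow> ('b \<Rightarrow> 'c::real_normed_vector) \<Rightarrow> bool" where
  "Ck_on 0 U f \<longleftrightarrow> continuous_on U f"
| "Ck_on (Suc k) U f \<longleftrightarrow>
     f differentiable_on U \<and> (\<forall>v. Ck_on k U (\<lambda>x. frechet_derivative f (at x) v))"

text \<open>Only used for open \<open>U\<close>, where \<open>frechet_derivative f (at x)\<close> is determined by \<open>f\<close> on \<open>U\<close>.\<close>

definition smooth_on :: "'b::real_normed_vector set \<Rightarrow> ('b \<Rightarrow> 'c::real_normed_vector) \<Rightarrow> bool" where
  "smooth_on U f \<longleftrightarrow> (\<forall>k. Ck_on k U f)"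

subsection \<open>Smooth manifolds\<close>

text \<open>The manifold is the whole type \<open>'a\<close>; its dimension is \<open>CARD('n)\<close>. A chart is a pair of a domain
  and a coordinate map; the coordinate map is irrelevant outside the domain.\<close>

type_synonym ('a, 'n) chart = "'a set \<times> ('a \<Rightarrow> real ^ 'n)"

definition chart_image :: "('a, 'n::finite) chart \<Rightarrow> (real ^ 'n) set" where
  "chart_image c = snd c ` fst c"

definition chart_inv :: "('a, 'n::finite) chart \<Rightarrow> real ^ 'n \<Rightarrow> 'a" where
  "chart_inv c = inv_into (fst c) (snd c)"

definition smooth_manifold ::
    "('a::{t2_space, second_countable_topology}, 'n::finite) chart set \<Rightarrow> bool" where
  "smooth_manifold A \<longleftrightarrow>
     (\<Union>c\<in>A. fst c) = UNIV \<and>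
     (\<forall>c\<in>A. open (fst c) \<and> open (chart_image c) \<and>
        homeomorphism (fst c) (chart_image c) (snd c) (chart_inv c)) \<and>
     (\<forall>c\<in>A. \<forall>d\<in>A. smooth_on (snd c ` (fst c \<inter> fst d)) (snd d \<circ> chart_inv c))"

definition smooth_fun :: "('a, 'n::finite) chart set \<Rightarrow> ('a \<Rightarrow> real) \<Rightarrow> bool" where
  "smooth_fun A f \<longleftrightarrow> (\<forall>c\<in>A. smooth_on (chart_image c) (f \<circ> chart_inv c))"

subsection \<open>Tangent vectors and vector fields\<close>

text \<open>The tangent space at \<open>p\<close> is modelled on \<open>real ^ 'n\<close>: a tangent vector at \<open>p\<close> is given by its
  components with respect to a chart \<open>chart_at A p\<close> chosen once and for all for each point. Its components
  in any other chart around \<open>p\<close> are obtained from the Jacobian of the transition map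
  (\<open>vec_in_chart\<close>). No continuity of \<open>chart_at\<close> in \<open>p\<close> is assumed, so smoothness of a vector field
  refers to its components in a fixed chart.\<close>

type_synonym ('a, 'n) vfield = "'a \<Rightarrow> real ^ 'n"

definition chart_at :: "('a, 'n::finite) chart set \<Rightarrow> 'a \<Rightarrow> ('a, 'n) chart" where
  "chart_at A p = (SOME c. c \<in> A \<and> p \<in> fst c)"

definition vec_in_chart ::
    "('a, 'n::finite) chart set \<Rightarrow> ('a, 'n) chart \<Rightarrow> 'a \<Rightarrow> real ^ 'n \<Rightarrow> real ^ 'n" where
  "vec_in_chart A c p v =
     frechet_derivative (snd c \<circ> chart_inv (chart_at A p)) (at (snd (chart_at A p) p)) v"

definition field_in_chart ::
    "('a, 'n::finite) chart set \<Rightarrow> ('a, 'n) chart \<Rightarrow> ('a, 'n) vfield \<Rightarrow> real ^ 'n \<Rightarrow> real ^ 'n" where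
  "field_in_chart A c X x = vec_in_chart A c (chart_inv c x) (X (chart_inv c x))"

definition vector_fields :: "('a, 'n::finite) chart set \<Rightarrow> ('a, 'n) vfield set" where
  "vector_fields A = {X. \<forall>c\<in>A. smooth_on (chart_image c) (field_in_chart A c X)}"

definition deriv_along ::
    "('a, 'n::finite) chart set \<Rightarrow> ('a, 'n) vfield \<Rightarrow> ('a \<Rightarrow> real) \<Rightarrow> 'a \<Rightarrow> real" where
  "deriv_along A X f p =
     frechet_derivative (f \<circ> chart_inv (chart_at A p)) (at (snd (chart_at A p) p)) (X p)"

text \<open>\<open>[X,Y]\<^sup>i = X\<^sup>j \<partial>\<^sub>j Y\<^sup>i - Y\<^sup>j \<partial>\<^sub>j X\<^sup>i\<close>, evaluated at \<open>p\<close> in the chart \<open>chart_at A p\<close>, with respect to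
  which \<open>X p\<close> and \<open>Y p\<close> are the components.\<close>

definition lie_bracket ::
    "('a, 'n::finite) chart set \<Rightarrow> ('a, 'n) vfield \<Rightarrow> ('a, 'n) vfield \<Rightarrow> ('a, 'n) vfield" where
  "lie_bracket A X Y p =
     (let c = chart_at A p; x = snd c p in
        frechet_derivative (field_in_chart A c Y) (at x) (X p)
        - frechet_derivative (field_in_chart A c X) (at x) (Y p))"

subsection \<open>Tensor fields\<close>

definition one_form :: "('a, 'n::finite) chart set \<Rightarrow> ('a \<Rightarrow> real ^ 'n \<Rightarrow> real) \<Rightarrow> bool" where
  "one_form A \<nu> \<longleftrightarrow>
     (\<forall>p. linear (\<nu> p)) \<and> (\<forall>X\<in>vector_fields A. smooth_fun A (\<lambda>p. \<nu> p (X p)))"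

definition tensor_field_11 ::
    "('a, 'n::finite) chart set \<Rightarrow> ('a \<Rightarrow> real ^ 'n \<Rightarrow> real ^ 'n) \<Rightarrow> bool" where
  "tensor_field_11 A \<phi> \<longleftrightarrow>
     (\<forall>p. linear (\<phi> p)) \<and> (\<forall>X\<in>vector_fields A. (\<lambda>p. \<phi> p (X p)) \<in> vector_fields A)"

text \<open>Signature \<open>(-,+,\<dots>,+)\<close>, expressed by the existence of an orthonormal basis; linear independence
  of \<open>e\<close> follows from the orthonormality relations.\<close>

definition lorentzian_form :: "(real ^ 'n::finite \<Rightarrow> real ^ 'n \<Rightarrow> real) \<Rightarrow> bool" where
  "lorentzian_form b \<longleftrightarrow>
     bilinear b \<and> (\<forall>v w. b v w = b w v) \<and>
     (\<exists>(e :: 'n \<Rightarrow> real ^ 'n) k. \<forall>i j.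
        b (e i) (e j) = (if i \<noteq> j then 0 else if i = k then - 1 else 1))"

definition lorentzian_metric ::
    "('a, 'n::finite) chart set \<Rightarrow> ('a \<Rightarrow> real ^ 'n \<Rightarrow> real ^ 'n \<Rightarrow> real) \<Rightarrow> bool" where
  "lorentzian_metric A g \<longleftrightarrow>
     (\<forall>p. lorentzian_form (g p)) \<and>
     (\<forall>X\<in>vector_fields A. \<forall>Y\<in>vector_fields A. smooth_fun A (\<lambda>p. g p (X p) (Y p)))"

definition lie_derivative_metric ::
    "('a, 'n::finite) chart set \<Rightarrow> ('a, 'n) vfield \<Rightarrow> ('a \<Rightarrow> real ^ 'n \<Rightarrow> real ^ 'n \<Rightarrow> real) \<Rightarrow>
     ('a, 'n) vfield \<Rightarrow> ('a, 'n) vfield \<Rightarrow> 'a \<Rightarrow> real" where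
  "lie_derivative_metric A K g E F p =
     deriv_along A K (\<lambda>q. g q (E q) (F q)) p
     - g p (lie_bracket A K E p) (F p) - g p (E p) (lie_bracket A K F p)"

subsection \<open>The Levi-Civita connection and its curvature\<close>

definition affine_connection ::
    "('a, 'n::finite) chart set \<Rightarrow> (('a, 'n) vfield \<Rightarrow> ('a, 'n) vfield \<Rightarrow> ('a, 'n) vfield) \<Rightarrow> bool" where
  "affine_connection A D \<longleftrightarrow>
     (\<forall>X\<in>vector_fields A. \<forall>Y\<in>vector_fields A. D X Y \<in> vector_fields A) \<and>
     (\<forall>X\<in>vector_fields A. \<forall>Y\<in>vector_fields A. \<forall>Z\<in>vector_fields A. \<forall>p.
        D (\<lambda>q. X q + Y q) Z p = D X Z p + D Y Z p \<and>
        D X (\<lambda>q. Y q + Z q) p = D X Y p + D X Z p) \<and>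
     (\<forall>f. smooth_fun A f \<longrightarrow> (\<forall>X\<in>vector_fields A. \<forall>Y\<in>vector_fields A. \<forall>p.
        D (\<lambda>q. f q *\<^sub>R X q) Y p = f p *\<^sub>R D X Y p \<and>
        D X (\<lambda>q. f q *\<^sub>R Y q) p = deriv_along A X f p *\<^sub>R Y p + f p *\<^sub>R D X Y p))"

text \<open>\<open>D\<close> is constrained on smooth vector fields only, where these conditions determine it uniquely.\<close>

definition levi_civita ::
    "('a, 'n::finite) chart set \<Rightarrow> ('a \<Rightarrow> real ^ 'n \<Rightarrow> real ^ 'n \<Rightarrow> real) \<Rightarrow>
     (('a, 'n) vfield \<Rightarrow> ('a, 'n) vfield \<Rightarrow> ('a, 'n) vfield) \<Rightarrow> bool" where
  "levi_civita A g D \<longleftrightarrow>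
     affine_connection A D \<and>
     (\<forall>X\<in>vector_fields A. \<forall>Y\<in>vector_fields A. \<forall>p.
        D X Y p - D Y X p = lie_bracket A X Y p) \<and>
     (\<forall>X\<in>vector_fields A. \<forall>Y\<in>vector_fields A. \<forall>Z\<in>vector_fields A. \<forall>p.
        deriv_along A X (\<lambda>q. g q (Y q) (Z q)) p = g p (D X Y p) (Z p) + g p (Y p) (D X Z p))"

definition cov_deriv_11 ::
    "(('a, 'n::finite) vfield \<Rightarrow> ('a, 'n) vfield \<Rightarrow> ('a, 'n) vfield) \<Rightarrow>
     ('a \<Rightarrow> real ^ 'n \<Rightarrow> real ^ 'n) \<Rightarrow> ('a, 'n) vfield \<Rightarrow> ('a, 'n) vfield \<Rightarrow> ('a, 'n) vfield" where
  "cov_deriv_11 D \<phi> E F p = D E (\<lambda>q. \<phi> q (F q)) p - \<phi> p (D E F p)"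

definition curvature ::
    "('a, 'n::finite) chart set \<Rightarrow> (('a, 'n) vfield \<Rightarrow> ('a, 'n) vfield \<Rightarrow> ('a, 'n) vfield) \<Rightarrow>
     ('a, 'n) vfield \<Rightarrow> ('a, 'n) vfield \<Rightarrow> ('a, 'n) vfield \<Rightarrow> ('a, 'n) vfield" where
  "curvature A D E F G p = D E (D F G) p - D F (D E G) p - D (lie_bracket A E F) G p"

text \<open>The curvature being tensorial, its value at \<open>p\<close> on tangent vectors is computed from arbitrary
  global smooth extensions of these vectors.\<close>

definition extend_vec :: "('a, 'n::finite) chart set \<Rightarrow> 'a \<Rightarrow> real ^ 'n \<Rightarrow> ('a, 'n) vfield" where
  "extend_vec A p v = (SOME X. X \<in> vector_fields A \<and> X p = v)"

text \<open>\<open>S(v,w) = trace (u \<mapsto> R(u,v)w)\<close>.\<close>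

definition ricci ::
    "('a, 'n::finite) chart set \<Rightarrow> (('a, 'n) vfield \<Rightarrow> ('a, 'n) vfield \<Rightarrow> ('a, 'n) vfield) \<Rightarrow>
     'a \<Rightarrow> real ^ 'n \<Rightarrow> real ^ 'n \<Rightarrow> real" where
  "ricci A D p v w =
     trace (matrix (\<lambda>u. curvature A D (extend_vec A p u) (extend_vec A p v) (extend_vec A p w) p))"

definition gram_matrix :: "(real ^ 'n::finite \<Rightarrow> real ^ 'n \<Rightarrow> real) \<Rightarrow> real ^ 'n ^ 'n" where
  "gram_matrix b = (\<chi> i j. b (axis i 1) (axis j 1))"

text \<open>The metric trace \<open>g\<^sup>i\<^sup>j S\<^sub>i\<^sub>j\<close>.\<close>

definition scalar_curvature ::
    "('a, 'n::finite) chart set \<Rightarrow> ('a \<Rightarrow> real ^ 'n \<Rightarrow> real ^ 'n \<Rightarrow> real) \<Rightarrow>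
     (('a, 'n) vfield \<Rightarrow> ('a, 'n) vfield \<Rightarrow> ('a, 'n) vfield) \<Rightarrow> 'a \<Rightarrow> real" where
  "scalar_curvature A g D p =
     trace (matrix_inv (gram_matrix (g p)) ** gram_matrix (ricci A D p))"

subsection \<open>Lorentzian para-Kenmotsu manifolds and Ricci-Yamabe solitons\<close>

definition lorentzian_almost_paracontact ::
    "('a::{t2_space, second_countable_topology}, 'n::finite) chart set \<Rightarrow>
     ('a \<Rightarrow> real ^ 'n \<Rightarrow> real ^ 'n) \<Rightarrow> ('a, 'n) vfield \<Rightarrow> ('a \<Rightarrow> real ^ 'n \<Rightarrow> real) \<Rightarrow>
     ('a \<Rightarrow> real ^ 'n \<Rightarrow> real ^ 'n \<Rightarrow> real) \<Rightarrow> bool" where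
  "lorentzian_almost_paracontact A \<phi> \<zeta> \<nu> g \<longleftrightarrow>
     smooth_manifold A \<and> 2 \<le> CARD('n) \<and>
     tensor_field_11 A \<phi> \<and> \<zeta> \<in> vector_fields A \<and> one_form A \<nu> \<and> lorentzian_metric A g \<and>
     (\<forall>p. \<nu> p (\<zeta> p) = - 1 \<and> \<phi> p (\<zeta> p) = 0) \<and>
     (\<forall>E\<in>vector_fields A. \<forall>p.
        \<phi> p (\<phi> p (E p)) = E p + \<nu> p (E p) *\<^sub>R \<zeta> p \<and>
        \<nu> p (\<phi> p (E p)) = 0 \<and>
        g p (E p) (\<zeta> p) = \<nu> p (E p)) \<and>
     (\<forall>E\<in>vector_fields A. \<forall>F\<in>vector_fields A. \<forall>p.
        g p (\<phi> p (E p)) (\<phi> p (F p)) = g p (E p) (F p) + \<nu> p (E p) * \<nu> p (F p) \<and>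
        g p (E p) (\<phi> p (F p)) = g p (\<phi> p (E p)) (F p))"

definition lp_kenmotsu ::
    "('a::{t2_space, second_countable_topology}, 'n::finite) chart set \<Rightarrow>
     ('a \<Rightarrow> real ^ 'n \<Rightarrow> real ^ 'n) \<Rightarrow> ('a, 'n) vfield \<Rightarrow> ('a \<Rightarrow> real ^ 'n \<Rightarrow> real) \<Rightarrow>
     ('a \<Rightarrow> real ^ 'n \<Rightarrow> real ^ 'n \<Rightarrow> real) \<Rightarrow>
     (('a, 'n) vfield \<Rightarrow> ('a, 'n) vfield \<Rightarrow> ('a, 'n) vfield) \<Rightarrow> bool" where
  "lp_kenmotsu A \<phi> \<zeta> \<nu> g D \<longleftrightarrow>
     lorentzian_almost_paracontact A \<phi> \<zeta> \<nu> g \<and> levi_civita A g D \<and>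
     (\<forall>E\<in>vector_fields A. \<forall>F\<in>vector_fields A. \<forall>p.
        cov_deriv_11 D \<phi> E F p =
          - (g p (\<phi> p (E p)) (F p) *\<^sub>R \<zeta> p) - \<nu> p (F p) *\<^sub>R \<phi> p (E p))"

definition ricci_yamabe_soliton ::
    "('a, 'n::finite) chart set \<Rightarrow> ('a \<Rightarrow> real ^ 'n \<Rightarrow> real ^ 'n \<Rightarrow> real) \<Rightarrow>
     (('a, 'n) vfield \<Rightarrow> ('a, 'n) vfield \<Rightarrow> ('a, 'n) vfield) \<Rightarrow>
     ('a, 'n) vfield \<Rightarrow> real \<Rightarrow> real \<Rightarrow> real \<Rightarrow> bool" where
  "ricci_yamabe_soliton A g D K \<Lambda> \<sigma> \<rho> \<longleftrightarrow>
     K \<in> vector_fields A \<and>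
     (\<forall>E\<in>vector_fields A. \<forall>F\<in>vector_fields A. \<forall>p.
        lie_derivative_metric A K g E F p + 2 * \<sigma> * ricci A D p (E p) (F p)
        + (2 * \<Lambda> - \<rho> * scalar_curvature A g D p) * g p (E p) (F p) = 0)"

end

theory Submission imports Defs
begin

text \<open>
  Write \<open>n\<close> for the dimension and \<open>h = g + \<nu> \<otimes> \<nu>\<close> (below \<open>g_hor\<close>). The structure equation for \<open>\<phi>\<close> gives
  \<open>\<nabla>\<^sub>E \<zeta> = - E - \<nu>(E) \<zeta>\<close>, so that \<open>\<nu>\<close> is closed, \<open>R(X,Y)\<zeta> = \<nu>(Y) X - \<nu>(X) Y\<close> and
  \<open>S(X,\<zeta>) = (n - 1) \<nu>(X)\<close>. Locally the manifold is a warped product \<open>- dt\<^sup>2 + e\<^sup>-\<^sup>2\<^sup>t h\<^sub>0\<close> with \<open>\<zeta> = \<partial>\<^sub>t\<close>; the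
  proof expresses the dependence on \<open>t\<close> by Lie derivatives along \<open>\<zeta>\<close>.

  From \<open>\<L>\<^sub>\<zeta> g = - 2 h\<close> one computes successively the Lie derivatives of the connection, the curvature and the
  Ricci tensor (\<open>lie_zeta_connection\<close>, \<open>lie_zeta_curvature\<close>, \<open>lie_zeta_ricci\<close>); the last one is
  \<open>\<L>\<^sub>\<zeta> S = - 2 (n - 1) h\<close>. Contracting once more gives \<open>\<zeta>(r) = 2 r - 2 n (n - 1)\<close>
  (\<open>drv_zeta_scalar_curvature\<close>), and therefore \<open>r = n (n - 1)\<close> as soon as \<open>r\<close> is constant.

  It remains to see that the constant \<open>c = \<Lambda> - \<rho> r / 2 + \<sigma> (n - 1)\<close> of a soliton vanishes
  (\<open>soliton_constant_zero\<close>). Put \<open>f = \<nu>(K)\<close> and \<open>W = [\<zeta>, K]\<close>. Inserting \<open>\<zeta>\<close> into the soliton equation gives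
  \<open>g(W, E) = - 2 c \<nu>(E) - E(f)\<close> and \<open>\<zeta>(f) = \<nu>(W) = c\<close>, whence \<open>[\<zeta>, W] = 2 W + 2 c \<zeta>\<close>. Applying \<open>\<L>\<^sub>\<zeta>\<close> to the
  soliton equation expresses \<open>\<L>\<^sub>W g\<close> through \<open>h\<close>, \<open>\<L>\<^sub>K g\<close>, \<open>df\<close> and \<open>\<nu>\<close>. Applying it a second time in two
  ways, to this expression and through the commutator rule, yields \<open>0 = - 4 c h\<close>, and \<open>h \<noteq> 0\<close> since \<open>n \<ge> 2\<close>.

  All of this is calculus with global vector fields, where Lie derivatives, curvature and traces obey simple
  algebraic rules. What has to be supplied from analysis is: symmetry of second derivatives, which makes
  the bracket a commutator (\<open>deriv_along_lie_bracket\<close>); bump functions, which extend tangent vectors to fields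
  and show that tensorial expressions only depend on values at a point (\<open>tensorial_at\<close>); and the
  compatibility of Lie derivatives with traces (\<open>deriv_along_trace\<close>).
\<close>

section \<open>Smooth maps between normed spaces\<close>

lemma Ck_on_cong_imp:
  assumes "open U"
  shows "(\<And>x. x \<in> U \<Longrightarrow> f x = g x) \<Longrightarrow> Ck_on k U f \<Longrightarrow> Ck_on k U g"
proof (induction k arbitrary: f g)
  case 0
  then show ?case using continuous_on_eq[of U f g] by simp
next
  case (Suc k)
  have d: "f differentiable (at x)" if "x \<in> U" for x
    using Suc.prems(2) that assms by (simp add: differentiable_on_eq_differentiable_at)
  have g: "(g has_derivative frechet_derivative f (at x)) (at x)" if "x \<in> U" for x
    using has_derivative_transform_within_open[OF d[OF that, unfolded frechet_derivative_works] assms that]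
      Suc.prems(1) by simp
  then have "g differentiable_on U"
    using assms by (auto simp: differentiable_on_eq_differentiable_at intro: differentiableI)
  moreover have "Ck_on k U (\<lambda>x. frechet_derivative g (at x) v)" for v
  proof (rule Suc.IH)
    show "Ck_on k U (\<lambda>x. frechet_derivative f (at x) v)" using Suc.prems(2) by simp
  qed (simp add: frechet_derivative_at[OF g])
  ultimately show ?case by simp
qed

lemma Ck_on_Suc_iff:
  assumes "open U"
  shows "Ck_on (Suc k) U f \<longleftrightarrow>
    (\<exists>f'. (\<forall>x\<in>U. (f has_derivative f' x) (at x)) \<and> (\<forall>v. Ck_on k U (\<lambda>x. f' x v)))"
    (is "?l \<longleftrightarrow> ?r")
proof
  assume ?l
  then show ?r
    using assms
    by (intro exI[of _ "\<lambda>x. frechet_derivative f (at x)"])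
       (auto simp: differentiable_on_eq_differentiable_at frechet_derivative_works)
next
  assume ?r
  then obtain f' where "\<And>x. x \<in> U \<Longrightarrow> (f has_derivative f' x) (at x)" "\<And>v. Ck_on k U (\<lambda>x. f' x v)"
    by blast
  then have *: "frechet_derivative f (at x) = f' x" if "x \<in> U" for x
    using that by (simp add: frechet_derivative_at[symmetric])
  have "f differentiable_on U"
    using assms \<open>\<And>x. x \<in> U \<Longrightarrow> (f has_derivative f' x) (at x)\<close>
    by (auto simp: differentiable_on_eq_differentiable_at intro: differentiableI)
  moreover have "Ck_on k U (\<lambda>x. frechet_derivative f (at x) v)" for v
    by (rule Ck_on_cong_imp[OF assms _ \<open>Ck_on k U (\<lambda>x. f' x v)\<close>]) (simp add: *)
  ultimately show ?l by simp
qed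

lemma Ck_on_Suc_imp: "open U \<Longrightarrow> Ck_on (Suc k) U f \<Longrightarrow> Ck_on k U f"
proof (induction k arbitrary: f)
  case 0
  then show ?case by (simp add: differentiable_imp_continuous_on)
next
  case (Suc k)
  have "f differentiable_on U" using Suc.prems(2) by simp
  moreover have "Ck_on k U (\<lambda>x. frechet_derivative f (at x) v)" for v
  proof (rule Suc.IH[OF Suc.prems(1)])
    show "Ck_on (Suc k) U (\<lambda>x. frechet_derivative f (at x) v)"
      using Suc.prems(2) unfolding Ck_on.simps(2)[of "Suc k"] by blast
  qed
  ultimately show ?case by simp
qed

lemma Ck_on_const [simp]: "Ck_on k U (\<lambda>x. c)"
  by (induction k arbitrary: c) auto

lemma Ck_on_bounded_linear:
  assumes "bounded_linear L" "open U"
  shows "Ck_on k U L"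
proof (cases k)
  case 0
  then show ?thesis using assms by (simp add: linear_continuous_on)
next
  case (Suc m)
  show ?thesis unfolding Suc Ck_on_Suc_iff[OF assms(2)]
    using assms(1) by (intro exI[of _ "\<lambda>x. L"]) (auto simp: bounded_linear_imp_has_derivative)
qed

lemma Ck_on_add:
  assumes "open U"
  shows "Ck_on k U f \<Longrightarrow> Ck_on k U g \<Longrightarrow> Ck_on k U (\<lambda>x. f x + g x)"
proof (induction k arbitrary: f g)
  case 0
  then show ?case by (simp add: continuous_on_add)
next
  case (Suc k)
  then obtain f' g' where
    "\<forall>x\<in>U. (f has_derivative f' x) (at x)" "\<forall>v. Ck_on k U (\<lambda>x. f' x v)"
    "\<forall>x\<in>U. (g has_derivative g' x) (at x)" "\<forall>v. Ck_on k U (\<lambda>x. g' x v)"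
    unfolding Ck_on_Suc_iff[OF assms] by blast
  then show ?case
    unfolding Ck_on_Suc_iff[OF assms] using Suc.IH
    by (intro exI[of _ "\<lambda>x v. f' x v + g' x v"]) (auto intro!: has_derivative_add)
qed

lemma Ck_on_bilinear:
  assumes "open U" "bounded_bilinear B"
  shows "Ck_on k U f \<Longrightarrow> Ck_on k U g \<Longrightarrow> Ck_on k U (\<lambda>x. B (f x) (g x))"
proof (induction k arbitrary: f g)
  case 0
  then show ?case
    using bounded_bilinear.continuous_on[OF assms(2)] by simp
next
  case (Suc k)
  then obtain f' g' where
    *: "\<forall>x\<in>U. (f has_derivative f' x) (at x)" "\<forall>v. Ck_on k U (\<lambda>x. f' x v)"
    "\<forall>x\<in>U. (g has_derivative g' x) (at x)" "\<forall>v. Ck_on k U (\<lambda>x. g' x v)"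
    unfolding Ck_on_Suc_iff[OF assms(1)] by blast
  have "Ck_on k U f" "Ck_on k U g"
    using Suc.prems assms(1) Ck_on_Suc_imp by blast+
  then show ?case
    unfolding Ck_on_Suc_iff[OF assms(1)] using Suc.IH *
    by (intro exI[of _ "\<lambda>x v. B (f x) (g' x v) + B (f' x v) (g x)"])
       (auto intro!: bounded_bilinear.FDERIV[OF assms(2)] Ck_on_add[OF assms(1)])
qed

lemma Ck_on_linear_compose:
  assumes "open U" "bounded_linear L"
  shows "Ck_on k U f \<Longrightarrow> Ck_on k U (\<lambda>x. L (f x))"
proof (induction k arbitrary: f)
  case 0
  then show ?case using assms(2) by (simp add: bounded_linear.continuous_on)
next
  case (Suc k)
  then obtain f' where "\<forall>x\<in>U. (f has_derivative f' x) (at x)" "\<forall>v. Ck_on k U (\<lambda>x. f' x v)"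
    unfolding Ck_on_Suc_iff[OF assms(1)] by blast
  then show ?case
    unfolding Ck_on_Suc_iff[OF assms(1)] using Suc.IH
    by (intro exI[of _ "\<lambda>x v. L (f' x v)"]) (auto intro!: bounded_linear.has_derivative[OF assms(2)])
qed

lemma Ck_on_sum:
  assumes "open U" "\<And>i. i \<in> I \<Longrightarrow> Ck_on k U (f i)"
  shows "Ck_on k U (\<lambda>x. \<Sum>i\<in>I. f i x)"
  using assms(2) by (induction I rule: infinite_finite_induct) (auto intro: Ck_on_add[OF assms(1)])

lemma Ck_on_subset:
  assumes "open U" "open V" "V \<subseteq> U"
  shows "Ck_on k U f \<Longrightarrow> Ck_on k V f"
proof (induction k arbitrary: f)
  case 0
  then show ?case using assms(3) continuous_on_subset by auto
next
  case (Suc k)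
  then show ?case using assms(3) differentiable_on_subset by auto
qed

lemma Ck_on_local:
  assumes "open U"
    and "\<And>x. x \<in> U \<Longrightarrow> \<exists>V. open V \<and> x \<in> V \<and> V \<subseteq> U \<and> Ck_on k V f"
  shows "Ck_on k U f"
  using assms(2)
proof (induction k arbitrary: f)
  case 0
  have "isCont f x" if "x \<in> U" for x
    using 0[OF that] continuous_on_eq_continuous_at by auto
  then show ?case using continuous_at_imp_continuous_on by auto
next
  case (Suc k)
  have "f differentiable (at x)" if "x \<in> U" for x
    using Suc.prems[OF that] by (auto simp: differentiable_on_eq_differentiable_at)
  then have "f differentiable_on U"
    by (simp add: assms(1) differentiable_on_eq_differentiable_at)
  moreover have "Ck_on k U (\<lambda>x. frechet_derivative f (at x) v)" for v
  proof (rule Suc.IH)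
    fix x assume "x \<in> U"
    then obtain V where V: "open V" "x \<in> V" "V \<subseteq> U" "Ck_on (Suc k) V f"
      using Suc.prems by blast
    then show "\<exists>V. open V \<and> x \<in> V \<and> V \<subseteq> U \<and> Ck_on k V (\<lambda>x. frechet_derivative f (at x) v)"
      by auto
  qed
  ultimately show ?case by simp
qed

text \<open>The derivative of a composition is \<open>x \<mapsto> Dg (f x) (Df x v)\<close>, where the direction
  depends on the point as well. Expanding the direction in a basis of the (finite-dimensional)
  middle space reduces the problem to directional derivatives of \<open>g\<close> in constant directions.\<close>
lemma Ck_on_compose:
  fixes f :: "'b::real_normed_vector \<Rightarrow> 'c::euclidean_space"
  assumes "open U" "open V" "f ` U \<subseteq> V"
  shows "Ck_on k U f \<Longrightarrow> Ck_on k V g \<Longrightarrow> Ck_on k U (\<lambda>x. g (f x))"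
proof (induction k arbitrary: g)
  case 0
  then show ?case using assms(3) continuous_on_compose2[of V g U f] by simp
next
  case (Suc k)
  obtain f' where f': "\<forall>x\<in>U. (f has_derivative f' x) (at x)" "\<forall>v. Ck_on k U (\<lambda>x. f' x v)"
    using Suc.prems(1) Ck_on_Suc_iff[OF assms(1)] by blast
  obtain g' where g': "\<forall>x\<in>V. (g has_derivative g' x) (at x)" "\<forall>v. Ck_on k V (\<lambda>x. g' x v)"
    using Suc.prems(2) Ck_on_Suc_iff[OF assms(2)] by blast
  have f: "Ck_on k U f" using Suc.prems(1) Ck_on_Suc_imp assms(1) by blast
  let ?h = "\<lambda>x v. \<Sum>b\<in>Basis. (f' x v \<bullet> b) *\<^sub>R g' (f x) b"
  have h: "?h x v = g' (f x) (f' x v)" if "x \<in> U" for x v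
  proof -
    have "linear (g' (f x))"
      using g'(1) that assms(3) has_derivative_linear by blast
    then have "(\<Sum>b\<in>Basis. (f' x v \<bullet> b) *\<^sub>R g' (f x) b) = g' (f x) (\<Sum>b\<in>Basis. (f' x v \<bullet> b) *\<^sub>R b)"
      by (simp add: linear_sum linear_cmul)
    then show ?thesis by (simp add: euclidean_representation)
  qed
  show ?case
    unfolding Ck_on_Suc_iff[OF assms(1)]
  proof (intro exI[of _ "?h"] conjI ballI allI)
    show "((\<lambda>x. g (f x)) has_derivative ?h x) (at x)" if "x \<in> U" for x
      using has_derivative_compose[of f "f' x" x UNIV g "g' (f x)"] f'(1) g'(1) that assms(3) h[OF that]
      by (auto simp: fun_eq_iff)
    show "Ck_on k U (\<lambda>x. ?h x v)" for v
    proof (intro Ck_on_sum[OF assms(1)] Ck_on_bilinear[OF assms(1) bounded_bilinear_scaleR])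
      show "Ck_on k U (\<lambda>x. f' x v \<bullet> b)" for b
        using Ck_on_linear_compose[OF assms(1) bounded_linear_inner_left] f'(2) by blast
      show "Ck_on k U (\<lambda>x. g' (f x) b)" for b
        using Suc.IH[OF f] g'(2) by blast
    qed
  qed
qed

lemma Ck_on_inverse: "Ck_on k (- {0}) (inverse :: real \<Rightarrow> real)"
proof (induction k)
  case 0
  then show ?case by (auto intro!: continuous_intros)
next
  case (Suc k)
  have o: "open (- {0::real})" by auto
  show ?case unfolding Ck_on_Suc_iff[OF o]
  proof (intro exI[of _ "\<lambda>x v. - (inverse x * v * inverse x)"] conjI ballI allI)
    show "(inverse has_derivative (\<lambda>v. - (inverse x * v * inverse x))) (at x)" if "x \<in> - {0}" for x :: real
      using that has_derivative_inverse'[of x UNIV] by auto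
    have "Ck_on k (- {0}) (\<lambda>x::real. (- v) * (inverse x * inverse x))" for v
      by (intro Ck_on_bilinear[OF o bounded_bilinear_mult] Ck_on_const Suc)
    then show "Ck_on k (- {0}) (\<lambda>x::real. - (inverse x * v * inverse x))" for v
      by (simp add: algebra_simps)
  qed
qed

lemma smooth_on_cong:
  "open U \<Longrightarrow> (\<And>x. x \<in> U \<Longrightarrow> f x = g x) \<Longrightarrow> smooth_on U f \<Longrightarrow> smooth_on U g"
  unfolding smooth_on_def using Ck_on_cong_imp by blast

lemma smooth_on_const [simp]: "smooth_on U (\<lambda>x. c)"
  by (simp add: smooth_on_def)

lemma smooth_on_add: "open U \<Longrightarrow> smooth_on U f \<Longrightarrow> smooth_on U g \<Longrightarrow> smooth_on U (\<lambda>x. f x + g x)"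
  by (simp add: smooth_on_def Ck_on_add)

lemma smooth_on_scaleR:
  "open U \<Longrightarrow> smooth_on U f \<Longrightarrow> smooth_on U g \<Longrightarrow> smooth_on U (\<lambda>x. f x *\<^sub>R g x)"
  by (simp add: smooth_on_def Ck_on_bilinear bounded_bilinear_scaleR)

lemma smooth_on_mult:
  fixes f g :: "'b::real_normed_vector \<Rightarrow> real"
  shows "open U \<Longrightarrow> smooth_on U f \<Longrightarrow> smooth_on U g \<Longrightarrow> smooth_on U (\<lambda>x. f x * g x)"
  using smooth_on_scaleR[of U f g] by simp

lemma smooth_on_inner:
  "open U \<Longrightarrow> smooth_on U f \<Longrightarrow> smooth_on U g \<Longrightarrow> smooth_on U (\<lambda>x. f x \<bullet> g x)"
  by (simp add: smooth_on_def Ck_on_bilinear bounded_bilinear_inner)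

lemma smooth_on_linear_compose:
  "open U \<Longrightarrow> bounded_linear L \<Longrightarrow> smooth_on U f \<Longrightarrow> smooth_on U (\<lambda>x. L (f x))"
  by (simp add: smooth_on_def Ck_on_linear_compose)

lemma smooth_on_ident [simp]: "open U \<Longrightarrow> smooth_on U (\<lambda>x. x)"
  by (simp add: smooth_on_def Ck_on_bounded_linear bounded_linear_ident)

lemma smooth_on_minus: "open U \<Longrightarrow> smooth_on U f \<Longrightarrow> smooth_on U (\<lambda>x. - f x)"
  using smooth_on_linear_compose[OF _ bounded_linear_minus[OF bounded_linear_ident]] by auto

lemma smooth_on_diff: "open U \<Longrightarrow> smooth_on U f \<Longrightarrow> smooth_on U g \<Longrightarrow> smooth_on U (\<lambda>x. f x - g x)"
  using smooth_on_add[of U f "\<lambda>x. - g x"] smooth_on_minus[of U g] by simp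

lemma smooth_on_sum:
  "open U \<Longrightarrow> (\<And>i. i \<in> I \<Longrightarrow> smooth_on U (f i)) \<Longrightarrow> smooth_on U (\<lambda>x. \<Sum>i\<in>I. f i x)"
  by (simp add: smooth_on_def Ck_on_sum)

lemma smooth_on_prod:
  fixes f :: "'i \<Rightarrow> 'b::real_normed_vector \<Rightarrow> real"
  assumes "open U" "\<And>i. i \<in> I \<Longrightarrow> smooth_on U (f i)"
  shows "smooth_on U (\<lambda>x. \<Prod>i\<in>I. f i x)"
  using assms(2) by (induction I rule: infinite_finite_induct) (auto intro: smooth_on_mult[OF assms(1)])

lemma smooth_on_subset: "open U \<Longrightarrow> open V \<Longrightarrow> V \<subseteq> U \<Longrightarrow> smooth_on U f \<Longrightarrow> smooth_on V f"
  by (simp add: smooth_on_def Ck_on_subset[of U V])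

lemma smooth_on_local:
  assumes "open U" "\<And>x. x \<in> U \<Longrightarrow> \<exists>V. open V \<and> x \<in> V \<and> V \<subseteq> U \<and> smooth_on V f"
  shows "smooth_on U f"
  unfolding smooth_on_def
proof
  fix k
  show "Ck_on k U f"
  proof (rule Ck_on_local[OF assms(1)])
    fix x assume "x \<in> U"
    then obtain V where "open V" "x \<in> V" "V \<subseteq> U" "smooth_on V f" using assms(2) by blast
    then show "\<exists>V. open V \<and> x \<in> V \<and> V \<subseteq> U \<and> Ck_on k V f"
      by (auto simp: smooth_on_def)
  qed
qed

lemma smooth_on_compose:
  fixes f :: "'b::real_normed_vector \<Rightarrow> 'c::euclidean_space"
  assumes "open U" "open V" "f ` U \<subseteq> V" "smooth_on U f" "smooth_on V g"
  shows "smooth_on U (\<lambda>x. g (f x))"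
  unfolding smooth_on_def
proof
  show "Ck_on k U (\<lambda>x. g (f x))" for k
    using assms(4,5) Ck_on_compose[OF assms(1-3), of k g] by (simp only: smooth_on_def)
qed

lemma smooth_on_divide:
  fixes f g :: "'b::real_normed_vector \<Rightarrow> real"
  assumes "open U" "smooth_on U f" "smooth_on U g" "\<And>x. x \<in> U \<Longrightarrow> g x \<noteq> 0"
  shows "smooth_on U (\<lambda>x. f x / g x)"
proof -
  have "smooth_on (- {0}) (inverse :: real \<Rightarrow> real)"
    by (simp add: smooth_on_def Ck_on_inverse)
  moreover have "open (- {0::real})" by auto
  ultimately have "smooth_on U (\<lambda>x. inverse (g x))"
    by (intro smooth_on_compose[of U "- {0}" g inverse]) (use assms in auto)
  then show ?thesis
    using smooth_on_mult[OF assms(1,2)] by (simp add: divide_inverse)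
qed

lemma smooth_on_differentiable: "open U \<Longrightarrow> smooth_on U f \<Longrightarrow> x \<in> U \<Longrightarrow> f differentiable (at x)"
  unfolding smooth_on_def
  using Ck_on.simps(2)[of 0 U f] by (simp add: differentiable_on_eq_differentiable_at)

lemma smooth_on_has_derivative:
  "open U \<Longrightarrow> smooth_on U f \<Longrightarrow> x \<in> U \<Longrightarrow> (f has_derivative frechet_derivative f (at x)) (at x)"
  using smooth_on_differentiable[of U f x] by (simp add: frechet_derivative_works)

lemma smooth_on_continuous: "smooth_on U f \<Longrightarrow> continuous_on U f"
  unfolding smooth_on_def using Ck_on.simps(1)[of U f] by blast

lemma smooth_on_frechet_const: "smooth_on U f \<Longrightarrow> smooth_on U (\<lambda>x. frechet_derivative f (at x) v)"
  unfolding smooth_on_def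
proof
  assume "\<forall>k. Ck_on k U f"
  then show "Ck_on k U (\<lambda>x. frechet_derivative f (at x) v)" for k
    using Ck_on.simps(2)[of k U f] by blast
qed

lemma smooth_on_frechet:
  fixes w :: "'b::euclidean_space \<Rightarrow> 'b"
  assumes "open U" "smooth_on U f" "smooth_on U w"
  shows "smooth_on U (\<lambda>x. frechet_derivative f (at x) (w x))"
proof -
  have "smooth_on U (\<lambda>x. \<Sum>b\<in>Basis. (w x \<bullet> b) *\<^sub>R frechet_derivative f (at x) b)"
    by (intro smooth_on_sum smooth_on_scaleR smooth_on_inner smooth_on_frechet_const smooth_on_const assms)
  then show ?thesis
  proof (rule smooth_on_cong[OF assms(1), rotated])
    show "(\<Sum>b\<in>Basis. (w x \<bullet> b) *\<^sub>R frechet_derivative f (at x) b) = frechet_derivative f (at x) (w x)"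
    if "x \<in> U" for x
  proof -
    have l: "linear (frechet_derivative f (at x))"
      by (rule linear_frechet_derivative) (rule smooth_on_differentiable[OF assms(1,2) that])
    have "frechet_derivative f (at x) (w x) = frechet_derivative f (at x) (\<Sum>b\<in>Basis. (w x \<bullet> b) *\<^sub>R b)"
      by (simp add: euclidean_representation)
    then show ?thesis using l by (simp add: linear_sum linear_cmul)
  qed
  qed
qed

lemma smooth_on_componentwise:
  fixes f :: "'b::real_normed_vector \<Rightarrow> real ^ 'n::finite"
  assumes "open U" "\<And>i. smooth_on U (\<lambda>x. f x $ i)"
  shows "smooth_on U f"
proof -
  have "smooth_on U (\<lambda>x. \<Sum>i\<in>UNIV. (f x $ i) *\<^sub>R (axis i 1 :: real ^ 'n))"
    by (intro smooth_on_sum smooth_on_scaleR assms smooth_on_const)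
  moreover have "(\<lambda>x. \<Sum>i\<in>UNIV. (f x $ i) *\<^sub>R (axis i 1 :: real ^ 'n)) = f"
    by (rule ext) (simp add: vec_eq_iff axis_def if_distrib[of "\<lambda>t. _ * t"] cong: if_cong)
  ultimately show ?thesis by simp
qed

lemma smooth_on_nth:
  fixes f :: "'b::real_normed_vector \<Rightarrow> real ^ 'n::finite"
  shows "open U \<Longrightarrow> smooth_on U f \<Longrightarrow> smooth_on U (\<lambda>x. f x $ i)"
  using smooth_on_linear_compose[OF _ bounded_linear_vec_nth] by blast

lemma smooth_on_det:
  fixes M :: "'b::real_normed_vector \<Rightarrow> real ^ 'n ^ 'n::finite"
  assumes "open U" "\<And>i j. smooth_on U (\<lambda>x. M x $ i $ j)"
  shows "smooth_on U (\<lambda>x. det (M x))"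
  unfolding det_def
  by (intro smooth_on_sum smooth_on_mult smooth_on_prod smooth_on_const assms)

subsection \<open>Symmetry of second derivatives\<close>

lemma DERIV_along_line:
  fixes f :: "'b::real_normed_vector \<Rightarrow> real"
  assumes "f differentiable (at (p + a *\<^sub>R v))"
  shows "((\<lambda>t. f (p + t *\<^sub>R v)) has_real_derivative frechet_derivative f (at (p + a *\<^sub>R v)) v) (at a)"
proof -
  have 1: "((\<lambda>t. p + t *\<^sub>R v) has_derivative (\<lambda>t. t *\<^sub>R v)) (at a)"
    by (auto intro!: derivative_eq_intros)
  have 2: "(f has_derivative frechet_derivative f (at (p + a *\<^sub>R v))) (at (p + a *\<^sub>R v))"
    using assms by (simp add: frechet_derivative_works)
  have "((\<lambda>t. f (p + t *\<^sub>R v)) has_derivative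
      (\<lambda>t. frechet_derivative f (at (p + a *\<^sub>R v)) (t *\<^sub>R v))) (at a)"
    using has_derivative_compose[OF 1 2] .
  moreover have "(\<lambda>t. frechet_derivative f (at (p + a *\<^sub>R v)) (t *\<^sub>R v)) =
      (*) (frechet_derivative f (at (p + a *\<^sub>R v)) v)"
    using linear_frechet_derivative[OF assms] by (auto simp: linear_cmul)
  ultimately show ?thesis by (simp add: has_field_derivative_def)
qed

lemma second_difference_mean_value:
  fixes f :: "'b::euclidean_space \<Rightarrow> real"
  assumes "open U" "smooth_on U f" "s > 0"
    and U: "\<And>a b. 0 \<le> a \<Longrightarrow> a \<le> s \<Longrightarrow> 0 \<le> b \<Longrightarrow> b \<le> s \<Longrightarrow> x + a *\<^sub>R v + b *\<^sub>R w \<in> U"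
  shows "\<exists>a b. 0 \<le> a \<and> a \<le> s \<and> 0 \<le> b \<and> b \<le> s \<and>
    f (x + s *\<^sub>R v + s *\<^sub>R w) - f (x + s *\<^sub>R v) - f (x + s *\<^sub>R w) + f x =
    s * (s * frechet_derivative (\<lambda>z. frechet_derivative f (at z) v) (at (x + a *\<^sub>R v + b *\<^sub>R w)) w)"
proof -
  let ?D = "\<lambda>z. frechet_derivative f (at z) v"
  have df: "f differentiable (at z)" if "z \<in> U" for z
    using smooth_on_differentiable[OF assms(1,2) that] .
  have dD: "?D differentiable (at z)" if "z \<in> U" for z
    using smooth_on_differentiable[OF assms(1) smooth_on_frechet_const[OF assms(2)] that] .
  define h where "h = (\<lambda>a. f (x + s *\<^sub>R w + a *\<^sub>R v) - f (x + a *\<^sub>R v))"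
  have "\<exists>z>0. z < s \<and> h s - h 0 = (s - 0) * (?D (x + s *\<^sub>R w + z *\<^sub>R v) - ?D (x + z *\<^sub>R v))"
  proof (rule MVT2[OF assms(3)])
    fix a :: real assume a: "0 \<le> a" "a \<le> s"
    have "x + s *\<^sub>R w + a *\<^sub>R v \<in> U" "x + a *\<^sub>R v \<in> U"
      using U[of a s] U[of a 0] a assms(3) by (simp_all add: algebra_simps)
    then show "(h has_real_derivative (?D (x + s *\<^sub>R w + a *\<^sub>R v) - ?D (x + a *\<^sub>R v))) (at a)"
      unfolding h_def by (intro DERIV_diff DERIV_along_line df)
  qed
  then obtain a where a: "0 < a" "a < s"
    "h s - h 0 = s * (?D (x + s *\<^sub>R w + a *\<^sub>R v) - ?D (x + a *\<^sub>R v))" by auto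
  have "\<exists>z>0. z < s \<and> ?D (x + a *\<^sub>R v + s *\<^sub>R w) - ?D (x + a *\<^sub>R v + 0 *\<^sub>R w) =
      (s - 0) * frechet_derivative ?D (at (x + a *\<^sub>R v + z *\<^sub>R w)) w"
    by (rule MVT2[OF assms(3)]) (intro DERIV_along_line dD U, use a in auto)
  then obtain b where b: "0 < b" "b < s" "?D (x + a *\<^sub>R v + s *\<^sub>R w) - ?D (x + a *\<^sub>R v) =
      s * frechet_derivative ?D (at (x + a *\<^sub>R v + b *\<^sub>R w)) w" by auto
  have "h s - h 0 = f (x + s *\<^sub>R v + s *\<^sub>R w) - f (x + s *\<^sub>R v) - f (x + s *\<^sub>R w) + f x"
    by (simp add: h_def algebra_simps)
  moreover have "x + s *\<^sub>R w + a *\<^sub>R v = x + a *\<^sub>R v + s *\<^sub>R w" by simp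
  ultimately show ?thesis
    using a b by (intro exI[of _ a] exI[of _ b]) simp
qed

text \<open>Both mixed second derivatives, taken at suitable points near \<open>x\<close>, equal the same second
  difference quotient; continuity then identifies their values at \<open>x\<close>.\<close>

lemma frechet_derivative_commute:
  fixes f :: "'b::euclidean_space \<Rightarrow> real"
  assumes "open U" "smooth_on U f" "x \<in> U"
  shows "frechet_derivative (\<lambda>z. frechet_derivative f (at z) v) (at x) w =
    frechet_derivative (\<lambda>z. frechet_derivative f (at z) w) (at x) v"
proof -
  define A where "A y = frechet_derivative (\<lambda>z. frechet_derivative f (at z) v) (at y) w" for y
  define B where "B y = frechet_derivative (\<lambda>z. frechet_derivative f (at z) w) (at y) v" for y
  have "smooth_on U A" "smooth_on U B"
    unfolding A_def B_def by (intro smooth_on_frechet_const assms)+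
  then have cont: "isCont A x" "isCont B x"
    using smooth_on_continuous continuous_on_eq_continuous_at assms by blast+
  have "\<bar>A x - B x\<bar> < 2 * e" if "e > 0" for e :: real
  proof -
    obtain d1 where d1: "d1 > 0" "\<And>y. dist y x < d1 \<Longrightarrow> \<bar>A y - A x\<bar> < e"
      using cont(1) \<open>e > 0\<close> unfolding continuous_at_eps_delta dist_real_def by blast
    obtain d2 where d2: "d2 > 0" "\<And>y. dist y x < d2 \<Longrightarrow> \<bar>B y - B x\<bar> < e"
      using cont(2) \<open>e > 0\<close> unfolding continuous_at_eps_delta dist_real_def by blast
    obtain d3 where d3: "d3 > 0" "ball x d3 \<subseteq> U"
      using assms(1,3) open_contains_ball by blast
    define d where "d = min d1 (min d2 d3)"
    have "d > 0" using d1 d2 d3 by (simp add: d_def)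
    define L where "L = norm v + norm w + 1"
    have pos: "L > 0" by (simp add: L_def add_nonneg_pos)
    define s where "s = d / (2 * L)"
    have "s > 0" using \<open>d > 0\<close> pos by (simp add: s_def)
    have near: "dist (x + a *\<^sub>R v + b *\<^sub>R w) x < d"
      if "0 \<le> a" "a \<le> s" "0 \<le> b" "b \<le> s" for a b
    proof -
      have "norm (a *\<^sub>R v + b *\<^sub>R w) \<le> a * norm v + b * norm w"
        using norm_triangle_ineq[of "a *\<^sub>R v" "b *\<^sub>R w"] that by simp
      also have "\<dots> \<le> s * norm v + s * norm w"
        using that by (intro add_mono mult_right_mono) auto
      also have "\<dots> \<le> s * L"
        using \<open>s > 0\<close> by (simp add: L_def algebra_simps)
      also have "\<dots> = d / 2" using pos by (simp add: s_def)
      also have "\<dots> < d" using \<open>d > 0\<close> by simp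
      finally show ?thesis by (simp add: dist_norm add.assoc)
    qed
    have inU: "x + a *\<^sub>R v + b *\<^sub>R w \<in> U" if "0 \<le> a" "a \<le> s" "0 \<le> b" "b \<le> s" for a b
      using near[OF that] d3 by (auto simp: d_def dist_commute subset_iff)
    have inU': "x + a *\<^sub>R w + b *\<^sub>R v \<in> U" if "0 \<le> a" "a \<le> s" "0 \<le> b" "b \<le> s" for a b
      using inU[OF that(3,4,1,2)] by (simp add: algebra_simps)
    obtain a b where ab: "0 \<le> a" "a \<le> s" "0 \<le> b" "b \<le> s"
      "f (x + s *\<^sub>R v + s *\<^sub>R w) - f (x + s *\<^sub>R v) - f (x + s *\<^sub>R w) + f x
        = s * (s * A (x + a *\<^sub>R v + b *\<^sub>R w))"
      using second_difference_mean_value[OF assms(1,2) \<open>s > 0\<close> inU] unfolding A_def by blast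
    obtain a' b' where ab': "0 \<le> a'" "a' \<le> s" "0 \<le> b'" "b' \<le> s"
      "f (x + s *\<^sub>R w + s *\<^sub>R v) - f (x + s *\<^sub>R w) - f (x + s *\<^sub>R v) + f x
        = s * (s * B (x + a' *\<^sub>R w + b' *\<^sub>R v))"
      using second_difference_mean_value[OF assms(1,2) \<open>s > 0\<close> inU'] unfolding B_def by blast
    have swap: "x + s *\<^sub>R w + s *\<^sub>R v = x + s *\<^sub>R v + s *\<^sub>R w"
      "x + a' *\<^sub>R w + b' *\<^sub>R v = x + b' *\<^sub>R v + a' *\<^sub>R w" by simp_all
    then have "s * (s * A (x + a *\<^sub>R v + b *\<^sub>R w)) = s * (s * B (x + b' *\<^sub>R v + a' *\<^sub>R w))"
      using ab(5) ab'(5)[unfolded swap] by linarith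
    then have "A (x + a *\<^sub>R v + b *\<^sub>R w) = B (x + b' *\<^sub>R v + a' *\<^sub>R w)"
      using \<open>s > 0\<close> by simp
    moreover have "\<bar>A (x + a *\<^sub>R v + b *\<^sub>R w) - A x\<bar> < e"
      using near[OF ab(1-4)] by (intro d1) (simp add: d_def)
    moreover have "\<bar>B (x + b' *\<^sub>R v + a' *\<^sub>R w) - B x\<bar> < e"
      using near[OF ab'(3,4,1,2)] by (intro d2) (simp add: d_def)
    ultimately show ?thesis by linarith
  qed
  from this[of "\<bar>A x - B x\<bar> / 2"] have "A x = B x" by fastforce
  then show ?thesis by (simp add: A_def B_def)
qed

text \<open>A directional derivative whose direction varies with the point obeys a product rule. The first
  summand is symmetric in the two directions involved, the second one is what survives in a bracket.\<close>

lemma frechet_derivative_along_field: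
  fixes F :: "'b::euclidean_space \<Rightarrow> 'c::real_normed_vector" and w :: "'b \<Rightarrow> 'b"
  assumes "open U" "smooth_on U F" "smooth_on U w" "x \<in> U"
  shows "frechet_derivative (\<lambda>z. frechet_derivative F (at z) (w z)) (at x) v =
    frechet_derivative (\<lambda>z. frechet_derivative F (at z) (w x)) (at x) v
    + frechet_derivative F (at x) (frechet_derivative w (at x) v)"
proof -
  let ?D = "\<lambda>b z. frechet_derivative F (at z) b"
  have lin: "linear (\<lambda>u. frechet_derivative F (at z) u)" if "z \<in> U" for z
    using linear_frechet_derivative[OF smooth_on_differentiable[OF assms(1,2) that]] by simp
  have expand: "?D u z = (\<Sum>b\<in>Basis. (u \<bullet> b) *\<^sub>R ?D b z)" if "z \<in> U" for z u
  proof -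
    have "?D u z = ?D (\<Sum>b\<in>Basis. (u \<bullet> b) *\<^sub>R b) z" by (simp add: euclidean_representation)
    then show ?thesis using lin[OF that] by (simp add: linear_sum linear_cmul)
  qed
  have dw: "(w has_derivative frechet_derivative w (at x)) (at x)"
    by (rule smooth_on_has_derivative[OF assms(1,3,4)])
  have dD: "(?D b has_derivative frechet_derivative (?D b) (at x)) (at x)" for b
    by (rule smooth_on_has_derivative[OF assms(1) smooth_on_frechet_const[OF assms(2)] assms(4)])
  have 1: "((\<lambda>z. \<Sum>b\<in>Basis. (w z \<bullet> b) *\<^sub>R ?D b z) has_derivative
      (\<lambda>v. \<Sum>b\<in>Basis. (w x \<bullet> b) *\<^sub>R frechet_derivative (?D b) (at x) v
        + (frechet_derivative w (at x) v \<bullet> b) *\<^sub>R ?D b x)) (at x)"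
    by (intro has_derivative_sum has_derivative_scaleR has_derivative_inner_left dw dD)
  have 2: "((\<lambda>z. \<Sum>b\<in>Basis. (w x \<bullet> b) *\<^sub>R ?D b z) has_derivative
      (\<lambda>v. \<Sum>b\<in>Basis. (w x \<bullet> b) *\<^sub>R frechet_derivative (?D b) (at x) v)) (at x)"
    by (intro has_derivative_sum has_derivative_scaleR_right dD)
  have 3: "((\<lambda>z. ?D (w z) z) has_derivative
      (\<lambda>v. \<Sum>b\<in>Basis. (w x \<bullet> b) *\<^sub>R frechet_derivative (?D b) (at x) v
        + (frechet_derivative w (at x) v \<bullet> b) *\<^sub>R ?D b x)) (at x)"
    by (rule has_derivative_transform_within_open[OF 1 assms(1,4)]) (simp add: expand)
  have 4: "((\<lambda>z. ?D (w x) z) has_derivative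
      (\<lambda>v. \<Sum>b\<in>Basis. (w x \<bullet> b) *\<^sub>R frechet_derivative (?D b) (at x) v)) (at x)"
    by (rule has_derivative_transform_within_open[OF 2 assms(1,4)]) (simp add: expand)
  show ?thesis
    unfolding fun_cong[OF frechet_derivative_at[OF 3, symmetric], of v]
      fun_cong[OF frechet_derivative_at[OF 4, symmetric], of v]
    by (simp add: sum.distrib expand[OF assms(4), of "frechet_derivative w (at x) v"])
qed

subsection \<open>Smooth bump functions\<close>

text \<open>The family \<open>exp (- 1 / x) / x ^ k\<close>, extended by zero to \<open>x \<le> 0\<close>, is closed under
  differentiation up to linear combinations; that is why the powers \<open>k\<close> are carried along.\<close>

definition flat_exp :: "nat \<Rightarrow> real \<Rightarrow> real" where
  "flat_exp k x = (if x > 0 then exp (- 1 / x) / x ^ k else 0)"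

lemma flat_exp_tendsto_0: "(flat_exp k \<longlongrightarrow> 0) (at 0)"
proof -
  have "((\<lambda>x::real. x ^ k / exp x) \<longlongrightarrow> 0) at_top"
    by (rule tendsto_power_div_exp_0)
  then have "((\<lambda>x::real. inverse x ^ k / exp (inverse x)) \<longlongrightarrow> 0) (at_right 0)"
    using filterlim_compose filterlim_inverse_at_top_right by blast
  moreover have "\<forall>\<^sub>F x in at_right 0. inverse x ^ k / exp (inverse x) = flat_exp k x"
    unfolding eventually_at_right_field
    by (intro exI[of _ 1]) (auto simp: flat_exp_def exp_minus field_simps)
  ultimately have "(flat_exp k \<longlongrightarrow> 0) (at_right 0)"
    by (rule Lim_transform_eventually)
  moreover have "(flat_exp k \<longlongrightarrow> 0) (at_left 0)"
    by (rule Lim_transform_eventually[OF tendsto_const])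
       (auto simp: eventually_at_left_field flat_exp_def intro!: exI[of _ "-1"])
  ultimately show ?thesis by (simp add: filterlim_at_split)
qed

lemma flat_exp_DERIV:
  "(flat_exp k has_real_derivative (flat_exp (k + 2) x - real k * flat_exp (k + 1) x)) (at x)"
proof -
  consider "x > 0" | "x < 0" | "x = 0" by linarith
  then show ?thesis
  proof cases
    case 1
    have "((\<lambda>x. exp (- 1 / x) / x ^ k) has_real_derivative
        (flat_exp (k + 2) x - real k * flat_exp (k + 1) x)) (at x)"
    proof (rule DERIV_cong)
      show "((\<lambda>x. exp (- 1 / x) / x ^ k) has_real_derivative
          (exp (- 1 / x) * (1 / (x * x)) * x ^ k - exp (- 1 / x) * (real k * x ^ (k - 1))) / (x ^ k * x ^ k)) (at x)"
        using 1 by (auto intro!: derivative_eq_intros)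
      have "real k * x ^ (k - 1) = real k * x ^ k / x" using 1 by (cases k) auto
      then show "(exp (- 1 / x) * (1 / (x * x)) * x ^ k - exp (- 1 / x) * (real k * x ^ (k - 1))) / (x ^ k * x ^ k)
          = flat_exp (k + 2) x - real k * flat_exp (k + 1) x"
        using 1 by (auto simp: flat_exp_def field_simps)
    qed
    then show ?thesis
      by (rule has_field_derivative_transform_within_open[of _ _ _ "{0<..}"])
         (use 1 in \<open>auto simp: flat_exp_def\<close>)
  next
    case 2
    have "((\<lambda>x. 0) has_real_derivative (flat_exp (k + 2) x - real k * flat_exp (k + 1) x)) (at x)"
      using 2 by (simp add: flat_exp_def)
    then show ?thesis
      by (rule has_field_derivative_transform_within_open[of _ _ _ "{..<0}"])
         (use 2 in \<open>auto simp: flat_exp_def\<close>)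
  next
    case 3
    have "(\<lambda>h. (flat_exp k (0 + h) - flat_exp k 0) / h) = flat_exp (k + 1)"
      by (auto simp: flat_exp_def fun_eq_iff)
    then have "(flat_exp k has_real_derivative 0) (at 0)"
      using flat_exp_tendsto_0[of "k + 1"] by (simp add: DERIV_def)
    then show ?thesis using 3 by (simp add: flat_exp_def)
  qed
qed

lemma smooth_on_flat_exp: "smooth_on UNIV (flat_exp k)"
proof -
  have o: "open (UNIV :: real set)" by simp
  have "Ck_on m UNIV (flat_exp k)" for m
  proof (induction m arbitrary: k)
    case 0
    then show ?case
      using DERIV_isCont[OF flat_exp_DERIV] by (simp add: continuous_at_imp_continuous_on)
  next
    case (Suc m)
    show ?case unfolding Ck_on_Suc_iff[OF o]
    proof (intro exI conjI ballI allI)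
      show "(flat_exp k has_derivative (\<lambda>v. (flat_exp (k + 2) x + (- real k) * flat_exp (k + 1) x) * v)) (at x)" for x
        using flat_exp_DERIV[of k x] by (simp add: has_field_derivative_def)
      show "Ck_on m UNIV (\<lambda>x. (flat_exp (k + 2) x + (- real k) * flat_exp (k + 1) x) * v)" for v
        by (intro Ck_on_bilinear[OF o bounded_bilinear_mult] Ck_on_add[OF o] Ck_on_const Suc)
    qed
  qed
  then show ?thesis by (simp add: smooth_on_def)
qed

lemma bump_function_exists:
  fixes x :: "'b::euclidean_space"
  assumes "open U" "x \<in> U"
  obtains \<beta> V K where "smooth_on UNIV (\<beta> :: 'b \<Rightarrow> real)"
    "open V" "x \<in> V" "\<forall>y\<in>V. \<beta> y = 1"
    "compact K" "K \<subseteq> U" "\<forall>y. y \<notin> K \<longrightarrow> \<beta> y = 0"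
proof -
  obtain r where r: "r > 0" "cball x r \<subseteq> U"
    using assms open_contains_cball by blast
  define u where "u y = (y - x) \<bullet> (y - x)" for y
  have u: "smooth_on UNIV u"
    unfolding u_def by (intro smooth_on_inner smooth_on_diff smooth_on_ident smooth_on_const) auto
  have u_norm: "u y = (dist x y)\<^sup>2" for y
    by (metis u_def dist_norm dist_commute power2_norm_eq_inner)
  define \<beta> where "\<beta> y = flat_exp 0 (r\<^sup>2 - u y) / (flat_exp 0 (r\<^sup>2 - u y) + flat_exp 0 (u y - r\<^sup>2 / 2))" for y
  \<comment> \<open>The arguments of the two summands add up to \<open>r\<^sup>2 / 2 > 0\<close>, so one of them is positive.\<close>
  have pos: "flat_exp 0 (r\<^sup>2 - u y) + flat_exp 0 (u y - r\<^sup>2 / 2) \<noteq> 0" for y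
  proof -
    have "0 < r\<^sup>2 - u y \<or> 0 < u y - r\<^sup>2 / 2" using r by (smt (verit) field_sum_of_halves zero_less_power)
    moreover have "flat_exp 0 t \<ge> 0" "t > 0 \<Longrightarrow> flat_exp 0 t > 0" for t by (auto simp: flat_exp_def)
    ultimately show ?thesis by (metis add_nonneg_pos add_pos_nonneg less_irrefl)
  qed
  have comp: "smooth_on UNIV (\<lambda>y. flat_exp 0 (f y))" if "smooth_on UNIV f" for f :: "'b \<Rightarrow> real"
    by (rule smooth_on_compose[OF open_UNIV open_UNIV _ that smooth_on_flat_exp]) simp
  show ?thesis
  proof (rule that[of \<beta> "{y. u y < r\<^sup>2 / 2}" "cball x r"])
    show "smooth_on UNIV \<beta>"
      unfolding \<beta>_def
      by (intro smooth_on_divide smooth_on_add comp smooth_on_diff u smooth_on_const pos) auto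
    show "\<forall>y\<in>{y. u y < r\<^sup>2 / 2}. \<beta> y = 1"
    proof
      fix y assume "y \<in> {y. u y < r\<^sup>2 / 2}"
      then have "flat_exp 0 (u y - r\<^sup>2 / 2) = 0" by (simp add: flat_exp_def)
      then show "\<beta> y = 1" using pos[of y] by (simp add: \<beta>_def)
    qed
    show "open {y. u y < r\<^sup>2 / 2}"
      by (intro open_Collect_less smooth_on_continuous u) simp
    show "x \<in> {y. u y < r\<^sup>2 / 2}" using r by (simp add: u_def)
    show "\<forall>y. y \<notin> cball x r \<longrightarrow> \<beta> y = 0"
    proof (intro allI impI)
      fix y assume "y \<notin> cball x r"
      then have "r\<^sup>2 < (dist x y)\<^sup>2" using r by (intro power_strict_mono) auto
      then show "\<beta> y = 0" by (simp add: \<beta>_def flat_exp_def u_norm)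
    qed
  qed (use r in auto)
qed

section \<open>Calculus on a smooth manifold\<close>

locale manifold =
  fixes A :: "('a::{t2_space, second_countable_topology}, 'n::finite) chart set"
  assumes smooth_manifold: "smooth_manifold A"
begin

abbreviation transition :: "('a, 'n) chart \<Rightarrow> ('a, 'n) chart \<Rightarrow> real ^ 'n \<Rightarrow> real ^ 'n" where
  "transition c d \<equiv> snd d \<circ> chart_inv c"

lemma chart_at_in: "chart_at A p \<in> A" and chart_at_mem: "p \<in> fst (chart_at A p)"
proof -
  have "\<exists>c. c \<in> A \<and> p \<in> fst c"
    using smooth_manifold unfolding smooth_manifold_def by blast
  then have "chart_at A p \<in> A \<and> p \<in> fst (chart_at A p)"
    unfolding chart_at_def by (rule someI_ex)
  then show "chart_at A p \<in> A" "p \<in> fst (chart_at A p)" by auto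
qed

context
  fixes c :: "('a, 'n) chart"
  assumes c: "c \<in> A"
begin

lemma chart_homeomorphism: "homeomorphism (fst c) (chart_image c) (snd c) (chart_inv c)"
  and open_chart_dom: "open (fst c)"
  and open_chart_image: "open (chart_image c)"
  using smooth_manifold c unfolding smooth_manifold_def by blast+

lemma chart_inv_chart: "q \<in> fst c \<Longrightarrow> chart_inv c (snd c q) = q"
  using chart_homeomorphism by (simp add: homeomorphism_def)

lemma chart_chart_inv: "x \<in> chart_image c \<Longrightarrow> snd c (chart_inv c x) = x"
  using chart_homeomorphism by (simp add: homeomorphism_def)

lemma chart_in_image: "q \<in> fst c \<Longrightarrow> snd c q \<in> chart_image c"
  by (simp add: chart_image_def)

lemma chart_inv_in: "x \<in> chart_image c \<Longrightarrow> chart_inv c x \<in> fst c"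
  using chart_homeomorphism by (auto simp: homeomorphism_def)

lemma image_chart_eq: "snd c ` (fst c \<inter> W) = chart_image c \<inter> chart_inv c -` W"
proof
  show "snd c ` (fst c \<inter> W) \<subseteq> chart_image c \<inter> chart_inv c -` W"
    using chart_inv_chart chart_in_image by auto
  show "chart_image c \<inter> chart_inv c -` W \<subseteq> snd c ` (fst c \<inter> W)"
  proof
    fix x assume "x \<in> chart_image c \<inter> chart_inv c -` W"
    then have "x = snd c (chart_inv c x)" "chart_inv c x \<in> fst c \<inter> W"
      using chart_chart_inv chart_inv_in by auto
    then show "x \<in> snd c ` (fst c \<inter> W)" by blast
  qed
qed

lemma open_image_chart: "open W \<Longrightarrow> open (snd c ` (fst c \<inter> W))"
  unfolding image_chart_eq
  using chart_homeomorphism open_chart_image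
  by (intro continuous_open_preimage) (auto simp: homeomorphism_def)

lemma open_image_chart': "open W \<Longrightarrow> W \<subseteq> fst c \<Longrightarrow> open (snd c ` W)"
  using open_image_chart[of W] by (simp add: inf.absorb2)

lemma smooth_trans: "d \<in> A \<Longrightarrow> smooth_on (snd c ` (fst c \<inter> fst d)) (transition c d)"
  using smooth_manifold c unfolding smooth_manifold_def by blast

end

lemma open_overlap: "c \<in> A \<Longrightarrow> d \<in> A \<Longrightarrow> open (snd c ` (fst c \<inter> fst d))"
  by (intro open_image_chart open_chart_dom)

lemma trans_differentiable:
  assumes "c \<in> A" "d \<in> A" "q \<in> fst c" "q \<in> fst d"
  shows "transition c d differentiable (at (snd c q))"
  by (rule smooth_on_differentiable[OF open_overlap[OF assms(1,2)] smooth_trans[OF assms(1,2)]])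
     (use assms in auto)

lemma linear_vec_in_chart:
  assumes "c \<in> A" "q \<in> fst c"
  shows "linear (vec_in_chart A c q)"
proof -
  have "linear (frechet_derivative (transition (chart_at A q) c) (at (snd (chart_at A q) q)))"
    by (rule linear_frechet_derivative[OF trans_differentiable])
       (auto simp: assms chart_at_in chart_at_mem)
  then show ?thesis by (simp add: vec_in_chart_def[abs_def])
qed

lemma vec_in_own_chart: "vec_in_chart A (chart_at A p) p v = v"
proof -
  let ?c = "chart_at A p"
  have "((\<lambda>x. x) has_derivative (\<lambda>x. x)) (at (snd ?c p))" by simp
  then have "(transition ?c ?c has_derivative (\<lambda>x. x)) (at (snd ?c p))"
    by (rule has_derivative_transform_within_open[where s = "chart_image ?c"])
       (auto simp: chart_at_in chart_at_mem open_chart_image chart_in_image chart_chart_inv)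
  from frechet_derivative_at[OF this] show ?thesis
    by (simp add: vec_in_chart_def fun_eq_iff)
qed

text \<open>The tangent space at \<open>q\<close> is modelled by a chart that jumps with \<open>q\<close>. The chain rule for transition
  maps removes this choice: components with respect to a fixed chart transform by the Jacobian.\<close>

lemma vec_in_chart_change:
  assumes "c \<in> A" "d \<in> A" "q \<in> fst c" "q \<in> fst d"
  shows "vec_in_chart A d q v = frechet_derivative (transition c d) (at (snd c q)) (vec_in_chart A c q v)"
proof -
  let ?e = "chart_at A q"
  have e: "?e \<in> A" "q \<in> fst ?e" by (simp_all add: chart_at_in chart_at_mem)
  have inv: "chart_inv ?e (snd ?e q) = q" using chart_inv_chart e by simp
  have 1: "(transition ?e c has_derivative frechet_derivative (transition ?e c) (at (snd ?e q))) (at (snd ?e q))"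
    using trans_differentiable[of ?e c q] assms e by (simp add: frechet_derivative_works)
  have 2: "(transition c d has_derivative frechet_derivative (transition c d) (at (snd c q)))
      (at (transition ?e c (snd ?e q)))"
    using trans_differentiable[of c d q] assms by (simp add: frechet_derivative_works inv)
  have "((\<lambda>x. transition c d (transition ?e c x)) has_derivative
      (\<lambda>v. frechet_derivative (transition c d) (at (snd c q)) (frechet_derivative (transition ?e c) (at (snd ?e q)) v)))
      (at (snd ?e q))"
    by (rule has_derivative_compose[OF 1 2])
  then have "(transition ?e d has_derivative
      (\<lambda>v. frechet_derivative (transition c d) (at (snd c q)) (frechet_derivative (transition ?e c) (at (snd ?e q)) v)))
      (at (snd ?e q))"
  proof (rule has_derivative_transform_within_open[OF _ open_overlap[OF e(1) assms(1)]])
    show "snd ?e q \<in> snd ?e ` (fst ?e \<inter> fst c)" using e(2) assms(3) by blast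
    fix x assume "x \<in> snd ?e ` (fst ?e \<inter> fst c)"
    then obtain q' where q': "q' \<in> fst ?e" "q' \<in> fst c" "x = snd ?e q'" by blast
    show "transition c d (transition ?e c x) = transition ?e d x"
      by (simp add: q' chart_inv_chart[OF e(1)] chart_inv_chart[OF assms(1)])
  qed
  from frechet_derivative_at[OF this] show ?thesis
    by (simp add: vec_in_chart_def fun_eq_iff)
qed

text \<open>The components of a tangent vector at \<open>q\<close> in the chosen chart, recovered from its components
  in \<open>c\<close>.\<close>

definition vec_from_chart :: "('a, 'n) chart \<Rightarrow> 'a \<Rightarrow> real ^ 'n \<Rightarrow> real ^ 'n" where
  "vec_from_chart c q v = frechet_derivative (transition c (chart_at A q)) (at (snd c q)) v"

lemma vec_from_in_chart: "c \<in> A \<Longrightarrow> q \<in> fst c \<Longrightarrow> vec_from_chart c q (vec_in_chart A c q v) = v"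
  using vec_in_chart_change[of c "chart_at A q" q v]
  by (simp add: vec_from_chart_def chart_at_in chart_at_mem vec_in_own_chart)

lemma vec_in_chart_inject:
  assumes "c \<in> A" "q \<in> fst c"
  shows "vec_in_chart A c q v = vec_in_chart A c q w \<longleftrightarrow> v = w"
proof
  assume "vec_in_chart A c q v = vec_in_chart A c q w"
  then have "vec_from_chart c q (vec_in_chart A c q v) = vec_from_chart c q (vec_in_chart A c q w)"
    by simp
  then show "v = w" by (simp only: vec_from_in_chart[OF assms])
qed simp

lemma vec_in_from_chart:
  assumes "c \<in> A" "q \<in> fst c"
  shows "vec_in_chart A c q (vec_from_chart c q v) = v"
proof -
  have "surj (vec_in_chart A c q)"
    by (rule linear_inj_imp_surj[OF linear_vec_in_chart[OF assms]])
       (rule injI, simp add: vec_in_chart_inject[OF assms])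
  from surjD[OF this, of v] obtain w where "v = vec_in_chart A c q w" ..
  then show ?thesis by (simp add: vec_from_in_chart[OF assms])
qed

lemma linear_vec_from_chart:
  assumes "c \<in> A" "q \<in> fst c"
  shows "linear (vec_from_chart c q)"
  unfolding vec_from_chart_def
  using linear_frechet_derivative[OF trans_differentiable[of c "chart_at A q" q]] assms
  by (simp add: chart_at_in chart_at_mem)

subsection \<open>Smooth functions and vector fields\<close>

lemma smooth_fun_in_chart: "smooth_fun A f \<Longrightarrow> c \<in> A \<Longrightarrow> smooth_on (chart_image c) (f \<circ> chart_inv c)"
  by (simp add: smooth_fun_def)

lemma vector_field_in_chart:
  "X \<in> vector_fields A \<Longrightarrow> c \<in> A \<Longrightarrow> smooth_on (chart_image c) (field_in_chart A c X)"
  by (simp add: vector_fields_def)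

lemma image_trans_subset:
  assumes "c \<in> A" "d \<in> A" "W \<subseteq> fst c"
  shows "transition d c ` (snd d ` (fst d \<inter> W)) \<subseteq> snd c ` W"
  using assms(3) chart_inv_chart[OF assms(2)] by auto

lemma smooth_trans_subset:
  assumes "c \<in> A" "d \<in> A" "open W" "W \<subseteq> fst c"
  shows "smooth_on (snd d ` (fst d \<inter> W)) (transition d c)"
  by (rule smooth_on_subset[OF open_overlap[OF assms(2,1)] open_image_chart[OF assms(2,3)] _
        smooth_trans[OF assms(2,1)]]) (use assms(4) in auto)

text \<open>Smooth transition maps carry smoothness near a point from one chart to all others, so it suffices
  to check one chart around each point.\<close>

lemma smooth_fun_local:
  assumes "\<And>p. \<exists>c\<in>A. \<exists>W. open W \<and> p \<in> W \<and> W \<subseteq> fst c \<and> smooth_on (snd c ` W) (f \<circ> chart_inv c)"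
  shows "smooth_fun A f"
  unfolding smooth_fun_def
proof (intro ballI smooth_on_local)
  fix d x assume d: "d \<in> A" and x: "x \<in> chart_image d"
  obtain c W where W: "c \<in> A" "open W" "chart_inv d x \<in> W" "W \<subseteq> fst c"
    "smooth_on (snd c ` W) (f \<circ> chart_inv c)"
    using assms by blast
  let ?V = "snd d ` (fst d \<inter> W)"
  have V: "open ?V" using open_image_chart[OF d W(2)] .
  have "smooth_on ?V (\<lambda>y. (f \<circ> chart_inv c) (transition d c y))"
    by (rule smooth_on_compose[OF V open_image_chart'[OF W(1,2,4)]
          image_trans_subset[OF W(1) d W(4)] smooth_trans_subset[OF W(1) d W(2,4)] W(5)])
  then have "smooth_on ?V (f \<circ> chart_inv d)"
    by (rule smooth_on_cong[OF V, rotated]) (use W(4) chart_inv_chart[OF d] chart_inv_chart[OF W(1)] in auto)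
  moreover have "x \<in> ?V" using x W(3) d by (simp add: image_chart_eq)
  moreover have "?V \<subseteq> chart_image d" using chart_in_image[OF d] by auto
  ultimately show "\<exists>V. open V \<and> x \<in> V \<and> V \<subseteq> chart_image d \<and> smooth_on V (f \<circ> chart_inv d)"
    using V by blast
qed (use open_chart_image in auto)

lemma vector_field_local:
  assumes "\<And>p. \<exists>c\<in>A. \<exists>W. open W \<and> p \<in> W \<and> W \<subseteq> fst c \<and> smooth_on (snd c ` W) (field_in_chart A c X)"
  shows "X \<in> vector_fields A"
  unfolding vector_fields_def mem_Collect_eq
proof (intro ballI smooth_on_local)
  fix d x assume d: "d \<in> A" and x: "x \<in> chart_image d"
  obtain c W where W: "c \<in> A" "open W" "chart_inv d x \<in> W" "W \<subseteq> fst c"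
    "smooth_on (snd c ` W) (field_in_chart A c X)"
    using assms by blast
  let ?V = "snd d ` (fst d \<inter> W)"
  have V: "open ?V" using open_image_chart[OF d W(2)] .
  have oW: "open (snd c ` W)" by (rule open_image_chart'[OF W(1,2,4)])
  let ?W = "W \<inter> fst d"
  have oW': "open (snd c ` ?W)" using W open_chart_dom[OF d] by (intro open_image_chart'[OF W(1)]) auto
  have 1: "smooth_on (snd c ` ?W) (transition c d)"
    by (rule smooth_on_subset[OF open_overlap[OF W(1) d] oW' _ smooth_trans[OF W(1) d]]) (use W(4) in auto)
  have 2: "smooth_on (snd c ` ?W) (field_in_chart A c X)"
    by (rule smooth_on_subset[OF oW oW' _ W(5)]) auto
  have 3: "smooth_on (snd c ` ?W) (\<lambda>y. frechet_derivative (transition c d) (at y) (field_in_chart A c X y))"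
    by (rule smooth_on_frechet[OF oW' 1 2])
  have "smooth_on ?V (\<lambda>y. (\<lambda>y. frechet_derivative (transition c d) (at y) (field_in_chart A c X y)) (transition d c y))"
    by (rule smooth_on_compose[OF V oW' _ smooth_trans_subset[OF W(1) d W(2,4)] 3])
       (use W(4) chart_inv_chart[OF d] in auto)
  then have "smooth_on ?V (field_in_chart A d X)"
  proof (rule smooth_on_cong[OF V, rotated])
    fix y assume "y \<in> ?V"
    then obtain q where q: "q \<in> fst d" "q \<in> W" "y = snd d q" by auto
    then have "q \<in> fst c" using W(4) by auto
    then show "frechet_derivative (transition c d) (at (transition d c y)) (field_in_chart A c X (transition d c y))
        = field_in_chart A d X y"
      using q W(1) d by (simp add: field_in_chart_def chart_inv_chart vec_in_chart_change[of c d q])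
  qed
  moreover have "x \<in> ?V" using x W(3) d by (simp add: image_chart_eq)
  moreover have "?V \<subseteq> chart_image d" using chart_in_image[OF d] by auto
  ultimately show "\<exists>V. open V \<and> x \<in> V \<and> V \<subseteq> chart_image d \<and> smooth_on V (field_in_chart A d X)"
    using V by blast
qed (use open_chart_image in auto)

lemma smooth_fun_const [simp]: "smooth_fun A (\<lambda>p. k)"
  by (simp add: smooth_fun_def o_def)

lemma smooth_fun_add: "smooth_fun A f \<Longrightarrow> smooth_fun A h \<Longrightarrow> smooth_fun A (\<lambda>p. f p + h p)"
  by (simp add: smooth_fun_def o_def smooth_on_add open_chart_image)

lemma smooth_fun_mult: "smooth_fun A f \<Longrightarrow> smooth_fun A h \<Longrightarrow> smooth_fun A (\<lambda>p. f p * h p)"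
  by (simp add: smooth_fun_def o_def smooth_on_mult open_chart_image)

lemma smooth_fun_minus: "smooth_fun A f \<Longrightarrow> smooth_fun A (\<lambda>p. - f p)"
  by (simp add: smooth_fun_def o_def smooth_on_minus open_chart_image)

lemma smooth_fun_diff: "smooth_fun A f \<Longrightarrow> smooth_fun A h \<Longrightarrow> smooth_fun A (\<lambda>p. f p - h p)"
  by (simp add: smooth_fun_def o_def smooth_on_diff open_chart_image)

lemma field_in_chart_add:
  "c \<in> A \<Longrightarrow> x \<in> chart_image c \<Longrightarrow>
    field_in_chart A c (\<lambda>q. X q + Y q) x = field_in_chart A c X x + field_in_chart A c Y x"
  by (simp add: field_in_chart_def linear_add[OF linear_vec_in_chart] chart_inv_in)

lemma field_in_chart_scaleR:
  "c \<in> A \<Longrightarrow> x \<in> chart_image c \<Longrightarrow>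
    field_in_chart A c (\<lambda>q. f q *\<^sub>R X q) x = (f \<circ> chart_inv c) x *\<^sub>R field_in_chart A c X x"
  by (simp add: field_in_chart_def linear_cmul[OF linear_vec_in_chart] chart_inv_in)

lemma vf_add [intro]:
  assumes "X \<in> vector_fields A" "Y \<in> vector_fields A"
  shows "(\<lambda>q. X q + Y q) \<in> vector_fields A"
  unfolding vector_fields_def mem_Collect_eq
proof
  fix c assume c: "c \<in> A"
  have "smooth_on (chart_image c) (\<lambda>x. field_in_chart A c X x + field_in_chart A c Y x)"
    by (intro smooth_on_add open_chart_image vector_field_in_chart assms c)
  then show "smooth_on (chart_image c) (field_in_chart A c (\<lambda>q. X q + Y q))"
    by (rule smooth_on_cong[OF open_chart_image[OF c], rotated]) (simp add: field_in_chart_add c)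
qed

lemma vf_scaleR:
  assumes "smooth_fun A f" "X \<in> vector_fields A"
  shows "(\<lambda>q. f q *\<^sub>R X q) \<in> vector_fields A"
  unfolding vector_fields_def mem_Collect_eq
proof
  fix c assume c: "c \<in> A"
  have "smooth_on (chart_image c) (\<lambda>x. (f \<circ> chart_inv c) x *\<^sub>R field_in_chart A c X x)"
    by (intro smooth_on_scaleR open_chart_image vector_field_in_chart smooth_fun_in_chart assms c)
  then show "smooth_on (chart_image c) (field_in_chart A c (\<lambda>q. f q *\<^sub>R X q))"
    by (rule smooth_on_cong[OF open_chart_image[OF c], rotated]) (simp only: field_in_chart_scaleR c)
qed

lemma vf_zero [simp]: "(\<lambda>q. 0) \<in> vector_fields A"
  unfolding vector_fields_def mem_Collect_eq
proof
  fix c assume c: "c \<in> A"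
  have "smooth_on (chart_image c) (\<lambda>x. 0 :: real ^ 'n)" by simp
  then show "smooth_on (chart_image c) (field_in_chart A c (\<lambda>q. 0))"
    by (rule smooth_on_cong[OF open_chart_image[OF c], rotated])
       (simp add: field_in_chart_def linear_0[OF linear_vec_in_chart] c chart_inv_in)
qed

lemma vf_cmult: "X \<in> vector_fields A \<Longrightarrow> (\<lambda>q. k *\<^sub>R X q) \<in> vector_fields A"
  using vf_scaleR[OF smooth_fun_const] .

lemma vf_minus [intro]: "X \<in> vector_fields A \<Longrightarrow> (\<lambda>q. - X q) \<in> vector_fields A"
  using vf_cmult[of X "-1"] by simp

lemma vf_diff [intro]:
  "X \<in> vector_fields A \<Longrightarrow> Y \<in> vector_fields A \<Longrightarrow> (\<lambda>q. X q - Y q) \<in> vector_fields A"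
  using vf_add[of X "\<lambda>q. - Y q"] vf_minus by simp

lemma vf_sum:
  "(\<And>i. i \<in> I \<Longrightarrow> X i \<in> vector_fields A) \<Longrightarrow> (\<lambda>q. \<Sum>i\<in>I. X i q) \<in> vector_fields A"
  by (induction I rule: infinite_finite_induct) auto

subsection \<open>Derivatives of functions along vector fields\<close>

text \<open>The defining formula uses a different chart at every point; differentiating \<open>deriv_along A X f\<close> once
  more requires its expression in one chart around the point.\<close>

lemma deriv_along_in_chart:
  assumes "smooth_fun A f" "c \<in> A" "q \<in> fst c"
  shows "deriv_along A X f q =
    frechet_derivative (f \<circ> chart_inv c) (at (snd c q)) (vec_in_chart A c q (X q))"
proof -
  let ?e = "chart_at A q"
  have e: "?e \<in> A" "q \<in> fst ?e" by (simp_all add: chart_at_in chart_at_mem)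
  have inv: "chart_inv ?e (snd ?e q) = q" using chart_inv_chart e by simp
  have 1: "(transition ?e c has_derivative vec_in_chart A c q) (at (snd ?e q))"
    using trans_differentiable[of ?e c q] assms e
    by (simp add: frechet_derivative_works vec_in_chart_def[abs_def])
  have "f \<circ> chart_inv c differentiable (at (snd c q))"
    using smooth_on_differentiable[OF open_chart_image smooth_fun_in_chart chart_in_image] assms by blast
  then have 2: "(f \<circ> chart_inv c has_derivative frechet_derivative (f \<circ> chart_inv c) (at (snd c q)))
      (at (transition ?e c (snd ?e q)))"
    by (simp add: frechet_derivative_works inv)
  have "((\<lambda>x. (f \<circ> chart_inv c) (transition ?e c x)) has_derivative
      (\<lambda>v. frechet_derivative (f \<circ> chart_inv c) (at (snd c q)) (vec_in_chart A c q v))) (at (snd ?e q))"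
    by (rule has_derivative_compose[OF 1 2])
  then have "(f \<circ> chart_inv ?e has_derivative
      (\<lambda>v. frechet_derivative (f \<circ> chart_inv c) (at (snd c q)) (vec_in_chart A c q v))) (at (snd ?e q))"
  proof (rule has_derivative_transform_within_open[OF _ open_overlap[OF e(1) assms(2)]])
    show "snd ?e q \<in> snd ?e ` (fst ?e \<inter> fst c)" using e(2) assms(3) by blast
    fix x assume "x \<in> snd ?e ` (fst ?e \<inter> fst c)"
    then obtain q' where q': "q' \<in> fst ?e" "q' \<in> fst c" "x = snd ?e q'" by blast
    show "(f \<circ> chart_inv c) (transition ?e c x) = (f \<circ> chart_inv ?e) x"
      by (simp add: q' chart_inv_chart[OF e(1)] chart_inv_chart[OF assms(2)])
  qed
  from frechet_derivative_at[OF this] show ?thesis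
    by (simp add: deriv_along_def fun_eq_iff)
qed

lemma deriv_along_in_chart_at:
  assumes "smooth_fun A f" "c \<in> A" "x \<in> chart_image c"
  shows "(deriv_along A X f \<circ> chart_inv c) x =
    frechet_derivative (f \<circ> chart_inv c) (at x) (field_in_chart A c X x)"
  using deriv_along_in_chart[OF assms(1,2) chart_inv_in] assms
  by (simp add: field_in_chart_def chart_chart_inv)

lemma smooth_deriv_along:
  assumes "X \<in> vector_fields A" "smooth_fun A f"
  shows "smooth_fun A (deriv_along A X f)"
  unfolding smooth_fun_def
proof
  fix c assume c: "c \<in> A"
  have "smooth_on (chart_image c) (\<lambda>x. frechet_derivative (f \<circ> chart_inv c) (at x) (field_in_chart A c X x))"
    by (intro smooth_on_frechet open_chart_image smooth_fun_in_chart vector_field_in_chart assms c)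
  then show "smooth_on (chart_image c) (deriv_along A X f \<circ> chart_inv c)"
    by (rule smooth_on_cong[OF open_chart_image[OF c], rotated])
       (simp only: deriv_along_in_chart_at[OF assms(2) c])
qed

lemma smooth_fun_has_derivative:
  assumes "smooth_fun A f"
  shows "(f \<circ> chart_inv (chart_at A p) has_derivative
    (\<lambda>v. deriv_along A (\<lambda>q. v) f p)) (at (snd (chart_at A p) p))"
proof -
  have "f \<circ> chart_inv (chart_at A p) differentiable (at (snd (chart_at A p) p))"
    by (rule smooth_on_differentiable[OF open_chart_image smooth_fun_in_chart chart_in_image])
       (auto simp: assms chart_at_in chart_at_mem)
  then show ?thesis by (simp add: deriv_along_def frechet_derivative_works)
qed

lemma deriv_along_pointwise: "X p = Y p \<Longrightarrow> deriv_along A X f p = deriv_along A Y f p"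
  by (simp add: deriv_along_def)

lemma deriv_alongI:
  assumes "(f \<circ> chart_inv (chart_at A p) has_derivative f') (at (snd (chart_at A p) p))"
  shows "deriv_along A X f p = f' (X p)"
  using frechet_derivative_at[OF assms] by (simp add: deriv_along_def)

lemma deriv_along_const [simp]: "deriv_along A X (\<lambda>q. k) p = 0"
  by (rule deriv_alongI[of _ _ "\<lambda>_. 0", simplified]) (simp add: o_def)

lemma deriv_along_add:
  assumes "smooth_fun A f" "smooth_fun A h"
  shows "deriv_along A X (\<lambda>q. f q + h q) p = deriv_along A X f p + deriv_along A X h p"
proof -
  have "((\<lambda>q. f q + h q) \<circ> chart_inv (chart_at A p) has_derivative
      (\<lambda>v. deriv_along A (\<lambda>q. v) f p + deriv_along A (\<lambda>q. v) h p)) (at (snd (chart_at A p) p))"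
    using has_derivative_add[OF smooth_fun_has_derivative[OF assms(1)] smooth_fun_has_derivative[OF assms(2)]]
    by (simp add: o_def)
  from deriv_alongI[OF this, of X] show ?thesis
    using deriv_along_pointwise[of "\<lambda>q. X p" p X] by simp
qed

lemma deriv_along_mult:
  assumes "smooth_fun A f" "smooth_fun A h"
  shows "deriv_along A X (\<lambda>q. f q * h q) p = deriv_along A X f p * h p + f p * deriv_along A X h p"
proof -
  have inv: "chart_inv (chart_at A p) (snd (chart_at A p) p) = p"
    by (simp add: chart_inv_chart chart_at_in chart_at_mem)
  have "((\<lambda>q. f q * h q) \<circ> chart_inv (chart_at A p) has_derivative
      (\<lambda>v. f p * deriv_along A (\<lambda>q. v) h p + deriv_along A (\<lambda>q. v) f p * h p)) (at (snd (chart_at A p) p))"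
    using has_derivative_mult[OF smooth_fun_has_derivative[OF assms(1), of p] smooth_fun_has_derivative[OF assms(2), of p]]
    by (simp add: o_def inv)
  from deriv_alongI[OF this, of X] show ?thesis
    using deriv_along_pointwise[of "\<lambda>q. X p" p X] by simp
qed

lemma deriv_along_cmult: "smooth_fun A f \<Longrightarrow> deriv_along A X (\<lambda>q. k * f q) p = k * deriv_along A X f p"
  using deriv_along_mult[of "\<lambda>q. k" f X p] by simp

lemma deriv_along_minus: "smooth_fun A f \<Longrightarrow> deriv_along A X (\<lambda>q. - f q) p = - deriv_along A X f p"
  using deriv_along_cmult[of f X "-1" p] by simp

lemma deriv_along_diff:
  assumes "smooth_fun A f" "smooth_fun A h"
  shows "deriv_along A X (\<lambda>q. f q - h q) p = deriv_along A X f p - deriv_along A X h p"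
  using deriv_along_add[OF assms(1) smooth_fun_minus[OF assms(2)]] deriv_along_minus[OF assms(2)] by simp

lemma linear_deriv_along: "smooth_fun A f \<Longrightarrow> linear (\<lambda>v. deriv_along A (\<lambda>q. v) f p)"
  using smooth_fun_has_derivative has_derivative_linear by blast

lemma deriv_along_field_add:
  assumes "smooth_fun A f"
  shows "deriv_along A (\<lambda>q. X q + Y q) f p = deriv_along A X f p + deriv_along A Y f p"
  using linear_add[OF linear_deriv_along[OF assms], of "X p" "Y p" p] by (simp add: deriv_along_def)

lemma deriv_along_field_scaleR:
  assumes "smooth_fun A f"
  shows "deriv_along A (\<lambda>q. h q *\<^sub>R X q) f p = h p * deriv_along A X f p"
  using linear_cmul[OF linear_deriv_along[OF assms], of "h p" "X p" p] by (simp add: deriv_along_def)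

text \<open>The second derivatives of \<open>f\<close> cancel by symmetry, so that the commutator of two derivations is
  again of first order, with the coordinate formula of the bracket as its principal part.\<close>

lemma deriv_along_lie_bracket:
  assumes "X \<in> vector_fields A" "Y \<in> vector_fields A" "smooth_fun A f"
  shows "deriv_along A (lie_bracket A X Y) f p =
    deriv_along A X (deriv_along A Y f) p - deriv_along A Y (deriv_along A X f) p"
proof -
  let ?c = "chart_at A p"
  let ?x = "snd ?c p"
  let ?F = "f \<circ> chart_inv ?c"
  have c: "?c \<in> A" "p \<in> fst ?c" by (simp_all add: chart_at_in chart_at_mem)
  have x: "?x \<in> chart_image ?c" by (rule chart_in_image[OF c])
  have o: "open (chart_image ?c)" by (rule open_chart_image[OF c(1)])
  have F: "smooth_on (chart_image ?c) ?F" by (rule smooth_fun_in_chart[OF assms(3) c(1)])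
  have val: "field_in_chart A ?c Z ?x = Z p" for Z
    by (simp add: field_in_chart_def chart_inv_chart[OF c] vec_in_own_chart)
  have second: "deriv_along A Z (deriv_along A Z' f) p =
      frechet_derivative (\<lambda>z. frechet_derivative ?F (at z) (Z' p)) (at ?x) (Z p)
      + frechet_derivative ?F (at ?x) (frechet_derivative (field_in_chart A ?c Z') (at ?x) (Z p))"
    if "Z' \<in> vector_fields A" for Z Z'
  proof -
    have Z': "smooth_on (chart_image ?c) (field_in_chart A ?c Z')"
      by (rule vector_field_in_chart[OF that c(1)])
    have sm: "smooth_on (chart_image ?c) (\<lambda>z. frechet_derivative ?F (at z) (field_in_chart A ?c Z' z))"
      by (rule smooth_on_frechet[OF o F Z'])
    have "frechet_derivative (\<lambda>z. frechet_derivative ?F (at z) (field_in_chart A ?c Z' z)) (at ?x)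
        = frechet_derivative (deriv_along A Z' f \<circ> chart_inv ?c) (at ?x)"
      by (rule frechet_derivative_transform_within_open[OF smooth_on_differentiable[OF o sm x] o x])
         (simp only: deriv_along_in_chart_at[OF assms(3) c(1)])
    then show ?thesis
      using frechet_derivative_along_field[OF o F Z' x, of "Z p"]
      by (simp add: deriv_along_def val)
  qed
  have lin: "linear (frechet_derivative ?F (at ?x))"
    by (rule linear_frechet_derivative[OF smooth_on_differentiable[OF o F x]])
  have "deriv_along A (lie_bracket A X Y) f p = frechet_derivative ?F (at ?x) (lie_bracket A X Y p)"
    by (simp add: deriv_along_def)
  also have "\<dots> = frechet_derivative ?F (at ?x) (frechet_derivative (field_in_chart A ?c Y) (at ?x) (X p))
      - frechet_derivative ?F (at ?x) (frechet_derivative (field_in_chart A ?c X) (at ?x) (Y p))"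
    by (simp add: lie_bracket_def Let_def linear_diff[OF lin])
  finally show ?thesis
    using second[OF assms(1), of Y] second[OF assms(2), of X]
      frechet_derivative_commute[OF o F x, of "X p" "Y p"] by simp
qed

subsection \<open>Extending local data to the whole manifold\<close>

text \<open>A compact support inside the chart image makes functions that are multiplied by \<open>b\<close> extend by zero.\<close>

definition cutoff :: "('a, 'n) chart \<Rightarrow> (real ^ 'n \<Rightarrow> real) \<Rightarrow> bool" where
  "cutoff c b \<longleftrightarrow> smooth_on UNIV b \<and> (\<exists>K. compact K \<and> K \<subseteq> chart_image c \<and> (\<forall>y. y \<notin> K \<longrightarrow> b y = 0))"

lemma cutoff_smooth: "cutoff c b \<Longrightarrow> open U \<Longrightarrow> smooth_on U b"
  unfolding cutoff_def using smooth_on_subset[of UNIV U b] by simp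

lemma cutoff_exists:
  assumes "c \<in> A" "p \<in> fst c"
  obtains b W where "cutoff c b" "open W" "p \<in> W" "W \<subseteq> fst c" "\<forall>q\<in>W. b (snd c q) = 1"
proof -
  obtain b :: "real ^ 'n \<Rightarrow> real" and V K where b: "smooth_on UNIV b" "open V" "snd c p \<in> V" "\<forall>y\<in>V. b y = 1"
    "compact K" "K \<subseteq> chart_image c" "\<forall>y. y \<notin> K \<longrightarrow> b y = 0"
    by (rule bump_function_exists[OF open_chart_image[OF assms(1)] chart_in_image[OF assms]])
  show ?thesis
  proof (rule that[of b "fst c \<inter> snd c -` V"])
    show "open (fst c \<inter> snd c -` V)"
      using chart_homeomorphism[OF assms(1)] open_chart_dom[OF assms(1)] b(2)
      by (intro continuous_open_preimage) (auto simp: homeomorphism_def)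
    show "cutoff c b" unfolding cutoff_def using b(1,5,6,7) by blast
  qed (use assms(2) b(3,4) in auto)
qed

text \<open>Where a cut-off vanishes outside a compact subset of a chart, a function given on the chart
  extends by zero: the image of the compact set is closed because the manifold is Hausdorff.\<close>

lemma cutoff_zero_near:
  assumes "c \<in> A" "cutoff c b" "p \<notin> fst c"
  obtains W where "open W" "p \<in> W" "W \<subseteq> fst (chart_at A p)"
    "\<And>q. q \<in> W \<Longrightarrow> q \<in> fst c \<Longrightarrow> b (snd c q) = 0"
proof -
  obtain K where K: "compact K" "K \<subseteq> chart_image c" "\<And>y. y \<notin> K \<Longrightarrow> b y = 0"
    using assms(2) unfolding cutoff_def by blast
  have "continuous_on K (chart_inv c)"
    by (rule continuous_on_subset[OF homeomorphism_cont2[OF chart_homeomorphism[OF assms(1)]] K(2)])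
  then have "closed (chart_inv c ` K)"
    by (rule compact_imp_closed[OF compact_continuous_image[OF _ K(1)]])
  then have o: "open (fst (chart_at A p) - chart_inv c ` K)"
    using open_chart_dom[OF chart_at_in] by (intro open_Diff)
  have sub: "chart_inv c ` K \<subseteq> fst c"
    using chart_inv_in[OF assms(1)] K(2) by blast
  show ?thesis
  proof (rule that[OF o])
    show "p \<in> fst (chart_at A p) - chart_inv c ` K"
      using assms(3) chart_at_mem sub by blast
    fix q assume q: "q \<in> fst (chart_at A p) - chart_inv c ` K" "q \<in> fst c"
    have "snd c q \<notin> K"
    proof
      assume "snd c q \<in> K"
      then have "chart_inv c (snd c q) \<in> chart_inv c ` K" by (rule imageI)
      then show False using q chart_inv_chart[OF assms(1) q(2)] by simp
    qed
    then show "b (snd c q) = 0" by (rule K(3))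
  qed blast
qed

lemma smooth_fun_extend:
  assumes "c \<in> A" "cutoff c b" "smooth_on (chart_image c) F"
  shows "smooth_fun A (\<lambda>q. if q \<in> fst c then b (snd c q) * F (snd c q) else 0)" (is "smooth_fun A ?f")
proof (rule smooth_fun_local)
  fix p
  show "\<exists>c\<in>A. \<exists>W. open W \<and> p \<in> W \<and> W \<subseteq> fst c \<and> smooth_on (snd c ` W) (?f \<circ> chart_inv c)"
  proof (cases "p \<in> fst c")
    case True
    have "smooth_on (chart_image c) (\<lambda>x. b x * F x)"
      by (intro smooth_on_mult open_chart_image assms cutoff_smooth[OF assms(2)])
    then have "smooth_on (chart_image c) (?f \<circ> chart_inv c)"
      by (rule smooth_on_cong[OF open_chart_image[OF assms(1)], rotated])
         (simp add: chart_inv_in[OF assms(1)] chart_chart_inv[OF assms(1)])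
    then show ?thesis
      using True open_chart_dom[OF assms(1)] unfolding chart_image_def
      by (intro bexI[OF _ assms(1)] exI[of _ "fst c"]) auto
  next
    case False
    then obtain W where W: "open W" "p \<in> W" "W \<subseteq> fst (chart_at A p)"
      "\<And>q. q \<in> W \<Longrightarrow> q \<in> fst c \<Longrightarrow> b (snd c q) = 0"
      using cutoff_zero_near[OF assms(1,2)] by blast
    let ?d = "chart_at A p"
    have "smooth_on (snd ?d ` W) (?f \<circ> chart_inv ?d)"
    proof (rule smooth_on_cong[OF open_image_chart'[OF chart_at_in W(1,3)]])
      show "smooth_on (snd ?d ` W) (\<lambda>x. 0 :: real)" by simp
      fix x assume "x \<in> snd ?d ` W"
      then obtain q where q: "q \<in> W" "x = snd ?d q" by blast
      then have "chart_inv ?d x = q" using W(3) chart_inv_chart[OF chart_at_in] by blast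
      then show "0 = (?f \<circ> chart_inv ?d) x" using W(4)[OF q(1)] by simp
    qed
    then show ?thesis
      using W(1-3) by (intro bexI[OF _ chart_at_in[of p]] exI[of _ W] conjI)
  qed
qed

lemma vf_extend:
  assumes "c \<in> A" "cutoff c b" "smooth_on (chart_image c) w"
  shows "(\<lambda>q. if q \<in> fst c then b (snd c q) *\<^sub>R vec_from_chart c q (w (snd c q)) else 0) \<in> vector_fields A"
    (is "?X \<in> _")
proof (rule vector_field_local)
  fix p
  show "\<exists>c\<in>A. \<exists>W. open W \<and> p \<in> W \<and> W \<subseteq> fst c \<and> smooth_on (snd c ` W) (field_in_chart A c ?X)"
  proof (cases "p \<in> fst c")
    case True
    have "smooth_on (chart_image c) (\<lambda>x. b x *\<^sub>R w x)"
      by (intro smooth_on_scaleR open_chart_image assms cutoff_smooth[OF assms(2)])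
    then have "smooth_on (chart_image c) (field_in_chart A c ?X)"
    proof (rule smooth_on_cong[OF open_chart_image[OF assms(1)], rotated])
      fix x assume x: "x \<in> chart_image c"
      note q = chart_inv_in[OF assms(1) x]
      show "b x *\<^sub>R w x = field_in_chart A c ?X x"
        using q by (simp add: field_in_chart_def chart_chart_inv[OF assms(1) x]
            linear_cmul[OF linear_vec_in_chart[OF assms(1) q]] vec_in_from_chart[OF assms(1) q])
    qed
    then show ?thesis
      using True open_chart_dom[OF assms(1)] unfolding chart_image_def
      by (intro bexI[OF _ assms(1)] exI[of _ "fst c"]) auto
  next
    case False
    then obtain W where W: "open W" "p \<in> W" "W \<subseteq> fst (chart_at A p)"
      "\<And>q. q \<in> W \<Longrightarrow> q \<in> fst c \<Longrightarrow> b (snd c q) = 0"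
      using cutoff_zero_near[OF assms(1,2)] by blast
    let ?d = "chart_at A p"
    have "smooth_on (snd ?d ` W) (field_in_chart A ?d ?X)"
    proof (rule smooth_on_cong[OF open_image_chart'[OF chart_at_in W(1,3)]])
      show "smooth_on (snd ?d ` W) (\<lambda>x. 0 :: real ^ 'n)" by simp
      fix x assume "x \<in> snd ?d ` W"
      then obtain q where q: "q \<in> W" "x = snd ?d q" by blast
      then have q': "q \<in> fst ?d" "chart_inv ?d x = q"
        using W(3) chart_inv_chart[OF chart_at_in] by blast+
      then show "0 = field_in_chart A ?d ?X x"
        using W(4)[OF q(1)] linear_0[OF linear_vec_in_chart[OF chart_at_in q'(1)]]
        by (simp add: field_in_chart_def)
    qed
    then show ?thesis
      using W(1-3) by (intro bexI[OF _ chart_at_in[of p]] exI[of _ W] conjI)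
  qed
qed

lemma local_frame:
  assumes "c \<in> A" "p \<in> fst c"
  obtains E W where "\<forall>j::'n. E j \<in> vector_fields A" "open W" "p \<in> W" "W \<subseteq> fst c"
    "\<forall>j. \<forall>q\<in>W. E j q = vec_from_chart c q (axis j 1)"
proof -
  obtain b W where b: "cutoff c b" "open W" "p \<in> W" "W \<subseteq> fst c" "\<forall>q\<in>W. b (snd c q) = 1"
    by (rule cutoff_exists[OF assms])
  let ?E = "\<lambda>j q. if q \<in> fst c then b (snd c q) *\<^sub>R vec_from_chart c q (axis j 1) else 0"
  show ?thesis
  proof (rule that[of ?E W])
    show "\<forall>j. ?E j \<in> vector_fields A"
      using vf_extend[OF assms(1) b(1) smooth_on_const] by blast
  qed (use b in auto)
qed

text \<open>Expansion of a field in a frame, globally valid after multiplication with a function \<open>\<beta>\<close> that is \<open>1\<close>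
  at \<open>p\<close>. Here \<open>\<beta>\<close> is the square of a cut-off: one factor makes the coefficients global, the other the
  frame fields.\<close>

lemma field_expansion:
  obtains E \<beta> where "\<forall>j::'n. E j \<in> vector_fields A" "smooth_fun A \<beta>" "\<beta> p = 1"
    "\<forall>X\<in>vector_fields A. \<exists>a. (\<forall>j. smooth_fun A (a j)) \<and> (\<forall>j. a j p = X p $ j) \<and>
      (\<forall>q. \<beta> q *\<^sub>R X q = (\<Sum>j\<in>UNIV. a j q *\<^sub>R E j q))"
proof -
  let ?c = "chart_at A p"
  note c = chart_at_in[of p] chart_at_mem[of p]
  obtain b W where b': "cutoff ?c b" "open W" "p \<in> W" "W \<subseteq> fst ?c" "\<forall>q\<in>W. b (snd ?c q) = 1"
    by (rule cutoff_exists[OF c])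
  note b = b'[rule_format]
  have bp: "b (snd ?c p) = 1" using b(5)[OF b(3)] .
  define E where "E j q = (if q \<in> fst ?c then b (snd ?c q) *\<^sub>R vec_from_chart ?c q (axis j 1) else 0)"
    for j :: 'n and q
  define \<beta> where "\<beta> q = (if q \<in> fst ?c then b (snd ?c q) * b (snd ?c q) else 0)" for q
  have 1: "E j \<in> vector_fields A" for j
    using vf_extend[OF c(1) b(1) smooth_on_const[of _ "axis j 1"]] by (simp add: E_def[abs_def])
  have 2: "smooth_fun A \<beta>"
    using smooth_fun_extend[OF c(1) b(1) cutoff_smooth[OF b(1) open_chart_image[OF c(1)]]]
    by (simp add: \<beta>_def[abs_def])
  have 3: "\<beta> p = 1" using c bp by (simp add: \<beta>_def)
  have 4: "\<exists>a. (\<forall>j. smooth_fun A (a j)) \<and> (\<forall>j. a j p = X p $ j) \<and>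
      (\<forall>q. \<beta> q *\<^sub>R X q = (\<Sum>j\<in>UNIV. a j q *\<^sub>R E j q))" if X: "X \<in> vector_fields A" for X
  proof -
    define a where "a j q = (if q \<in> fst ?c then b (snd ?c q) * (field_in_chart A ?c X (snd ?c q) $ j) else 0)"
      for j :: 'n and q
    have val: "field_in_chart A ?c X (snd ?c q) = vec_in_chart A ?c q (X q)" if "q \<in> fst ?c" for q
      by (simp add: field_in_chart_def chart_inv_chart[OF c(1) that])
    have "smooth_fun A (a j)" for j
      using smooth_fun_extend[OF c(1) b(1)
          smooth_on_nth[OF open_chart_image[OF c(1)] vector_field_in_chart[OF X c(1)]], of j]
      by (simp add: a_def[abs_def])
    moreover have "a j p = X p $ j" for j
      using c bp by (simp add: a_def val vec_in_own_chart)
    moreover have "\<beta> q *\<^sub>R X q = (\<Sum>j\<in>UNIV. a j q *\<^sub>R E j q)" for q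
    proof (cases "q \<in> fst ?c")
      case True
      let ?v = "vec_in_chart A ?c q (X q)"
      have "?v = (\<Sum>j\<in>UNIV. (?v $ j) *\<^sub>R axis j 1)"
        using basis_expansion[of ?v] by (simp add: scalar_mult_eq_scaleR)
      then have "vec_from_chart ?c q ?v = vec_from_chart ?c q (\<Sum>j\<in>UNIV. (?v $ j) *\<^sub>R axis j 1)"
        by simp
      then have "X q = (\<Sum>j\<in>UNIV. (?v $ j) *\<^sub>R vec_from_chart ?c q (axis j 1))"
        using linear_vec_from_chart[OF c(1) True]
        by (simp add: vec_from_in_chart[OF c(1) True] linear_sum linear_cmul)
      then have "\<beta> q *\<^sub>R X q = \<beta> q *\<^sub>R (\<Sum>j\<in>UNIV. (?v $ j) *\<^sub>R vec_from_chart ?c q (axis j 1))"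
        by simp
      also have "\<dots> = (\<Sum>j\<in>UNIV. a j q *\<^sub>R E j q)"
        using True by (simp add: \<beta>_def a_def E_def val scaleR_sum_right mult_ac)
      finally show ?thesis .
    next
      case False
      then show ?thesis by (simp add: \<beta>_def a_def E_def)
    qed
    ultimately show ?thesis by (intro exI[of _ a] conjI allI)
  qed
  show ?thesis by (rule that[of E \<beta>]) (use 1 2 3 4 in simp_all)
qed

text \<open>A map on vector fields that is linear over the smooth functions only sees the value of its
  argument at the point: multiply by a cut-off and expand in a frame.\<close>

lemma tensorial_at:
  fixes T :: "('a, 'n) vfield \<Rightarrow> 'v::real_vector"
  assumes add: "\<And>X Y. X \<in> vector_fields A \<Longrightarrow> Y \<in> vector_fields A \<Longrightarrow> T (\<lambda>q. X q + Y q) = T X + T Y"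
    and scale: "\<And>f X. smooth_fun A f \<Longrightarrow> X \<in> vector_fields A \<Longrightarrow> T (\<lambda>q. f q *\<^sub>R X q) = f p *\<^sub>R T X"
    and XY: "X \<in> vector_fields A" "Y \<in> vector_fields A" "X p = Y p"
  shows "T X = T Y"
proof -
  obtain E \<beta> where E': "\<forall>j::'n. E j \<in> vector_fields A" "smooth_fun A \<beta>" "\<beta> p = 1"
    "\<forall>X\<in>vector_fields A. \<exists>a. (\<forall>j. smooth_fun A (a j)) \<and> (\<forall>j. a j p = X p $ j) \<and>
      (\<forall>q. \<beta> q *\<^sub>R X q = (\<Sum>j\<in>UNIV. a j q *\<^sub>R E j q))"
    by (rule field_expansion[of p])
  note E = E'[rule_format]
  have zero: "T (\<lambda>q. 0) = 0"
    using scale[of "\<lambda>q. 0" "\<lambda>q. 0"] by simp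
  have sum: "T (\<lambda>q. \<Sum>j\<in>I. F j q) = (\<Sum>j\<in>I. T (F j))"
    if "finite I" "\<And>j. F j \<in> vector_fields A" for I :: "'n set" and F
    using that(1)
  proof (induction I rule: finite_induct)
    case (insert x I)
    have "T (\<lambda>q. F x q + (\<Sum>j\<in>I. F j q)) = T (F x) + T (\<lambda>q. \<Sum>j\<in>I. F j q)"
      by (intro add vf_sum that(2))
    then show ?case using insert by simp
  qed (simp add: zero)
  have expand: "T X = (\<Sum>j\<in>UNIV. (X p $ j) *\<^sub>R T (E j))" if X: "X \<in> vector_fields A" for X
  proof -
    obtain a where a: "\<And>j. smooth_fun A (a j)" "\<And>j. a j p = X p $ j"
      "\<And>q. \<beta> q *\<^sub>R X q = (\<Sum>j\<in>UNIV. a j q *\<^sub>R E j q)"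
      using E(4)[OF X] by blast
    have "T X = T (\<lambda>q. \<beta> q *\<^sub>R X q)" using scale[OF E(2) X] E(3) by simp
    also have "\<dots> = T (\<lambda>q. \<Sum>j\<in>UNIV. a j q *\<^sub>R E j q)" by (simp only: a(3))
    also have "\<dots> = (\<Sum>j\<in>UNIV. T (\<lambda>q. a j q *\<^sub>R E j q))"
      by (rule sum) (simp_all add: vf_scaleR a(1) E(1))
    also have "\<dots> = (\<Sum>j\<in>UNIV. (X p $ j) *\<^sub>R T (E j))"
      by (simp add: scale[OF a(1) E(1)] a(2))
    finally show ?thesis .
  qed
  show ?thesis by (simp only: expand[OF XY(1)] expand[OF XY(2)] XY(3))
qed

lemma extend_vec: "extend_vec A p v \<in> vector_fields A \<and> extend_vec A p v p = v"
proof -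
  let ?c = "chart_at A p"
  note c = chart_at_in[of p] chart_at_mem[of p]
  obtain b W where b': "cutoff ?c b" "open W" "p \<in> W" "W \<subseteq> fst ?c" "\<forall>q\<in>W. b (snd ?c q) = 1"
    by (rule cutoff_exists[OF c])
  note b = b'[rule_format]
  let ?X = "\<lambda>q. if q \<in> fst ?c then b (snd ?c q) *\<^sub>R vec_from_chart ?c q v else 0"
  have "?X \<in> vector_fields A"
    by (rule vf_extend[OF c(1) b(1) smooth_on_const])
  moreover have "?X p = v"
    using c b(5)[OF b(3)] vec_from_in_chart[OF c, of v] by (simp add: vec_in_own_chart)
  ultimately have "?X \<in> vector_fields A \<and> ?X p = v" by (rule conjI)
  then show ?thesis unfolding extend_vec_def
    by (rule someI[where P = "\<lambda>X. X \<in> vector_fields A \<and> X p = v"])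
qed

lemmas extend_vec_vf [simp] = extend_vec[THEN conjunct1]
lemmas extend_vec_at [simp] = extend_vec[THEN conjunct2]

text \<open>Cut-off coordinate functions are smooth on the whole manifold and detect every component.\<close>

lemma fields_eq_at:
  assumes "\<And>f. smooth_fun A f \<Longrightarrow> deriv_along A X f p = deriv_along A Y f p"
  shows "X p = Y p"
proof -
  let ?c = "chart_at A p"
  note c = chart_at_in[of p] chart_at_mem[of p]
  obtain b W where b': "cutoff ?c b" "open W" "p \<in> W" "W \<subseteq> fst ?c" "\<forall>q\<in>W. b (snd ?c q) = 1"
    by (rule cutoff_exists[OF c])
  note b = b'[rule_format]
  have "Z p $ j = deriv_along A Z (\<lambda>q. if q \<in> fst ?c then b (snd ?c q) * (snd ?c q $ j) else 0) p"
    (is "_ = deriv_along A Z ?f p") for Z and j :: 'n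
  proof -
    have "((\<lambda>x. x $ j) has_derivative (\<lambda>v. v $ j)) (at (snd ?c p))"
      by (rule bounded_linear_imp_has_derivative[OF bounded_linear_vec_nth])
    then have "(?f \<circ> chart_inv ?c has_derivative (\<lambda>v. v $ j)) (at (snd ?c p))"
    proof (rule has_derivative_transform_within_open[OF _ open_image_chart'[OF c(1) b(2,4)]])
      show "snd ?c p \<in> snd ?c ` W" using b(3) by blast
      fix x assume "x \<in> snd ?c ` W"
      then obtain q where q: "q \<in> W" "x = snd ?c q" by blast
      then have "q \<in> fst ?c" using b(4) by blast
      then show "x $ j = (?f \<circ> chart_inv ?c) x"
        using q b(5) by (simp add: chart_inv_chart[OF c(1)])
    qed
    then show ?thesis by (simp add: deriv_alongI)
  qed
  moreover have "smooth_fun A (\<lambda>q. if q \<in> fst ?c then b (snd ?c q) * (snd ?c q $ j) else 0)" for j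
    by (intro smooth_fun_extend c b smooth_on_nth smooth_on_ident open_chart_image)
  ultimately show ?thesis
    using assms by (simp add: vec_eq_iff)
qed

subsection \<open>Traces of fields of endomorphisms\<close>

lemma trace_matrix: "trace (matrix u) = (\<Sum>j\<in>UNIV. u (axis j 1) $ j)"
  for u :: "real ^ 'n \<Rightarrow> real ^ 'n"
  by (simp add: trace_def matrix_def)

lemma trace_matrix_commute:
  fixes u v :: "real ^ 'n \<Rightarrow> real ^ 'n"
  assumes "linear u" "linear v"
  shows "trace (matrix (u \<circ> v)) = trace (matrix (v \<circ> u))"
  using trace_mul_sym[of "matrix u" "matrix v"] assms by (simp add: matrix_compose)

lemma trace_in_frame:
  assumes "c \<in> A" "q \<in> fst c" "linear u"
  shows "(\<Sum>j\<in>UNIV. vec_in_chart A c q (u (vec_from_chart c q (axis j 1))) $ j) = trace (matrix u)"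
proof -
  let ?J = "vec_in_chart A c q" and ?J' = "vec_from_chart c q"
  have lin: "linear (u \<circ> ?J')"
    using linear_compose[OF linear_vec_from_chart[OF assms(1,2)] assms(3)] .
  have "(\<Sum>j\<in>UNIV. ?J (u (?J' (axis j 1))) $ j) = trace (matrix (?J \<circ> (u \<circ> ?J')))"
    by (simp add: trace_matrix)
  also have "\<dots> = trace (matrix ((u \<circ> ?J') \<circ> ?J))"
    by (rule trace_matrix_commute[OF linear_vec_in_chart[OF assms(1,2)] lin])
  also have "(u \<circ> ?J') \<circ> ?J = u"
    by (rule ext) (simp add: vec_from_in_chart[OF assms(1,2)])
  finally show ?thesis .
qed

context
  fixes U :: "('a, 'n) vfield \<Rightarrow> ('a, 'n) vfield" and u :: "'a \<Rightarrow> real ^ 'n \<Rightarrow> real ^ 'n"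
  assumes U: "\<And>X. X \<in> vector_fields A \<Longrightarrow> U X \<in> vector_fields A"
    and u: "\<And>q. linear (u q)"
    and Uu: "\<And>X q. X \<in> vector_fields A \<Longrightarrow> U X q = u q (X q)"
begin

lemma trace_near:
  assumes "c \<in> A" "W \<subseteq> fst c"
    and E: "\<And>j::'n. E j \<in> vector_fields A" "\<And>j q. q \<in> W \<Longrightarrow> E j q = vec_from_chart c q (axis j 1)"
    and x: "x \<in> snd c ` W"
  shows "(\<Sum>j\<in>UNIV. field_in_chart A c (U (E j)) x $ j) = ((\<lambda>q. trace (matrix (u q))) \<circ> chart_inv c) x"
proof -
  obtain q where q: "q \<in> W" "x = snd c q" using x by blast
  then have qc: "q \<in> fst c" using assms(2) by blast
  show ?thesis
    using trace_in_frame[OF assms(1) qc u[of q]] E q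
    by (simp add: field_in_chart_def chart_inv_chart[OF assms(1) qc] Uu)
qed

lemma smooth_fun_trace: "smooth_fun A (\<lambda>q. trace (matrix (u q)))"
proof (rule smooth_fun_local)
  fix p
  let ?c = "chart_at A p"
  note c = chart_at_in[of p] chart_at_mem[of p]
  obtain E W where E': "\<forall>j::'n. E j \<in> vector_fields A" "open W" "p \<in> W" "W \<subseteq> fst ?c"
    "\<forall>j. \<forall>q\<in>W. E j q = vec_from_chart ?c q (axis j 1)"
    by (rule local_frame[OF c])
  note E = E'[rule_format]
  have o: "open (snd ?c ` W)" by (rule open_image_chart'[OF c(1) E(2,4)])
  have "smooth_on (snd ?c ` W) (field_in_chart A ?c (U (E j)))" for j
    by (rule smooth_on_subset[OF open_chart_image[OF c(1)] o _ vector_field_in_chart[OF U[OF E(1)] c(1)]])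
       (use E(4) chart_in_image[OF c(1)] in blast)
  then have "smooth_on (snd ?c ` W) (\<lambda>x. \<Sum>j\<in>UNIV. field_in_chart A ?c (U (E j)) x $ j)"
    by (intro smooth_on_sum smooth_on_nth o)
  then have "smooth_on (snd ?c ` W) ((\<lambda>q. trace (matrix (u q))) \<circ> chart_inv ?c)"
    by (rule smooth_on_cong[OF o, rotated]) (rule trace_near[OF c(1) E(4,1,5)])
  then show "\<exists>c\<in>A. \<exists>W. open W \<and> p \<in> W \<and> W \<subseteq> fst c \<and>
      smooth_on (snd c ` W) ((\<lambda>q. trace (matrix (u q))) \<circ> chart_inv c)"
    using E(2-4) by (intro bexI[OF _ c(1)] exI[of _ W] conjI)
qed

text \<open>Lie derivatives commute with contraction: in a coordinate frame, the matrix of the Lie derivative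
  of \<open>U\<close> differs from the derivative of the matrix of \<open>U\<close> by a commutator with the Jacobian matrix of
  \<open>Z\<close>, which has trace zero.\<close>

lemma deriv_along_trace:
  assumes Z: "Z \<in> vector_fields A"
    and w: "\<And>X. X \<in> vector_fields A \<Longrightarrow> lie_bracket A Z (U X) p - u p (lie_bracket A Z X p) = w (X p)"
  shows "deriv_along A Z (\<lambda>q. trace (matrix (u q))) p = trace (matrix w)"
proof -
  let ?c = "chart_at A p"
  let ?x = "snd ?c p"
  note c = chart_at_in[of p] chart_at_mem[of p]
  obtain E W where E': "\<forall>j::'n. E j \<in> vector_fields A" "open W" "p \<in> W" "W \<subseteq> fst ?c"
    "\<forall>j. \<forall>q\<in>W. E j q = vec_from_chart ?c q (axis j 1)"
    by (rule local_frame[OF c])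
  note E = E'[rule_format]
  have o: "open (snd ?c ` W)" by (rule open_image_chart'[OF c(1) E(2,4)])
  have x: "?x \<in> snd ?c ` W" using E(3) by blast
  have Ep: "E j p = axis j 1" for j
    using E(5)[OF E(3)] vec_from_in_chart[OF c, of "axis j 1"] by (simp add: vec_in_own_chart)
  have diff: "field_in_chart A ?c X differentiable (at ?x)" if "X \<in> vector_fields A" for X
    by (rule smooth_on_differentiable[OF open_chart_image[OF c(1)] vector_field_in_chart[OF that c(1)]
          chart_in_image[OF c]])
  let ?d = "\<lambda>X. frechet_derivative (field_in_chart A ?c X) (at ?x)"
  have "((\<lambda>x. \<Sum>j\<in>UNIV. field_in_chart A ?c (U (E j)) x $ j) has_derivative
      (\<lambda>v. \<Sum>j\<in>UNIV. ?d (U (E j)) v $ j)) (at ?x)"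
    by (intro has_derivative_sum bounded_linear.has_derivative[OF bounded_linear_vec_nth]
          diff[OF U[OF E(1)], unfolded frechet_derivative_works])
  then have "((\<lambda>q. trace (matrix (u q))) \<circ> chart_inv ?c has_derivative
      (\<lambda>v. \<Sum>j\<in>UNIV. ?d (U (E j)) v $ j)) (at ?x)"
    by (rule has_derivative_transform_within_open[OF _ o x]) (rule trace_near[OF c(1) E(4,1,5)])
  then have 1: "deriv_along A Z (\<lambda>q. trace (matrix (u q))) p = (\<Sum>j\<in>UNIV. ?d (U (E j)) (Z p) $ j)"
    by (rule deriv_alongI)
  have dE: "?d (E j) = (\<lambda>v. 0)" for j
  proof -
    have "((\<lambda>x. axis j 1) has_derivative (\<lambda>v. 0 :: real ^ 'n)) (at ?x)" by simp
    then have "(field_in_chart A ?c (E j) has_derivative (\<lambda>v. 0)) (at ?x)"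
    proof (rule has_derivative_transform_within_open[OF _ o x])
      fix y assume "y \<in> snd ?c ` W"
      then obtain q where q: "q \<in> W" "y = snd ?c q" by blast
      then have qc: "q \<in> fst ?c" using E(4) by blast
      show "axis j 1 = field_in_chart A ?c (E j) y"
        using E(5)[OF q(1)] q(2)
        by (simp add: field_in_chart_def chart_inv_chart[OF c(1) qc] vec_in_from_chart[OF c(1) qc])
    qed
    from frechet_derivative_at[OF this] show ?thesis by simp
  qed
  have linZ: "linear (?d Z)" by (rule linear_frechet_derivative[OF diff[OF Z]])
  have "?d (U (E j)) (Z p) = w (axis j 1) - (u p \<circ> ?d Z) (axis j 1) + (?d Z \<circ> u p) (axis j 1)" for j
  proof -
    have "lie_bracket A Z (E j) p = - ?d Z (axis j 1)"
      by (simp add: lie_bracket_def Let_def dE Ep)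
    then have "lie_bracket A Z (U (E j)) p + u p (?d Z (axis j 1)) = w (axis j 1)"
      using w[OF E(1), of j] linear_neg[OF u[of p]] by (simp add: Ep)
    moreover have "lie_bracket A Z (U (E j)) p = ?d (U (E j)) (Z p) - ?d Z (u p (axis j 1))"
      by (simp add: lie_bracket_def Let_def Uu[OF E(1)] Ep)
    ultimately show ?thesis by (simp add: algebra_simps)
  qed
  then have "(\<Sum>j\<in>UNIV. ?d (U (E j)) (Z p) $ j)
      = trace (matrix w) - trace (matrix (u p \<circ> ?d Z)) + trace (matrix (?d Z \<circ> u p))"
    unfolding trace_matrix by (simp add: sum.distrib sum_subtractf)
  then show ?thesis
    using 1 trace_matrix_commute[OF u linZ, of p] by simp
qed

end

end

section \<open>Nondegenerate bilinear forms\<close>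

lemma bilinear_gram:
  fixes b :: "real ^ 'n::finite \<Rightarrow> real ^ 'n \<Rightarrow> real"
  assumes "bilinear b"
  shows "b v w = v \<bullet> (gram_matrix b *v w)"
proof -
  have lin: "linear (\<lambda>x. b x y)" "linear (b x)" for x y
    using assms by (auto simp: bilinear_def)
  have v: "v = (\<Sum>i\<in>UNIV. (v $ i) *\<^sub>R axis i 1)" for v :: "real ^ 'n"
    using basis_expansion[of v] by (simp add: scalar_mult_eq_scaleR)
  have "b v w = (\<Sum>i\<in>UNIV. v $ i * b (axis i 1) w)"
    using arg_cong[OF v[of v], of "\<lambda>x. b x w"] by (simp add: linear_sum[OF lin(1)] linear_cmul[OF lin(1)])
  moreover have "b (axis i 1) w = (\<Sum>j\<in>UNIV. w $ j * b (axis i 1) (axis j 1))" for i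
    using arg_cong[OF v[of w], of "\<lambda>x. b (axis i 1) x"] by (simp add: linear_sum[OF lin(2)] linear_cmul[OF lin(2)])
  ultimately show ?thesis
    by (simp add: inner_vec_def matrix_vector_mult_def gram_matrix_def mult.commute)
qed

lemma lorentzian_form_nondegenerate:
  fixes b :: "real ^ 'n::finite \<Rightarrow> real ^ 'n \<Rightarrow> real"
  assumes "lorentzian_form b" "\<And>w. b v w = 0"
  shows "v = 0"
proof -
  obtain e :: "'n \<Rightarrow> real ^ 'n" and k where e: "b (e i) (e j) = (if i \<noteq> j then 0 else if i = k then - 1 else 1)" for i j
    using assms(1) unfolding lorentzian_form_def by blast
  have lin: "linear (\<lambda>x. b x y)" for y
    using assms(1) by (auto simp: lorentzian_form_def bilinear_def)
  define T where "T x = (\<Sum>i\<in>UNIV. (x $ i) *\<^sub>R e i)" for x :: "real ^ 'n"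
  have bT: "b (T x) (e j) = (if j = k then - (x $ j) else x $ j)" for x j
  proof -
    have "b (T x) (e j) = (\<Sum>i\<in>UNIV. x $ i * b (e i) (e j))"
      by (simp add: T_def linear_sum[OF lin] linear_cmul[OF lin])
    also have "\<dots> = (\<Sum>i\<in>UNIV. if i = j then x $ j * b (e j) (e j) else 0)"
      by (rule sum.cong) (auto simp: e)
    finally show ?thesis by (simp add: e)
  qed
  have lT: "linear T"
    by (rule linearI) (simp_all add: T_def scaleR_add_left sum.distrib scaleR_sum_right)
  have null: "x = 0" if "\<And>j. b (T x) (e j) = 0" for x
  proof -
    have "x $ j = 0" for j using that[of j] by (simp add: bT split: if_splits)
    then show ?thesis by (simp add: vec_eq_iff)
  qed
  have "inj T"
    unfolding linear_injective_0[OF lT] using null linear_0[OF lin] by simp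
  then have "surj T" by (rule linear_inj_imp_surj[OF lT])
  from surjD[OF this, of v] obtain x where x: "v = T x" ..
  have "x = 0" using null assms(2)[unfolded x] .
  then show ?thesis using x linear_0[OF lT] by simp
qed

lemma lorentzian_form_gram_invertible:
  assumes "lorentzian_form b"
  shows "invertible (gram_matrix b)"
proof -
  have b: "bilinear b" "\<And>v w. b v w = b w v"
    using assms by (auto simp: lorentzian_form_def)
  have "y = 0" if "gram_matrix b *v y = 0" for y
    using lorentzian_form_nondegenerate[OF assms, of y] bilinear_gram[OF b(1), of _ y] b(2) that by simp
  then show ?thesis
    unfolding invertible_left_inverse matrix_left_invertible_ker by blast
qed

section \<open>The Levi-Civita connection\<close>

locale levi_civita_manifold = manifold A
  for A :: "('a::{t2_space, second_countable_topology}, 'n::finite) chart set" +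
  fixes g :: "'a \<Rightarrow> real ^ 'n \<Rightarrow> real ^ 'n \<Rightarrow> real"
    and D :: "('a, 'n) vfield \<Rightarrow> ('a, 'n) vfield \<Rightarrow> ('a, 'n) vfield"
  assumes lorentzian_metric: "lorentzian_metric A g"
    and levi_civita: "levi_civita A g D"
begin

abbreviation "vf \<equiv> vector_fields A"
abbreviation "drv X f \<equiv> deriv_along A X f"
abbreviation "br X Y \<equiv> lie_bracket A X Y"
abbreviation "R X Y Z \<equiv> curvature A D X Y Z"
abbreviation "ric p \<equiv> ricci A D p"
abbreviation "ip X Y p \<equiv> g p (X p) (Y p)"

lemma g_form: "lorentzian_form (g p)"
  using lorentzian_metric by (simp add: lorentzian_metric_def)

lemma g_bilinear: "bilinear (g p)" and g_commute: "g p v w = g p w v"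
  using g_form[of p] by (auto simp: lorentzian_form_def)

lemma g_linear1: "linear (\<lambda>v. g p v w)" and g_linear2: "linear (g p v)"
  using g_bilinear[of p] by (auto simp: bilinear_def)

lemmas g_simps [simp] =
  linear_add[OF g_linear1] linear_diff[OF g_linear1] linear_neg[OF g_linear1]
  linear_cmul[OF g_linear1, simplified] linear_0[OF g_linear1]
  linear_add[OF g_linear2] linear_diff[OF g_linear2] linear_neg[OF g_linear2]
  linear_cmul[OF g_linear2, simplified] linear_0[OF g_linear2]

lemma g_eqI:
  assumes "\<And>w. g p v w = g p v' w"
  shows "v = v'"
  using lorentzian_form_nondegenerate[OF g_form, of p "v - v'"] assms by simp

lemma g_eqI_fields:
  assumes "\<And>Y. Y \<in> vf \<Longrightarrow> g p v (Y p) = g p v' (Y p)"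
  shows "v = v'"
proof (rule g_eqI)
  show "g p v w = g p v' w" for w
    using assms[of "extend_vec A p w"] by simp
qed

lemma smooth_inner: "X \<in> vf \<Longrightarrow> Y \<in> vf \<Longrightarrow> smooth_fun A (ip X Y)"
  using lorentzian_metric by (simp add: lorentzian_metric_def)

lemma affine: "affine_connection A D"
  using levi_civita by (simp add: levi_civita_def)

lemma D_vf: "X \<in> vf \<Longrightarrow> Y \<in> vf \<Longrightarrow> D X Y \<in> vf"
  using affine by (simp add: affine_connection_def)

lemma D_add1: "X \<in> vf \<Longrightarrow> Y \<in> vf \<Longrightarrow> Z \<in> vf \<Longrightarrow> D (\<lambda>q. X q + Y q) Z = (\<lambda>p. D X Z p + D Y Z p)"
  using affine by (simp add: affine_connection_def fun_eq_iff)

lemma D_add2: "X \<in> vf \<Longrightarrow> Y \<in> vf \<Longrightarrow> Z \<in> vf \<Longrightarrow> D X (\<lambda>q. Y q + Z q) = (\<lambda>p. D X Y p + D X Z p)"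
  using affine by (simp add: affine_connection_def fun_eq_iff)

lemma D_scale1: "smooth_fun A f \<Longrightarrow> X \<in> vf \<Longrightarrow> Y \<in> vf \<Longrightarrow> D (\<lambda>q. f q *\<^sub>R X q) Y = (\<lambda>p. f p *\<^sub>R D X Y p)"
  using affine by (simp add: affine_connection_def fun_eq_iff)

lemma D_scale2: "smooth_fun A f \<Longrightarrow> X \<in> vf \<Longrightarrow> Y \<in> vf \<Longrightarrow>
    D X (\<lambda>q. f q *\<^sub>R Y q) = (\<lambda>p. drv X f p *\<^sub>R Y p + f p *\<^sub>R D X Y p)"
  using affine by (simp add: affine_connection_def fun_eq_iff)

lemma D_minus1: "X \<in> vf \<Longrightarrow> Y \<in> vf \<Longrightarrow> D (\<lambda>q. - X q) Y = (\<lambda>p. - D X Y p)"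
  using D_scale1[of "\<lambda>q. - 1" X Y] by simp

lemma D_minus2: "X \<in> vf \<Longrightarrow> Y \<in> vf \<Longrightarrow> D X (\<lambda>q. - Y q) = (\<lambda>p. - D X Y p)"
  using D_scale2[of "\<lambda>q. - 1" X Y] by simp

lemma D_diff1: "X \<in> vf \<Longrightarrow> Y \<in> vf \<Longrightarrow> Z \<in> vf \<Longrightarrow> D (\<lambda>q. X q - Y q) Z = (\<lambda>p. D X Z p - D Y Z p)"
  using D_add1[of X "\<lambda>q. - Y q" Z] by (simp add: D_minus1 vf_minus)

lemma D_diff2: "X \<in> vf \<Longrightarrow> Y \<in> vf \<Longrightarrow> Z \<in> vf \<Longrightarrow> D X (\<lambda>q. Y q - Z q) = (\<lambda>p. D X Y p - D X Z p)"
  using D_add2[of X Y "\<lambda>q. - Z q"] by (simp add: D_minus2 vf_minus)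

lemma D_zero2: "X \<in> vf \<Longrightarrow> D X (\<lambda>q. 0) = (\<lambda>p. 0)"
  using D_scale2[of "\<lambda>q. 0" X "\<lambda>q. 0"] by simp

lemma torsion_free: "X \<in> vf \<Longrightarrow> Y \<in> vf \<Longrightarrow> br X Y = (\<lambda>p. D X Y p - D Y X p)"
  using levi_civita by (simp add: levi_civita_def fun_eq_iff)

lemma deriv_inner: "X \<in> vf \<Longrightarrow> Y \<in> vf \<Longrightarrow> Z \<in> vf \<Longrightarrow>
    drv X (ip Y Z) = (\<lambda>p. g p (D X Y p) (Z p) + g p (Y p) (D X Z p))"
  using levi_civita by (simp add: levi_civita_def fun_eq_iff)

subsection \<open>The Lie bracket\<close>

lemma br_vf: "X \<in> vf \<Longrightarrow> Y \<in> vf \<Longrightarrow> br X Y \<in> vf"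
  by (simp add: torsion_free vf_diff D_vf)

lemma br_commute: "br Y X p = - br X Y p"
  by (simp add: lie_bracket_def Let_def)

lemma br_scale2: "smooth_fun A f \<Longrightarrow> X \<in> vf \<Longrightarrow> Y \<in> vf \<Longrightarrow>
    br X (\<lambda>q. f q *\<^sub>R Y q) = (\<lambda>p. drv X f p *\<^sub>R Y p + f p *\<^sub>R br X Y p)"
  by (simp add: torsion_free vf_scaleR D_scale1 D_scale2 fun_eq_iff algebra_simps)

lemma br_scale1: "smooth_fun A f \<Longrightarrow> X \<in> vf \<Longrightarrow> Y \<in> vf \<Longrightarrow>
    br (\<lambda>q. f q *\<^sub>R X q) Y = (\<lambda>p. f p *\<^sub>R br X Y p - drv Y f p *\<^sub>R X p)"
  by (simp add: torsion_free vf_scaleR D_scale1 D_scale2 fun_eq_iff algebra_simps)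

lemma br_add2: "X \<in> vf \<Longrightarrow> Y \<in> vf \<Longrightarrow> Z \<in> vf \<Longrightarrow> br X (\<lambda>q. Y q + Z q) = (\<lambda>p. br X Y p + br X Z p)"
  by (simp add: torsion_free vf_add D_add1 D_add2 fun_eq_iff algebra_simps)

lemma br_add1: "X \<in> vf \<Longrightarrow> Y \<in> vf \<Longrightarrow> Z \<in> vf \<Longrightarrow> br (\<lambda>q. X q + Y q) Z = (\<lambda>p. br X Z p + br Y Z p)"
  by (simp add: torsion_free vf_add D_add1 D_add2 fun_eq_iff algebra_simps)

lemma deriv_br: "X \<in> vf \<Longrightarrow> Y \<in> vf \<Longrightarrow> smooth_fun A f \<Longrightarrow>
    drv (br X Y) f = (\<lambda>p. drv X (drv Y f) p - drv Y (drv X f) p)"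
  by (rule ext) (rule deriv_along_lie_bracket)

text \<open>On functions the bracket is a commutator, for which the Jacobi identity is purely algebraic, and a
  field is determined by its action on functions.\<close>

lemma jacobi:
  assumes "X \<in> vf" "Y \<in> vf" "Z \<in> vf"
  shows "br X (br Y Z) p = br (br X Y) Z p + br Y (br X Z) p"
proof -
  have "br X (br Y Z) p = (\<lambda>p. br (br X Y) Z p + br Y (br X Z) p) p"
  proof (rule fields_eq_at)
    fix f assume f: "smooth_fun A f"
    show "drv (br X (br Y Z)) f p = drv (\<lambda>p. br (br X Y) Z p + br Y (br X Z) p) f p"
      by (simp add: deriv_along_field_add f deriv_br br_vf assms smooth_deriv_along deriv_along_diff)
  qed
  then show ?thesis .
qed

subsection \<open>Curvature\<close>

lemma R_vf: "X \<in> vf \<Longrightarrow> Y \<in> vf \<Longrightarrow> Z \<in> vf \<Longrightarrow> R X Y Z \<in> vf"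
  unfolding curvature_def[abs_def] by (intro vf_diff D_vf br_vf)

lemma R_commute: "X \<in> vf \<Longrightarrow> Y \<in> vf \<Longrightarrow> Z \<in> vf \<Longrightarrow> R Y X Z p = - R X Y Z p"
proof -
  assume v: "X \<in> vf" "Y \<in> vf" "Z \<in> vf"
  have "br Y X = (\<lambda>q. - br X Y q)" by (rule ext) (rule br_commute)
  then show ?thesis using D_minus1[of "br X Y" Z] v by (simp add: curvature_def br_vf)
qed

lemma R_add1: "X \<in> vf \<Longrightarrow> X' \<in> vf \<Longrightarrow> Y \<in> vf \<Longrightarrow> Z \<in> vf \<Longrightarrow>
    R (\<lambda>q. X q + X' q) Y Z p = R X Y Z p + R X' Y Z p"
  by (simp add: curvature_def D_add1 D_add2 D_vf br_add1 br_vf algebra_simps)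

lemma R_add2: "X \<in> vf \<Longrightarrow> Y \<in> vf \<Longrightarrow> Y' \<in> vf \<Longrightarrow> Z \<in> vf \<Longrightarrow>
    R X (\<lambda>q. Y q + Y' q) Z p = R X Y Z p + R X Y' Z p"
  by (simp add: curvature_def D_add1 D_add2 D_vf br_add2 br_vf algebra_simps)

lemma R_add3: "X \<in> vf \<Longrightarrow> Y \<in> vf \<Longrightarrow> Z \<in> vf \<Longrightarrow> Z' \<in> vf \<Longrightarrow>
    R X Y (\<lambda>q. Z q + Z' q) p = R X Y Z p + R X Y Z' p"
  by (simp add: curvature_def D_add2 D_vf br_vf algebra_simps)

text \<open>Curvature is tensorial: the derivatives of \<open>f\<close> produced by the two iterated covariant derivatives are
  cancelled by the bracket term.\<close>

lemma R_scale1: "smooth_fun A f \<Longrightarrow> X \<in> vf \<Longrightarrow> Y \<in> vf \<Longrightarrow> Z \<in> vf \<Longrightarrow>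
    R (\<lambda>q. f q *\<^sub>R X q) Y Z p = f p *\<^sub>R R X Y Z p"
  by (simp add: curvature_def D_scale1 D_scale2 D_vf D_diff1 br_scale1 br_vf vf_scaleR
      smooth_deriv_along algebra_simps)

lemma R_scale2: "smooth_fun A f \<Longrightarrow> X \<in> vf \<Longrightarrow> Y \<in> vf \<Longrightarrow> Z \<in> vf \<Longrightarrow>
    R X (\<lambda>q. f q *\<^sub>R Y q) Z p = f p *\<^sub>R R X Y Z p"
  by (simp add: curvature_def D_scale1 D_scale2 D_vf D_add1 br_scale2 br_vf vf_scaleR
      smooth_deriv_along algebra_simps)

lemma R_scale3: "smooth_fun A f \<Longrightarrow> X \<in> vf \<Longrightarrow> Y \<in> vf \<Longrightarrow> Z \<in> vf \<Longrightarrow>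
    R X Y (\<lambda>q. f q *\<^sub>R Z q) p = f p *\<^sub>R R X Y Z p"
  by (simp add: curvature_def D_scale2 D_vf D_add2 br_vf vf_scaleR deriv_br
      smooth_deriv_along algebra_simps)

lemma R_pointwise:
  assumes "X \<in> vf" "X' \<in> vf" "X p = X' p" "Y \<in> vf" "Y' \<in> vf" "Y p = Y' p"
    "Z \<in> vf" "Z' \<in> vf" "Z p = Z' p"
  shows "R X Y Z p = R X' Y' Z' p"
proof -
  have "R X Y Z p = R X' Y Z p"
    by (rule tensorial_at[of "\<lambda>X. R X Y Z p" p]) (use assms R_add1 R_scale1 in auto)
  also have "\<dots> = R X' Y' Z p"
    by (rule tensorial_at[of "\<lambda>Y. R X' Y Z p" p]) (use assms R_add2 R_scale2 in auto)
  also have "\<dots> = R X' Y' Z' p"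
    by (rule tensorial_at[of "\<lambda>Z. R X' Y' Z p" p]) (use assms R_add3 R_scale3 in auto)
  finally show ?thesis .
qed

text \<open>The commutator of second derivatives of \<open>g(Z, W)\<close> is the derivative along the bracket; expanding both
  sides with the compatibility of metric and connection leaves only curvature terms.\<close>

lemma R_metric:
  assumes "X \<in> vf" "Y \<in> vf" "Z \<in> vf" "W \<in> vf"
  shows "g p (R X Y Z p) (W p) = - g p (R X Y W p) (Z p)"
proof -
  note D = assms D_vf br_vf
  have "drv (br X Y) (ip Z W) p = drv X (drv Y (ip Z W)) p - drv Y (drv X (ip Z W)) p"
    by (simp add: deriv_br assms smooth_inner)
  then have "g p (D (br X Y) Z p) (W p) + g p (Z p) (D (br X Y) W p) =
      g p (D X (D Y Z) p) (W p) - g p (D Y (D X Z) p) (W p)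
      + g p (Z p) (D X (D Y W) p) - g p (Z p) (D Y (D X W) p)"
    by (simp add: deriv_inner D deriv_along_add smooth_inner)
  then show ?thesis
    by (simp add: curvature_def g_commute[of p "Z p"])
qed

lemma bianchi:
  assumes "X \<in> vf" "Y \<in> vf" "Z \<in> vf"
  shows "R X Y Z p + R Y Z X p + R Z X Y p = 0"
proof -
  have "br X (br Y Z) p = D X (D Y Z) p - D X (D Z Y) p - D (br Y Z) X p"
    if "X \<in> vf" "Y \<in> vf" "Z \<in> vf" for X Y Z
    using torsion_free[OF that(1) br_vf[OF that(2,3)]] torsion_free[OF that(2,3)]
    by (simp add: D_diff2 D_vf that)
  from this[OF assms] this[OF assms(2,3,1)] this[OF assms(3,1,2)]
  have "R X Y Z p + R Y Z X p + R Z X Y p = br X (br Y Z) p + br Y (br Z X) p + br Z (br X Y) p"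
    by (simp add: curvature_def)
  moreover have "br Y (br Z X) p = - br Y (br X Z) p"
  proof -
    have "br Z X = (\<lambda>q. (- 1) *\<^sub>R br X Z q)" by (rule ext) (simp add: br_commute[of Z X])
    then show ?thesis using br_scale2[of "\<lambda>q. - 1" Y "br X Z"] assms br_vf by simp
  qed
  moreover have "br Z (br X Y) p = - br (br X Y) Z p" by (rule br_commute)
  ultimately show ?thesis using jacobi[OF assms, of p] by simp
qed

subsection \<open>The Ricci tensor and the Ricci operator\<close>

text \<open>By tensoriality the extensions in the definition of \<open>ricci\<close> may be replaced by any fields with the
  same values. In particular \<open>S(Y, Z)\<close> is the trace of the field of endomorphisms \<open>X \<mapsto> R(X, Y)Z\<close>, to
  which the contraction lemmas apply.\<close>

lemma R_extend:
  assumes "X \<in> vf" "Y \<in> vf" "Z \<in> vf"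
  shows "R (extend_vec A p (X p)) Y Z p = R X Y Z p"
    and "R X (extend_vec A p (Y p)) Z p = R X Y Z p"
    and "R X Y (extend_vec A p (Z p)) p = R X Y Z p"
  by (rule R_pointwise; simp add: assms)+

lemma linear_R1:
  assumes "Y \<in> vf" "Z \<in> vf"
  shows "linear (\<lambda>v. R (extend_vec A p v) Y Z p)"
proof (rule linearI)
  fix v w :: "real ^ 'n" and k :: real
  have "R (extend_vec A p (v + w)) Y Z p = R (\<lambda>q. extend_vec A p v q + extend_vec A p w q) Y Z p"
    by (rule R_pointwise) (simp_all add: assms vf_add)
  then show "R (extend_vec A p (v + w)) Y Z p = R (extend_vec A p v) Y Z p + R (extend_vec A p w) Y Z p"
    by (simp add: R_add1 assms)
  have "R (extend_vec A p (k *\<^sub>R v)) Y Z p = R (\<lambda>q. k *\<^sub>R extend_vec A p v q) Y Z p"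
    by (rule R_pointwise) (simp_all add: assms vf_cmult)
  then show "R (extend_vec A p (k *\<^sub>R v)) Y Z p = k *\<^sub>R R (extend_vec A p v) Y Z p"
    by (simp add: R_scale1 assms)
qed

lemma ricci_eq_trace:
  assumes "Y \<in> vf" "Z \<in> vf" "\<And>X. X \<in> vf \<Longrightarrow> R X Y Z p = w (X p)"
  shows "ric p (Y p) (Z p) = trace (matrix w)"
proof -
  have "R (extend_vec A p v) (extend_vec A p (Y p)) (extend_vec A p (Z p)) p = w v" for v
    using R_extend(2)[of "extend_vec A p v" Y "extend_vec A p (Z p)" p]
      R_extend(3)[of "extend_vec A p v" Y Z p] assms(3)[of "extend_vec A p v"] assms(1,2) by simp
  then show ?thesis by (simp add: ricci_def)
qed

lemma ricci_fields:
  assumes "Y \<in> vf" "Z \<in> vf"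
  shows "ric p (Y p) (Z p) = trace (matrix (\<lambda>v. R (extend_vec A p v) Y Z p))"
  by (rule ricci_eq_trace[OF assms]) (simp add: R_extend assms)

lemma smooth_ricci: "Y \<in> vf \<Longrightarrow> Z \<in> vf \<Longrightarrow> smooth_fun A (\<lambda>q. ric q (Y q) (Z q))"
  unfolding ricci_fields
  by (rule smooth_fun_trace[of "\<lambda>X. R X Y Z"]) (simp_all add: R_vf linear_R1 R_extend)

lemma deriv_ricci:
  assumes "V \<in> vf" "Y \<in> vf" "Z \<in> vf"
    and w: "\<And>X. X \<in> vf \<Longrightarrow> br V (R X Y Z) p - R (br V X) Y Z p = w (X p)"
  shows "drv V (\<lambda>q. ric q (Y q) (Z q)) p = trace (matrix w)"
  unfolding ricci_fields[OF assms(2,3)]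
proof (rule deriv_along_trace[of "\<lambda>X. R X Y Z"])
  show "br V (R X Y Z) p - R (extend_vec A p (br V X p)) Y Z p = w (X p)" if "X \<in> vf" for X
    using w[OF that] R_extend(1)[of "br V X" Y Z p] assms(1-3) that by (simp add: br_vf)
qed (simp_all add: R_vf linear_R1 R_extend assms)

lemma ricci_add1: "ric p (v + v') w = ric p v w + ric p v' w"
  and ricci_scale1: "ric p (k *\<^sub>R v) w = k * ric p v w"
  and ricci_add2: "ric p v (w + w') = ric p v w + ric p v w'"
  and ricci_scale2: "ric p v (k *\<^sub>R w) = k * ric p v w"
proof -
  let ?e = "extend_vec A p"
  have *: "ric p v w = (\<Sum>j\<in>UNIV. R (?e (axis j 1)) (?e v) (?e w) p $ j)" for v w
    by (simp add: ricci_def trace_matrix)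
  have "R X (?e (v + v')) Z p = R X (?e v) Z p + R X (?e v') Z p" if "X \<in> vf" "Z \<in> vf" for X Z
    using R_pointwise[of X X p "?e (v + v')" "\<lambda>q. ?e v q + ?e v' q" Z Z] R_add2 that
    by (simp add: vf_add)
  then show "ric p (v + v') w = ric p v w + ric p v' w"
    by (simp add: * sum.distrib)
  have "R X (?e (k *\<^sub>R v)) Z p = k *\<^sub>R R X (?e v) Z p" if "X \<in> vf" "Z \<in> vf" for X Z
    using R_pointwise[of X X p "?e (k *\<^sub>R v)" "\<lambda>q. k *\<^sub>R ?e v q" Z Z] R_scale2[of "\<lambda>q. k"] that
    by (simp add: vf_cmult)
  then show "ric p (k *\<^sub>R v) w = k * ric p v w"
    by (simp add: * sum_distrib_left)
  have "R X Z (?e (w + w')) p = R X Z (?e w) p + R X Z (?e w') p" if "X \<in> vf" "Z \<in> vf" for X Z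
    using R_pointwise[of X X p Z Z "?e (w + w')" "\<lambda>q. ?e w q + ?e w' q"] R_add3 that
    by (simp add: vf_add)
  then show "ric p v (w + w') = ric p v w + ric p v w'"
    by (simp add: * sum.distrib)
  have "R X Z (?e (k *\<^sub>R w)) p = k *\<^sub>R R X Z (?e w) p" if "X \<in> vf" "Z \<in> vf" for X Z
    using R_pointwise[of X X p Z Z "?e (k *\<^sub>R w)" "\<lambda>q. k *\<^sub>R ?e w q"] R_scale3[of "\<lambda>q. k"] that
    by (simp add: vf_cmult)
  then show "ric p v (k *\<^sub>R w) = k * ric p v w"
    by (simp add: * sum_distrib_left)
qed

lemma ricci_bilinear: "bilinear (ric p)"
  unfolding bilinear_def
  by (intro conjI allI linearI) (simp_all add: ricci_add1 ricci_add2 ricci_scale1 ricci_scale2)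

text \<open>The endomorphism \<open>Q\<close> with \<open>g(Q v, w) = S(v, w)\<close>. Its trace is the scalar curvature, which turns the
  metric trace into a trace of endomorphisms.\<close>

definition ricci_op :: "'a \<Rightarrow> real ^ 'n \<Rightarrow> real ^ 'n" where
  "ricci_op p v = v v* (gram_matrix (ric p) ** matrix_inv (gram_matrix (g p)))"

lemma linear_ricci_op: "linear (ricci_op p)"
  unfolding ricci_op_def[abs_def]
  by (rule linearI) (simp_all add: vector_matrix_mult_def vec_eq_iff sum.distrib sum_distrib_left algebra_simps)

lemma g_ricci_op: "g p (ricci_op p v) w = ric p v w"
proof -
  let ?G = "gram_matrix (g p)" and ?S = "gram_matrix (ric p)"
  have inv: "matrix_inv ?G ** ?G = mat 1"
    using someI_ex[OF lorentzian_form_gram_invertible[OF g_form, of p, unfolded invertible_def]]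
    unfolding matrix_inv_def by (rule conjunct2)
  have "g p (ricci_op p v) w = v \<bullet> ((?S ** matrix_inv ?G) *v (?G *v w))"
    using bilinear_gram[OF g_bilinear, of p "ricci_op p v" w] by (simp only: ricci_op_def dot_lmul_matrix)
  also have "(?S ** matrix_inv ?G) *v (?G *v w) = ?S *v w"
    by (simp only: matrix_vector_mul_assoc matrix_mul_assoc[symmetric] inv matrix_mul_rid)
  also have "v \<bullet> (?S *v w) = ric p v w"
    by (rule bilinear_gram[OF ricci_bilinear, symmetric])
  finally show ?thesis .
qed

lemma scalar_curvature_eq_trace: "scalar_curvature A g D p = trace (matrix (ricci_op p))"
proof -
  let ?M = "gram_matrix (ric p) ** matrix_inv (gram_matrix (g p))"
  have "trace (matrix (ricci_op p)) = trace ?M"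
    by (simp add: trace_def matrix_def ricci_op_def vector_matrix_mult_def axis_def
        if_distrib[of "\<lambda>t. t * _"] if_distrib[of "\<lambda>t. _ * t"] cong: if_cong)
  also have "\<dots> = trace (matrix_inv (gram_matrix (g p)) ** gram_matrix (ric p))"
    by (rule trace_mul_sym)
  finally show ?thesis by (simp add: scalar_curvature_def)
qed

text \<open>In a local frame \<open>E\<close> the components of \<open>ricci_op\<close> applied to \<open>X\<close> solve the linear system with
  coefficients \<open>g(E\<^sub>i, E\<^sub>j)\<close> and right-hand side \<open>S(X, E\<^sub>i)\<close>, so Cramer's rule shows that they are
  smooth.\<close>

lemma ricci_op_vf:
  assumes X: "X \<in> vf"
  shows "(\<lambda>q. ricci_op q (X q)) \<in> vf" (is "?Q \<in> vf")
proof (rule vector_field_local)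
  fix p
  let ?c = "chart_at A p"
  note c = chart_at_in[of p] chart_at_mem[of p]
  obtain E W where E': "\<forall>j::'n. E j \<in> vf" "open W" "p \<in> W" "W \<subseteq> fst ?c"
    "\<forall>j. \<forall>q\<in>W. E j q = vec_from_chart ?c q (axis j 1)"
    by (rule local_frame[OF c])
  note E = E'[rule_format]
  have o: "open (snd ?c ` W)" by (rule open_image_chart'[OF c(1) E(2,4)])
  have sub: "snd ?c ` W \<subseteq> chart_image ?c" using E(4) chart_in_image[OF c(1)] by blast
  have local: "smooth_on (snd ?c ` W) (f \<circ> chart_inv ?c)" if "smooth_fun A f" for f
    by (rule smooth_on_subset[OF open_chart_image[OF c(1)] o sub smooth_fun_in_chart[OF that c(1)]])
  define M :: "'a \<Rightarrow> real ^ 'n ^ 'n" where "M q = (\<chi> i j. g q (E i q) (E j q))" for q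
  define b where "b i q = ric q (X q) (E i q)" for i q
  let ?F = "\<lambda>x. \<chi> k. det (\<chi> i j. if j = k then b i (chart_inv ?c x) else M (chart_inv ?c x) $ i $ j)
      / det (M (chart_inv ?c x))"
  have comb: "(\<Sum>j\<in>UNIV. (y $ j) *\<^sub>R E j q) = vec_from_chart ?c q y" if "q \<in> W" for q and y :: "real ^ 'n"
  proof -
    have lin: "linear (vec_from_chart ?c q)" using linear_vec_from_chart[OF c(1)] that E(4) by blast
    have "y = (\<Sum>j\<in>UNIV. (y $ j) *\<^sub>R axis j 1)"
      using basis_expansion[of y] by (simp add: scalar_mult_eq_scaleR)
    then have "vec_from_chart ?c q y = vec_from_chart ?c q (\<Sum>j\<in>UNIV. (y $ j) *\<^sub>R axis j 1)" by simp
    also have "\<dots> = (\<Sum>j\<in>UNIV. (y $ j) *\<^sub>R E j q)"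
      using that by (simp add: linear_sum[OF lin] linear_cmul[OF lin] E(5))
    finally show ?thesis by simp
  qed
  have My: "(M q *v y) $ i = g q (vec_from_chart ?c q y) (E i q)" if "q \<in> W" for q i and y :: "real ^ 'n"
  proof -
    have "g q (vec_from_chart ?c q y) (E i q) = (\<Sum>j\<in>UNIV. y $ j * g q (E j q) (E i q))"
      by (simp add: comb[OF that, symmetric] linear_sum[OF g_linear1])
    then show ?thesis
      by (simp add: matrix_vector_mult_def M_def mult.commute g_commute[of q "E i q"])
  qed
  have det: "det (M q) \<noteq> 0" if q: "q \<in> W" for q
  proof -
    have qc: "q \<in> fst ?c" using q E(4) by blast
    have "y = 0" if "M q *v y = 0" for y
    proof -
      have 1: "g q (vec_from_chart ?c q y) (E i q) = 0" for i
        using My[OF q, of y i] that by simp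
      have "g q (vec_from_chart ?c q y) v = 0" for v
      proof -
        have "v = (\<Sum>j\<in>UNIV. (vec_in_chart A ?c q v $ j) *\<^sub>R E j q)"
          by (simp add: comb[OF q] vec_from_in_chart[OF c(1) qc])
        then have "g q (vec_from_chart ?c q y) v =
            g q (vec_from_chart ?c q y) (\<Sum>j\<in>UNIV. (vec_in_chart A ?c q v $ j) *\<^sub>R E j q)" by simp
        then show ?thesis by (simp add: linear_sum[OF g_linear2] 1)
      qed
      then have "vec_from_chart ?c q y = 0" by (rule lorentzian_form_nondegenerate[OF g_form])
      then show ?thesis
        using vec_in_from_chart[OF c(1) qc, of y] linear_0[OF linear_vec_in_chart[OF c(1) qc]] by simp
    qed
    then have "invertible (M q)"
      unfolding invertible_left_inverse matrix_left_invertible_ker by blast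
    then show ?thesis by (simp add: invertible_det_nz)
  qed
  have M: "smooth_on (snd ?c ` W) (\<lambda>x. M (chart_inv ?c x) $ i $ j)" for i j
    using local[OF smooth_inner[OF E(1) E(1)], of i j] by (simp add: M_def o_def)
  have b: "smooth_on (snd ?c ` W) (\<lambda>x. b i (chart_inv ?c x))" for i
    using local[OF smooth_ricci[OF X E(1)], of i] by (simp add: b_def o_def)
  have inW: "chart_inv ?c x \<in> W" if x: "x \<in> snd ?c ` W" for x
  proof -
    obtain q where q: "q \<in> W" "x = snd ?c q" using x by blast
    then have "q \<in> fst ?c" using E(4) by blast
    then show ?thesis using q chart_inv_chart[OF c(1)] by simp
  qed
  have "smooth_on (snd ?c ` W) (\<lambda>x. (if j = k then b i (chart_inv ?c x) else M (chart_inv ?c x) $ i $ j))"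
    for i j k by (cases "j = k") (simp_all add: M b)
  then have "smooth_on (snd ?c ` W) (\<lambda>x. det (\<chi> i j. if j = k then b i (chart_inv ?c x) else M (chart_inv ?c x) $ i $ j))"
    for k by (intro smooth_on_det o) simp
  then have "smooth_on (snd ?c ` W) ?F"
    by (intro smooth_on_componentwise o) (simp add: smooth_on_divide o smooth_on_det M det inW)
  moreover have "?F x = field_in_chart A ?c ?Q x" if x: "x \<in> snd ?c ` W" for x
  proof -
    let ?q = "chart_inv ?c x" and ?y = "field_in_chart A ?c ?Q x"
    have q: "?q \<in> W" "?q \<in> fst ?c" using inW[OF x] E(4) by auto
    have "(M ?q *v ?y) $ i = b i ?q" for i
      by (simp add: My[OF q(1)] field_in_chart_def vec_from_in_chart[OF c(1) q(2)] g_ricci_op b_def)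
    then have "M ?q *v ?y = (\<chi> i. b i ?q)" by (simp add: vec_eq_iff)
    from iffD1[OF cramer[OF det[OF q(1)]] this] show ?thesis
      unfolding vec_lambda_beta by (rule sym)
  qed
  ultimately have "smooth_on (snd ?c ` W) (field_in_chart A ?c ?Q)"
    by (rule smooth_on_cong[OF o, rotated])
  then show "\<exists>c\<in>A. \<exists>W. open W \<and> p \<in> W \<and> W \<subseteq> fst c \<and> smooth_on (snd c ` W) (field_in_chart A c ?Q)"
    using E(2-4) by (intro bexI[OF _ c(1)] exI[of _ W] conjI)
qed

lemma deriv_scalar_curvature:
  assumes "V \<in> vf"
    and w: "\<And>X. X \<in> vf \<Longrightarrow> br V (\<lambda>q. ricci_op q (X q)) p - ricci_op p (br V X p) = w (X p)"
  shows "drv V (scalar_curvature A g D) p = trace (matrix w)"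
proof -
  have "scalar_curvature A g D = (\<lambda>q. trace (matrix (ricci_op q)))"
    by (rule ext) (rule scalar_curvature_eq_trace)
  then show ?thesis
    using deriv_along_trace[of "\<lambda>X q. ricci_op q (X q)" ricci_op V p w] assms
    by (simp add: ricci_op_vf linear_ricci_op)
qed

end

section \<open>Curvature of Lorentzian para-Kenmotsu manifolds\<close>

lemma trace_ident: "trace (matrix (\<lambda>v. a *\<^sub>R v :: real ^ 'n::finite)) = a * real CARD('n)"
  by (simp add: trace_def matrix_def)

lemma trace_rank_one:
  fixes f :: "real ^ 'n::finite \<Rightarrow> real"
  assumes "linear f"
  shows "trace (matrix (\<lambda>v. f v *\<^sub>R a)) = f a"
proof -
  have "a = (\<Sum>j\<in>UNIV. (a $ j) *\<^sub>R axis j 1)"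
    using basis_expansion[of a] by (simp add: scalar_mult_eq_scaleR)
  then have "f a = f (\<Sum>j\<in>UNIV. (a $ j) *\<^sub>R axis j 1)" by simp
  also have "\<dots> = (\<Sum>j\<in>UNIV. f (axis j 1) * a $ j)"
    by (simp add: linear_sum[OF assms] linear_cmul[OF assms] mult.commute)
  finally show ?thesis by (simp add: trace_def matrix_def)
qed

lemma trace_add: "trace (matrix (\<lambda>v. f v + h v :: real ^ 'n::finite)) = trace (matrix f) + trace (matrix h)"
  by (simp add: trace_def matrix_def sum.distrib)

lemma trace_diff: "trace (matrix (\<lambda>v. f v - h v :: real ^ 'n::finite)) = trace (matrix f) - trace (matrix h)"
  by (simp add: trace_def matrix_def sum_subtractf)

locale lp_kenmotsu_manifold = levi_civita_manifold A g D
  for A :: "('a::{t2_space, second_countable_topology}, 'n::finite) chart set"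
    and g :: "'a \<Rightarrow> real ^ 'n \<Rightarrow> real ^ 'n \<Rightarrow> real"
    and D :: "('a, 'n) vfield \<Rightarrow> ('a, 'n) vfield \<Rightarrow> ('a, 'n) vfield" +
  fixes \<phi> :: "'a \<Rightarrow> real ^ 'n \<Rightarrow> real ^ 'n"
    and \<zeta> :: "('a, 'n) vfield"
    and \<nu> :: "'a \<Rightarrow> real ^ 'n \<Rightarrow> real"
  assumes almost_paracontact: "lorentzian_almost_paracontact A \<phi> \<zeta> \<nu> g"
    and cov_deriv_phi: "\<And>E F p. E \<in> vector_fields A \<Longrightarrow> F \<in> vector_fields A \<Longrightarrow>
      cov_deriv_11 D \<phi> E F p = - (g p (\<phi> p (E p)) (F p) *\<^sub>R \<zeta> p) - \<nu> p (F p) *\<^sub>R \<phi> p (E p)"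
begin

lemma zeta_vf: "\<zeta> \<in> vf"
  using almost_paracontact by (simp add: lorentzian_almost_paracontact_def)

lemma two_le_dim: "2 \<le> CARD('n)"
  using almost_paracontact by (simp add: lorentzian_almost_paracontact_def)

lemma nu_zeta [simp]: "\<nu> p (\<zeta> p) = - 1" and phi_zeta [simp]: "\<phi> p (\<zeta> p) = 0"
  using almost_paracontact by (simp_all add: lorentzian_almost_paracontact_def)

lemma phi_phi: "\<phi> p (\<phi> p v) = v + \<nu> p v *\<^sub>R \<zeta> p"
  and nu_phi: "\<nu> p (\<phi> p v) = 0"
  and g_zeta [simp]: "g p v (\<zeta> p) = \<nu> p v"
proof -
  have "\<forall>E\<in>vf. \<forall>p. \<phi> p (\<phi> p (E p)) = E p + \<nu> p (E p) *\<^sub>R \<zeta> p \<and>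
      \<nu> p (\<phi> p (E p)) = 0 \<and> g p (E p) (\<zeta> p) = \<nu> p (E p)"
    using almost_paracontact by (simp add: lorentzian_almost_paracontact_def)
  from bspec[OF this extend_vec_vf[of p v], rule_format, of p]
  show "\<phi> p (\<phi> p v) = v + \<nu> p v *\<^sub>R \<zeta> p" "\<nu> p (\<phi> p v) = 0" "g p v (\<zeta> p) = \<nu> p v"
    by simp_all
qed

lemma g_zeta' [simp]: "g p (\<zeta> p) v = \<nu> p v"
  by (subst g_commute) simp

lemma nu_linear: "linear (\<nu> p)"
  using g_linear1[of p "\<zeta> p"] by simp

lemmas nu_simps [simp] = linear_add[OF nu_linear] linear_diff[OF nu_linear] linear_neg[OF nu_linear]
  linear_cmul[OF nu_linear, simplified] linear_0[OF nu_linear]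

lemma phi_linear: "linear (\<phi> p)"
  using almost_paracontact by (simp add: lorentzian_almost_paracontact_def tensor_field_11_def)

abbreviation nu_fun :: "('a, 'n) vfield \<Rightarrow> 'a \<Rightarrow> real" where
  "nu_fun X \<equiv> \<lambda>p. \<nu> p (X p)"

lemma smooth_nu: "X \<in> vf \<Longrightarrow> smooth_fun A (nu_fun X)"
  using smooth_inner[of X \<zeta>] zeta_vf by simp

text \<open>The metric on the orthogonal complement of \<open>\<zeta>\<close>, extended by zero along \<open>\<zeta>\<close>;
  up to the factor \<open>- 2\<close> it is \<open>\<L>\<^sub>\<zeta> g\<close>.\<close>

definition g_hor :: "'a \<Rightarrow> real ^ 'n \<Rightarrow> real ^ 'n \<Rightarrow> real" where
  "g_hor p v w = g p v w + \<nu> p v * \<nu> p w"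

lemma g_hor_commute: "g_hor p v w = g_hor p w v"
  by (simp add: g_hor_def g_commute[of p v w])

text \<open>Applying \<open>\<nabla>\<^sub>E \<phi>\<close> to \<open>\<zeta>\<close> determines \<open>\<phi> (\<nabla>\<^sub>E \<zeta>)\<close>, and \<open>\<zeta>\<close> has constant length,
  so \<open>\<nabla>\<^sub>E \<zeta>\<close> has no component along the kernel of \<open>\<phi>\<close>.\<close>

lemma D_zeta:
  assumes E: "E \<in> vf"
  shows "D E \<zeta> = (\<lambda>p. - E p - \<nu> p (E p) *\<^sub>R \<zeta> p)"
proof
  fix p
  have z: "(\<lambda>q. \<phi> q (\<zeta> q)) = (\<lambda>q. 0)" by (rule ext) simp
  have "drv E (ip \<zeta> \<zeta>) p = 0" by simp
  then have nu0: "\<nu> p (D E \<zeta> p) = 0"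
    unfolding deriv_inner[OF E zeta_vf zeta_vf] by simp
  have "- \<phi> p (D E \<zeta> p) = \<phi> p (E p)"
    using cov_deriv_phi[OF E zeta_vf, of p] by (simp add: cov_deriv_11_def z D_zero2[OF E] nu_phi)
  then have "\<phi> p (- \<phi> p (D E \<zeta> p)) = \<phi> p (\<phi> p (E p))" by simp
  then have "- D E \<zeta> p = E p + \<nu> p (E p) *\<^sub>R \<zeta> p"
    by (simp add: linear_neg[OF phi_linear] phi_phi nu0)
  then show "D E \<zeta> p = - E p - \<nu> p (E p) *\<^sub>R \<zeta> p"
    by (metis minus_add_distrib minus_minus uminus_add_conv_diff add.commute)
qed

lemma drv_nu:
  assumes "X \<in> vf" "Y \<in> vf"
  shows "drv X (nu_fun Y) = (\<lambda>p. \<nu> p (D X Y p) - g_hor p (X p) (Y p))"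
  using deriv_inner[OF assms zeta_vf]
  by (simp add: fun_eq_iff D_zeta assms g_hor_def g_commute[of _ "Y _" "X _"] algebra_simps)

text \<open>\<open>\<nabla>\<nu> = - g_hor\<close> is symmetric, hence \<open>\<nu>\<close> is closed.\<close>

lemma nu_closed:
  assumes "X \<in> vf" "Y \<in> vf"
  shows "drv X (nu_fun Y) p - drv Y (nu_fun X) p = \<nu> p (br X Y p)"
  by (simp add: drv_nu torsion_free assms g_hor_commute[of p "Y p"])

lemma br_zeta:
  assumes "X \<in> vf"
  shows "br \<zeta> X = (\<lambda>p. D \<zeta> X p + X p + \<nu> p (X p) *\<^sub>R \<zeta> p)"
  by (simp add: torsion_free zeta_vf assms D_zeta fun_eq_iff)

lemma vf_nu_zeta: "X \<in> vf \<Longrightarrow> (\<lambda>p. \<nu> p (X p) *\<^sub>R \<zeta> p) \<in> vf"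
  by (rule vf_scaleR[OF smooth_nu zeta_vf])

text \<open>The second covariant derivative of \<open>\<zeta>\<close> is explicit by \<open>D_zeta\<close>, and the terms along \<open>\<zeta>\<close> cancel because
  \<open>\<nu>\<close> is closed.\<close>

lemma R_zeta3:
  assumes "X \<in> vf" "Y \<in> vf"
  shows "R X Y \<zeta> p = \<nu> p (Y p) *\<^sub>R X p - \<nu> p (X p) *\<^sub>R Y p"
proof -
  have second: "D X (D Y \<zeta>) p = - D X Y p - drv X (nu_fun Y) p *\<^sub>R \<zeta> p + \<nu> p (Y p) *\<^sub>R (X p + \<nu> p (X p) *\<^sub>R \<zeta> p)"
    if "X \<in> vf" "Y \<in> vf" for X Y
  proof -
    have "D X (D Y \<zeta>) = D X (\<lambda>p. - Y p - \<nu> p (Y p) *\<^sub>R \<zeta> p)" by (simp only: D_zeta[OF that(2)])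
    then show ?thesis
      by (simp add: D_diff2 D_minus2 D_scale2 that vf_minus vf_nu_zeta smooth_nu zeta_vf D_zeta algebra_simps)
  qed
  have "D (br X Y) \<zeta> p = D Y X p - D X Y p - \<nu> p (br X Y p) *\<^sub>R \<zeta> p"
    unfolding D_zeta[OF br_vf[OF assms]] by (simp add: torsion_free assms)
  then show ?thesis
    unfolding curvature_def second[OF assms] second[OF assms(2,1)] nu_closed[OF assms, symmetric]
    by (simp add: algebra_simps)
qed

text \<open>The tensor \<open>g(R(\<zeta>,X)Y, Z)\<close> is skew in \<open>Y, Z\<close>, and its skew part in \<open>X, Y\<close> is known from the
  Bianchi identity; these two symmetries determine it, as in the Koszul formula.\<close>

lemma R_zeta1:
  assumes "X \<in> vf" "Y \<in> vf"
  shows "R \<zeta> X Y p = g p (X p) (Y p) *\<^sub>R \<zeta> p - \<nu> p (Y p) *\<^sub>R X p"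
proof (rule g_eqI_fields)
  fix Z assume Z: "Z \<in> vf"
  have skew: "g p (R \<zeta> X Y p) (Z p) = - g p (R \<zeta> X Z p) (Y p)" if "X \<in> vf" "Y \<in> vf" "Z \<in> vf" for X Y Z
    by (rule R_metric[OF zeta_vf that])
  have swap: "g p (R \<zeta> X Y p) (Z p) - g p (R \<zeta> Y X p) (Z p)
      = \<nu> p (X p) * g p (Y p) (Z p) - \<nu> p (Y p) * g p (X p) (Z p)"
    if "X \<in> vf" "Y \<in> vf" "Z \<in> vf" for X Y Z
  proof -
    have "R \<zeta> X Y p + R X Y \<zeta> p - R \<zeta> Y X p = 0"
      using bianchi[OF zeta_vf that(1,2), of p] R_commute[OF zeta_vf that(2,1), of p] by simp
    then have "R \<zeta> X Y p - R \<zeta> Y X p = - R X Y \<zeta> p" by (simp add: algebra_simps eq_neg_iff_add_eq_0)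
    then have "g p (R \<zeta> X Y p - R \<zeta> Y X p) (Z p) = g p (- R X Y \<zeta> p) (Z p)" by simp
    then show ?thesis by (simp add: R_zeta3 that)
  qed
  have "g p (R \<zeta> X Y p) (Z p) = \<nu> p (Z p) * g p (X p) (Y p) - \<nu> p (Y p) * g p (X p) (Z p)"
    using skew[OF assms Z] skew[OF assms(2,1) Z] skew[OF Z assms] swap[OF assms Z] swap[OF assms(2) Z assms(1)]
      swap[OF Z assms]
    by (simp add: g_commute[of p "Z p"] g_commute[of p "Y p" "X p"])
  then show "g p (R \<zeta> X Y p) (Z p) = g p (g p (X p) (Y p) *\<^sub>R \<zeta> p - \<nu> p (Y p) *\<^sub>R X p) (Z p)"
    by simp
qed

lemma ricci_zeta: "ric p v (\<zeta> p) = (real CARD('n) - 1) * \<nu> p v"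
proof -
  let ?Y = "extend_vec A p v"
  have "ric p (?Y p) (\<zeta> p) = trace (matrix (\<lambda>u. \<nu> p v *\<^sub>R u - \<nu> p u *\<^sub>R v))"
    by (rule ricci_eq_trace) (simp_all add: zeta_vf R_zeta3)
  then show ?thesis
    by (simp add: trace_diff trace_ident trace_rank_one[OF nu_linear] algebra_simps)
qed

subsection \<open>Lie derivatives along the Reeb field\<close>

text \<open>The Lie derivative of the connection, \<open>(\<L>\<^sub>\<zeta> \<nabla>)(E, F) = 2 g_hor(E, F) \<zeta>\<close>. It combines \<open>R(\<zeta>, E)F\<close> with
  the second covariant derivative of \<open>\<zeta>\<close>, both of which are explicit.\<close>

lemma lie_zeta_connection:
  assumes "E \<in> vf" "F \<in> vf"
  shows "br \<zeta> (D E F) =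
    (\<lambda>p. D (br \<zeta> E) F p + D E (br \<zeta> F) p + (2 * g_hor p (E p) (F p)) *\<^sub>R \<zeta> p)"
proof
  fix p
  have 1: "D E (br \<zeta> F) p = D E (D \<zeta> F) p + D E F p + drv E (nu_fun F) p *\<^sub>R \<zeta> p + \<nu> p (F p) *\<^sub>R D E \<zeta> p"
    unfolding br_zeta[OF assms(2)]
    by (simp add: D_add2 D_scale2 assms vf_add vf_nu_zeta D_vf zeta_vf smooth_nu)
  have 2: "br \<zeta> (D E F) p = D \<zeta> (D E F) p + D E F p + \<nu> p (D E F p) *\<^sub>R \<zeta> p"
    unfolding br_zeta[OF D_vf[OF assms]] ..
  have 3: "D \<zeta> (D E F) p = D E (D \<zeta> F) p + D (br \<zeta> E) F p + (g p (E p) (F p) *\<^sub>R \<zeta> p - \<nu> p (F p) *\<^sub>R E p)"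
    using R_zeta1[OF assms, of p] by (simp add: curvature_def algebra_simps)
  show "br \<zeta> (D E F) p = D (br \<zeta> E) F p + D E (br \<zeta> F) p + (2 * g_hor p (E p) (F p)) *\<^sub>R \<zeta> p"
    unfolding 1 2 3 drv_nu[OF assms] D_zeta[OF assms(1)]
    by (simp add: g_hor_def algebra_simps flip: scaleR_2)
qed

lemma drv_g_hor:
  assumes "E \<in> vf" "F \<in> vf" "G \<in> vf"
  shows "drv E (\<lambda>q. g_hor q (F q) (G q)) p = g_hor p (D E F p) (G p) + g_hor p (F p) (D E G p)
    - g_hor p (E p) (F p) * \<nu> p (G p) - g_hor p (E p) (G p) * \<nu> p (F p)"
proof -
  have "drv E (\<lambda>q. g_hor q (F q) (G q)) p = drv E (ip F G) p
      + (drv E (nu_fun F) p * \<nu> p (G p) + \<nu> p (F p) * drv E (nu_fun G) p)"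
    unfolding g_hor_def
    by (simp add: deriv_along_add deriv_along_mult smooth_inner smooth_nu smooth_fun_mult assms)
  then show ?thesis
    by (simp add: deriv_inner drv_nu assms) (simp add: g_hor_def algebra_simps)
qed

lemma smooth_g_hor: "E \<in> vf \<Longrightarrow> F \<in> vf \<Longrightarrow> smooth_fun A (\<lambda>q. g_hor q (E q) (F q))"
  unfolding g_hor_def by (intro smooth_fun_add smooth_fun_mult smooth_inner smooth_nu)

lemma br_diff2: "X \<in> vf \<Longrightarrow> Y \<in> vf \<Longrightarrow> Z \<in> vf \<Longrightarrow> br X (\<lambda>q. Y q - Z q) = (\<lambda>p. br X Y p - br X Z p)"
  by (simp add: torsion_free vf_diff D_diff1 D_diff2 fun_eq_iff algebra_simps)

text \<open>Differentiating the definition of the curvature, with \<open>\<L>\<^sub>\<zeta>\<close> acting as a derivation on brackets and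
  on \<open>\<nabla>\<close> up to the correction above. The components along \<open>\<zeta>\<close> cancel since \<open>\<nabla>g_hor\<close> is explicit.\<close>

lemma lie_zeta_curvature:
  assumes "E \<in> vf" "F \<in> vf" "G \<in> vf"
  shows "br \<zeta> (R E F G) p = R (br \<zeta> E) F G p + R E (br \<zeta> F) G p + R E F (br \<zeta> G) p
    + (2 * g_hor p (E p) (G p)) *\<^sub>R F p - (2 * g_hor p (F p) (G p)) *\<^sub>R E p"
proof -
  note v = D_vf br_vf zeta_vf
  have second: "br \<zeta> (D E (D F G)) p = D (br \<zeta> E) (D F G) p + D E (D (br \<zeta> F) G) p + D E (D F (br \<zeta> G)) p
      + (2 * drv E (\<lambda>q. g_hor q (F q) (G q)) p) *\<^sub>R \<zeta> p
      + (2 * g_hor p (F p) (G p)) *\<^sub>R (- E p - \<nu> p (E p) *\<^sub>R \<zeta> p)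
      + (2 * g_hor p (E p) (D F G p)) *\<^sub>R \<zeta> p" if "E \<in> vf" "F \<in> vf" for E F
  proof -
    have s: "smooth_fun A (\<lambda>q. 2 * g_hor q (F q) (G q))"
      by (intro smooth_fun_mult smooth_fun_const smooth_g_hor that assms)
    have "D E (br \<zeta> (D F G)) p = D E (D (br \<zeta> F) G) p + D E (D F (br \<zeta> G)) p
      + (2 * drv E (\<lambda>q. g_hor q (F q) (G q)) p) *\<^sub>R \<zeta> p
      + (2 * g_hor p (F p) (G p)) *\<^sub>R (- E p - \<nu> p (E p) *\<^sub>R \<zeta> p)"
      unfolding lie_zeta_connection[OF that(2) assms(3)]
      by (simp add: D_add2 D_scale2 s v that assms vf_add vf_scaleR[OF s] D_zeta deriv_along_cmult smooth_g_hor)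
    then show ?thesis
      by (simp add: lie_zeta_connection[OF that(1) D_vf[OF that(2) assms(3)]])
  qed
  have "br \<zeta> (br E F) = (\<lambda>q. br (br \<zeta> E) F q + br E (br \<zeta> F) q)"
    by (rule ext) (rule jacobi[OF zeta_vf assms(1,2)])
  then have third: "br \<zeta> (D (br E F) G) p = D (br (br \<zeta> E) F) G p + D (br E (br \<zeta> F)) G p
      + D (br E F) (br \<zeta> G) p + (2 * g_hor p (br E F p) (G p)) *\<^sub>R \<zeta> p"
    by (simp add: lie_zeta_connection v assms D_add1)
  have "br \<zeta> (R E F G) p = br \<zeta> (D E (D F G)) p - br \<zeta> (D F (D E G)) p - br \<zeta> (D (br E F) G) p"
    by (simp add: curvature_def[abs_def] br_diff2 vf_diff v assms)
  moreover have "g_hor p (br E F p) (G p) = g_hor p (D E F p) (G p) - g_hor p (D F E p) (G p)"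
    by (simp add: torsion_free assms g_hor_def algebra_simps)
  ultimately show ?thesis
    unfolding second[OF assms(1,2)] second[OF assms(2,1)] third drv_g_hor[OF assms] drv_g_hor[OF assms(2,1,3)]
    by (simp add: curvature_def g_hor_commute[of p "F p" "E p"] algebra_simps)
qed

lemma lie_zeta_ricci:
  assumes "Y \<in> vf" "Z \<in> vf"
  shows "drv \<zeta> (\<lambda>q. ric q (Y q) (Z q)) p = ric p (br \<zeta> Y p) (Z p) + ric p (Y p) (br \<zeta> Z p)
    - 2 * (real CARD('n) - 1) * g_hor p (Y p) (Z p)"
proof -
  let ?e = "extend_vec A p"
  let ?w = "\<lambda>u. R (?e u) (br \<zeta> Y) Z p + R (?e u) Y (br \<zeta> Z) p + (2 * g_hor p u (Z p)) *\<^sub>R Y p - (2 * g_hor p (Y p) (Z p)) *\<^sub>R u"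
  have "drv \<zeta> (\<lambda>q. ric q (Y q) (Z q)) p = trace (matrix ?w)"
    by (rule deriv_ricci[OF zeta_vf assms])
       (simp add: lie_zeta_curvature assms R_extend br_vf zeta_vf)
  moreover have "linear (\<lambda>u. 2 * g_hor p u (Z p))"
    by (rule linearI) (simp_all add: g_hor_def algebra_simps)
  ultimately show ?thesis
    using ricci_fields[of "br \<zeta> Y" Z p] ricci_fields[of Y "br \<zeta> Z" p]
    by (simp add: trace_add trace_diff trace_ident trace_rank_one br_vf zeta_vf assms algebra_simps)
qed

lemma lie_zeta_metric:
  assumes "X \<in> vf" "Y \<in> vf"
  shows "drv \<zeta> (ip X Y) p = g p (br \<zeta> X p) (Y p) + g p (X p) (br \<zeta> Y p) - 2 * g_hor p (X p) (Y p)"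
  by (simp add: deriv_inner br_zeta zeta_vf assms g_hor_def algebra_simps)

lemma lie_zeta_ricci_op:
  assumes X: "X \<in> vf"
  shows "br \<zeta> (\<lambda>q. ricci_op q (X q)) p - ricci_op p (br \<zeta> X p)
    = 2 *\<^sub>R ricci_op p (X p) - (2 * (real CARD('n) - 1)) *\<^sub>R X p"
proof (rule g_eqI_fields)
  fix Y assume Y: "Y \<in> vf"
  have nuQ: "\<nu> p (ricci_op p v) = (real CARD('n) - 1) * \<nu> p v" for v
    using g_ricci_op[of p v "\<zeta> p"] by (simp add: ricci_zeta)
  have "drv \<zeta> (\<lambda>q. g q (ricci_op q (X q)) (Y q)) p = drv \<zeta> (\<lambda>q. ric q (X q) (Y q)) p"
    by (simp add: g_ricci_op)
  then have "g p (br \<zeta> (\<lambda>q. ricci_op q (X q)) p) (Y p) + ric p (X p) (br \<zeta> Y p) - 2 * g_hor p (ricci_op p (X p)) (Y p)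
      = ric p (br \<zeta> X p) (Y p) + ric p (X p) (br \<zeta> Y p) - 2 * (real CARD('n) - 1) * g_hor p (X p) (Y p)"
    using lie_zeta_metric[OF ricci_op_vf[OF X] Y, of p] lie_zeta_ricci[OF X Y, of p] by (simp add: g_ricci_op)
  then show "g p (br \<zeta> (\<lambda>q. ricci_op q (X q)) p - ricci_op p (br \<zeta> X p)) (Y p)
      = g p (2 *\<^sub>R ricci_op p (X p) - (2 * (real CARD('n) - 1)) *\<^sub>R X p) (Y p)"
    by (simp add: g_hor_def g_ricci_op nuQ algebra_simps)
qed

text \<open>Taking traces of \<open>\<L>\<^sub>\<zeta> Q = 2 Q - 2 (n - 1)\<close>. In particular a constant scalar curvature must
  be \<open>n (n - 1)\<close>.\<close>

lemma drv_zeta_scalar_curvature: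
  "drv \<zeta> (scalar_curvature A g D) p =
    2 * scalar_curvature A g D p - 2 * real CARD('n) * (real CARD('n) - 1)"
proof -
  have "drv \<zeta> (scalar_curvature A g D) p =
      trace (matrix (\<lambda>v. 2 *\<^sub>R ricci_op p v - (2 * (real CARD('n) - 1)) *\<^sub>R v))"
    by (rule deriv_scalar_curvature[OF zeta_vf lie_zeta_ricci_op])
  moreover have "trace (matrix (\<lambda>v. 2 *\<^sub>R ricci_op p v)) = 2 * trace (matrix (ricci_op p))"
    by (simp add: trace_def matrix_def sum_distrib_left)
  ultimately have "drv \<zeta> (scalar_curvature A g D) p =
      2 * trace (matrix (ricci_op p)) - 2 * (real CARD('n) - 1) * real CARD('n)"
    by (simp only: trace_diff trace_ident)
  then show ?thesis by (simp add: scalar_curvature_eq_trace algebra_simps)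
qed

end

section \<open>Lie derivatives of covariant tensors\<close>

context manifold
begin

text \<open>Covariant tensors appear as function-valued maps on vector fields, so that a Lie derivative can
  be differentiated again.\<close>

definition lie1 :: "('a, 'n) vfield \<Rightarrow> (('a, 'n) vfield \<Rightarrow> 'a \<Rightarrow> real) \<Rightarrow> ('a, 'n) vfield \<Rightarrow> 'a \<Rightarrow> real" where
  "lie1 X \<alpha> E p = deriv_along A X (\<alpha> E) p - \<alpha> (lie_bracket A X E) p"

definition lie2 :: "('a, 'n) vfield \<Rightarrow> (('a, 'n) vfield \<Rightarrow> ('a, 'n) vfield \<Rightarrow> 'a \<Rightarrow> real) \<Rightarrow>
    ('a, 'n) vfield \<Rightarrow> ('a, 'n) vfield \<Rightarrow> 'a \<Rightarrow> real" where
  "lie2 X b E F p = deriv_along A X (b E F) p - b (lie_bracket A X E) F p - b E (lie_bracket A X F) p"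

end

context levi_civita_manifold
begin

lemma lie2_cong:
  assumes "\<And>E F. E \<in> vf \<Longrightarrow> F \<in> vf \<Longrightarrow> b E F = b' E F" and "X \<in> vf" "E \<in> vf" "F \<in> vf"
  shows "lie2 X b E F p = lie2 X b' E F p"
  by (simp add: lie2_def assms br_vf)

lemma lie2_add:
  assumes "smooth_fun A (b E F)" "smooth_fun A (b' E F)"
  shows "lie2 X (\<lambda>E F p. b E F p + b' E F p) E F p = lie2 X b E F p + lie2 X b' E F p"
  by (simp add: lie2_def deriv_along_add assms)

lemma lie2_cmult:
  assumes "smooth_fun A (b E F)"
  shows "lie2 X (\<lambda>E F p. t * b E F p) E F p = t * lie2 X b E F p"
  by (simp add: lie2_def deriv_along_cmult assms algebra_simps)

lemma lie2_tensor:
  assumes "smooth_fun A (\<alpha> E)" "smooth_fun A (\<beta> F)"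
  shows "lie2 X (\<lambda>E F p. \<alpha> E p * \<beta> F p) E F p = lie1 X \<alpha> E p * \<beta> F p + \<alpha> E p * lie1 X \<beta> F p"
  by (simp add: lie1_def lie2_def deriv_along_mult assms algebra_simps)

lemma smooth_lie2:
  assumes "\<And>E F. E \<in> vf \<Longrightarrow> F \<in> vf \<Longrightarrow> smooth_fun A (b E F)" "X \<in> vf" "E \<in> vf" "F \<in> vf"
  shows "smooth_fun A (lie2 X b E F)"
  unfolding lie2_def[abs_def]
  by (intro smooth_fun_diff smooth_deriv_along assms br_vf)

text \<open>\<open>\<L>\<^sub>X \<L>\<^sub>Y - \<L>\<^sub>Y \<L>\<^sub>X = \<L>\<^bsub>[X,Y]\<^esub>\<close>, by the Jacobi identity.\<close>

lemma lie2_commutator: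
  assumes "X \<in> vf" "Y \<in> vf" "E \<in> vf" "F \<in> vf"
  shows "lie2 X (lie2 Y ip) E F p = lie2 Y (lie2 X ip) E F p + lie2 (br X Y) ip E F p"
proof -
  note v = assms br_vf
  have s: "smooth_fun A (drv Z (ip E F))" if "Z \<in> vf" "E \<in> vf" "F \<in> vf" for Z E F
    using that smooth_deriv_along smooth_inner by simp
  have expand: "lie2 X (lie2 Y ip) E F p = drv X (drv Y (ip E F)) p
      - drv X (ip (br Y E) F) p - drv X (ip E (br Y F)) p
      - drv Y (ip (br X E) F) p - drv Y (ip E (br X F)) p
      + g p (br Y (br X E) p) (F p) + g p (br X E p) (br Y F p)
      + g p (br Y E p) (br X F p) + g p (E p) (br Y (br X F) p)" if "X \<in> vf" "Y \<in> vf" for X Y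
    using that assms(3,4)
    by (simp add: lie2_def[abs_def] deriv_along_diff smooth_fun_diff smooth_inner s br_vf)
  have jac: "br (br X Y) Z p = br X (br Y Z) p - br Y (br X Z) p" if "Z \<in> vf" for Z
    using jacobi[OF assms(1,2) that, of p] by simp
  have "lie2 (br X Y) ip E F p = drv X (drv Y (ip E F)) p - drv Y (drv X (ip E F)) p
      - g p (br X (br Y E) p - br Y (br X E) p) (F p) - g p (E p) (br X (br Y F) p - br Y (br X F) p)"
    using assms by (simp only: lie2_def deriv_br smooth_inner jac)
  then show ?thesis
    unfolding expand[OF assms(1,2)] expand[OF assms(2,1)] by simp
qed

end

section \<open>Ricci-Yamabe solitons on Lorentzian para-Kenmotsu manifolds\<close>

context lp_kenmotsu_manifold
begin

abbreviation g_hor_fun :: "('a, 'n) vfield \<Rightarrow> ('a, 'n) vfield \<Rightarrow> 'a \<Rightarrow> real" where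
  "g_hor_fun E F \<equiv> \<lambda>p. g_hor p (E p) (F p)"

abbreviation ric_fun :: "('a, 'n) vfield \<Rightarrow> ('a, 'n) vfield \<Rightarrow> 'a \<Rightarrow> real" where
  "ric_fun E F \<equiv> \<lambda>p. ric p (E p) (F p)"

text \<open>By Cartan's formula, because \<open>\<nu>\<close> is closed.\<close>

lemma lie_nu:
  assumes "X \<in> vf" "E \<in> vf"
  shows "lie1 X nu_fun E p = drv E (nu_fun X) p"
  using nu_closed[OF assms, of p] by (simp add: lie1_def)

lemma lie_g_hor:
  assumes "X \<in> vf" "E \<in> vf" "F \<in> vf"
  shows "lie2 X g_hor_fun E F p = lie2 X ip E F p
    + drv E (nu_fun X) p * \<nu> p (F p) + \<nu> p (E p) * drv F (nu_fun X) p"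
proof -
  have "lie2 X g_hor_fun E F p = lie2 X (\<lambda>E F p. ip E F p + nu_fun E p * nu_fun F p) E F p"
    by (simp add: g_hor_def)
  also have "\<dots> = lie2 X ip E F p + lie2 X (\<lambda>E F p. nu_fun E p * nu_fun F p) E F p"
    by (rule lie2_add) (intro smooth_inner smooth_fun_mult smooth_nu assms)+
  also have "lie2 X (\<lambda>E F p. nu_fun E p * nu_fun F p) E F p
      = lie1 X nu_fun E p * \<nu> p (F p) + \<nu> p (E p) * lie1 X nu_fun F p"
    by (rule lie2_tensor) (intro smooth_nu assms)+
  finally show ?thesis by (simp add: lie_nu assms)
qed

lemma lie2_zeta_ip: "E \<in> vf \<Longrightarrow> F \<in> vf \<Longrightarrow> lie2 \<zeta> ip E F p = - 2 * g_hor p (E p) (F p)"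
  by (simp add: lie2_def lie_zeta_metric)

lemma lie2_zeta_g_hor: "E \<in> vf \<Longrightarrow> F \<in> vf \<Longrightarrow> lie2 \<zeta> g_hor_fun E F p = - 2 * g_hor p (E p) (F p)"
  by (simp add: lie_g_hor zeta_vf lie2_zeta_ip)

text \<open>If \<open>g_hor\<close> vanished, every tangent vector would be a multiple of \<open>\<zeta>\<close>, although the dimension is at
  least two.\<close>

lemma g_hor_nonzero: "\<exists>v w. g_hor p v w \<noteq> 0"
proof (rule ccontr)
  assume "\<not> ?thesis"
  then have "g p (v + \<nu> p v *\<^sub>R \<zeta> p) w = g p 0 w" for v w
    by (simp add: g_hor_def)
  then have "v + \<nu> p v *\<^sub>R \<zeta> p = 0" for v
    by (rule g_eqI)
  then have "trace (matrix (\<lambda>v. 1 *\<^sub>R v + \<nu> p v *\<^sub>R \<zeta> p)) = trace (matrix (\<lambda>v. 0 *\<^sub>R v :: real ^ 'n))"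
    by simp
  then have "real CARD('n) - 1 = 0"
    by (simp only: trace_add trace_ident trace_rank_one[OF nu_linear] nu_zeta)
  then show False using two_le_dim by simp
qed

text \<open>In a product chart with \<open>\<zeta> = \<partial>\<^sub>t\<close> and metric \<open>- dt\<^sup>2 + e\<^sup>-\<^sup>2\<^sup>t h\<^sub>0\<close>, the soliton equation makes \<open>\<nu>(K)\<close>
  affine in \<open>t\<close> with slope \<open>c = \<sigma> (n - 1) + m\<close>. Then \<open>\<L>\<^sub>K g\<close> contains the term \<open>2 c t e\<^sup>-\<^sup>2\<^sup>t h\<^sub>0\<close>, whereas all other
  terms in the part of the equation orthogonal to \<open>\<zeta>\<close> are combinations of \<open>1\<close> and \<open>e\<^sup>-\<^sup>2\<^sup>t\<close> with coefficients that do not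
  depend on \<open>t\<close>. Two Lie derivatives along \<open>\<zeta>\<close> isolate this term.\<close>

lemma soliton_constant_zero:
  assumes K: "K \<in> vf"
    and soliton: "\<And>E F p. E \<in> vf \<Longrightarrow> F \<in> vf \<Longrightarrow> lie2 K ip E F p = - 2 * \<sigma> * ric p (E p) (F p) - 2 * m * g p (E p) (F p)"
  shows "\<sigma> * (real CARD('n) - 1) + m = 0" (is "?c = 0")
proof -
  define c where "c = \<sigma> * (real CARD('n) - 1) + m"
  define f where "f = nu_fun K"
  define W where "W = br \<zeta> K"
  have W: "W \<in> vf" unfolding W_def by (intro br_vf zeta_vf K)
  have f: "smooth_fun A f" unfolding f_def by (rule smooth_nu[OF K])
  have df: "smooth_fun A (drv E f)" if "E \<in> vf" for E by (rule smooth_deriv_along[OF that f])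
  have BK: "br K \<zeta> p = - W p" for p unfolding W_def by (rule br_commute)
  \<comment> \<open>Inserting \<open>\<zeta>\<close> into one or both slots of the soliton equation.\<close>
  have gW: "g p (W p) (E p) = - 2 * c * \<nu> p (E p) - drv E f p" if E: "E \<in> vf" for E p
  proof -
    have "lie2 K ip E \<zeta> p = drv E f p + g p (E p) (W p)"
      using lie_nu[OF K E, of p] by (simp add: lie2_def lie1_def BK f_def)
    then show ?thesis
      using soliton[OF E zeta_vf, of p] by (simp add: ricci_zeta c_def g_commute[of p "W p"] algebra_simps)
  qed
  have nuW: "\<nu> p (W p) = c" for p
  proof -
    have "lie2 K ip \<zeta> \<zeta> p = 2 * \<nu> p (W p)"
      by (simp add: lie2_def BK)
    then show ?thesis
      using soliton[OF zeta_vf zeta_vf, of p] by (simp add: ricci_zeta c_def algebra_simps)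
  qed
  have zf: "drv \<zeta> f = (\<lambda>p. c)"
    using gW[OF zeta_vf] nuW by (auto simp: fun_eq_iff algebra_simps)
  let ?\<Theta> = "lie2 K ip"
  have lie_\<Theta>: "lie2 \<zeta> ?\<Theta> E F p = 4 * c * g_hor p (E p) (F p)" if "E \<in> vf" "F \<in> vf" for E F p
  proof -
    have "lie2 \<zeta> ?\<Theta> E F p = lie2 \<zeta> (\<lambda>E F p. (- 2 * \<sigma>) * ric_fun E F p + (- 2 * m) * ip E F p) E F p"
      by (rule lie2_cong) (simp_all add: fun_eq_iff soliton that zeta_vf)
    also have "\<dots> = lie2 \<zeta> (\<lambda>E F p. (- 2 * \<sigma>) * ric_fun E F p) E F p + lie2 \<zeta> (\<lambda>E F p. (- 2 * m) * ip E F p) E F p"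
      by (rule lie2_add) (intro smooth_fun_mult smooth_fun_const smooth_ricci smooth_inner that)+
    also have "\<dots> = (- 2 * \<sigma>) * lie2 \<zeta> ric_fun E F p + (- 2 * m) * lie2 \<zeta> ip E F p"
      by (simp only: lie2_cmult smooth_ricci smooth_inner that)
    also have "lie2 \<zeta> ric_fun E F p = - 2 * (real CARD('n) - 1) * g_hor p (E p) (F p)"
      by (simp add: lie2_def lie_zeta_ricci that algebra_simps)
    also have "lie2 \<zeta> ip E F p = - 2 * g_hor p (E p) (F p)"
      by (rule lie2_zeta_ip[OF that])
    finally show ?thesis by (simp add: c_def algebra_simps)
  qed
  let ?T = "\<lambda>E F p. drv E f p * nu_fun F p + nu_fun E p * drv F f p"
  \<comment> \<open>One Lie derivative: the commutator of \<open>\<L>\<^sub>\<zeta>\<close> and \<open>\<L>\<^sub>K\<close> on the metric is \<open>\<L>\<^sub>W g\<close>.\<close>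
  have lieW: "lie2 W ip E F = (\<lambda>p. 4 * c * g_hor_fun E F p + (2 * ?\<Theta> E F p + 2 * ?T E F p))"
    if "E \<in> vf" "F \<in> vf" for E F
  proof
    fix p
    have "lie2 K (lie2 \<zeta> ip) E F p = lie2 K (\<lambda>E F p. - 2 * g_hor_fun E F p) E F p"
      by (rule lie2_cong) (simp_all add: fun_eq_iff lie2_zeta_ip that K)
    also have "\<dots> = - 2 * lie2 K g_hor_fun E F p"
      by (rule lie2_cmult) (rule smooth_g_hor[OF that])
    finally show "lie2 W ip E F p = 4 * c * g_hor_fun E F p + (2 * ?\<Theta> E F p + 2 * ?T E F p)"
      using lie2_commutator[OF zeta_vf K that, of p] lie_\<Theta>[OF that, of p]
      by (simp add: lie_g_hor[OF K that] f_def[symmetric] W_def[symmetric] algebra_simps)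
  qed
  have lie_df: "lie1 \<zeta> (\<lambda>E. drv E f) E p = 0" if "E \<in> vf" for E p
  proof -
    have "drv (br \<zeta> E) f p = drv \<zeta> (drv E f) p - drv E (drv \<zeta> f) p"
      by (simp add: deriv_br zeta_vf that f)
    then show ?thesis by (simp add: lie1_def zf)
  qed
  have lie_T: "lie2 \<zeta> ?T E F p = 0" if "E \<in> vf" "F \<in> vf" for E F p
  proof -
    have "lie2 \<zeta> ?T E F p = lie2 \<zeta> (\<lambda>E F p. drv E f p * nu_fun F p) E F p
        + lie2 \<zeta> (\<lambda>E F p. nu_fun E p * drv F f p) E F p"
      by (rule lie2_add) (intro smooth_fun_mult df smooth_nu that)+
    also have "lie2 \<zeta> (\<lambda>E F p. drv E f p * nu_fun F p) E F p =
        lie1 \<zeta> (\<lambda>E. drv E f) E p * nu_fun F p + drv E f p * lie1 \<zeta> nu_fun F p"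
      by (rule lie2_tensor) (intro df smooth_nu that)+
    also have "lie2 \<zeta> (\<lambda>E F p. nu_fun E p * drv F f p) E F p =
        lie1 \<zeta> nu_fun E p * drv F f p + nu_fun E p * lie1 \<zeta> (\<lambda>E. drv E f) F p"
      by (rule lie2_tensor) (intro df smooth_nu that)+
    finally show ?thesis by (simp add: lie_df lie_nu zeta_vf that)
  qed
  \<comment> \<open>The second Lie derivative, from the expression just found: the two multiples of \<open>g_hor\<close> cancel.\<close>
  have left: "lie2 \<zeta> (lie2 W ip) E F p = 0" if "E \<in> vf" "F \<in> vf" for E F p
  proof -
    have s: "smooth_fun A (g_hor_fun E F)" "smooth_fun A (?\<Theta> E F)" "smooth_fun A (?T E F)"
      using that by (simp_all add: smooth_g_hor smooth_lie2 smooth_inner K smooth_fun_add smooth_fun_mult df smooth_nu)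
    have "lie2 \<zeta> (lie2 W ip) E F p =
        lie2 \<zeta> (\<lambda>E F p. 4 * c * g_hor_fun E F p + (2 * ?\<Theta> E F p + 2 * ?T E F p)) E F p"
      by (rule lie2_cong) (simp_all only: lieW that zeta_vf)
    also have "\<dots> = lie2 \<zeta> (\<lambda>E F p. 4 * c * g_hor_fun E F p) E F p
        + lie2 \<zeta> (\<lambda>E F p. 2 * ?\<Theta> E F p + 2 * ?T E F p) E F p"
      by (rule lie2_add) (intro smooth_fun_add smooth_fun_mult smooth_fun_const s)+
    also have "lie2 \<zeta> (\<lambda>E F p. 2 * ?\<Theta> E F p + 2 * ?T E F p) E F p
        = lie2 \<zeta> (\<lambda>E F p. 2 * ?\<Theta> E F p) E F p + lie2 \<zeta> (\<lambda>E F p. 2 * ?T E F p) E F p"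
      by (rule lie2_add) (intro smooth_fun_mult smooth_fun_const s)+
    also have "lie2 \<zeta> (\<lambda>E F p. 4 * c * g_hor_fun E F p) E F p = 4 * c * lie2 \<zeta> g_hor_fun E F p"
      by (rule lie2_cmult) (rule s(1))
    also have "lie2 \<zeta> (\<lambda>E F p. 2 * ?\<Theta> E F p) E F p = 2 * lie2 \<zeta> ?\<Theta> E F p"
      by (rule lie2_cmult) (rule s(2))
    also have "lie2 \<zeta> (\<lambda>E F p. 2 * ?T E F p) E F p = 2 * lie2 \<zeta> ?T E F p"
      by (rule lie2_cmult) (rule s(3))
    finally show ?thesis
      by (simp only: lie_T[OF that] lie_\<Theta>[OF that] lie2_zeta_g_hor[OF that])
  qed
  \<comment> \<open>The second Lie derivative, from the commutator rule, where \<open>\<nu>(W) = c\<close> is constant.\<close>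
  have zW: "br \<zeta> W = (\<lambda>p. 2 *\<^sub>R W p + (2 * c) *\<^sub>R \<zeta> p)"
  proof (rule ext, rule g_eqI_fields)
    fix p E assume E: "E \<in> vf"
    have "lie1 \<zeta> (\<lambda>E p. g p (W p) (E p)) E p = lie1 \<zeta> (\<lambda>E p. (- 2 * c) * nu_fun E p - drv E f p) E p"
      by (simp add: lie1_def gW E br_vf zeta_vf)
    also have "\<dots> = (- 2 * c) * lie1 \<zeta> nu_fun E p - lie1 \<zeta> (\<lambda>E. drv E f) E p"
      by (simp add: lie1_def deriv_along_diff deriv_along_minus deriv_along_cmult
          smooth_fun_minus smooth_fun_mult smooth_nu df E algebra_simps)
    also have "\<dots> = 0" by (simp add: lie_nu zeta_vf E lie_df)
    finally have "drv \<zeta> (ip W E) p = g p (W p) (br \<zeta> E p)" by (simp add: lie1_def)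
    then show "g p (br \<zeta> W p) (E p) = g p (2 *\<^sub>R W p + (2 * c) *\<^sub>R \<zeta> p) (E p)"
      using lie_zeta_metric[OF W E, of p] by (simp add: g_hor_def nuW)
  qed
  have right: "lie2 W (lie2 \<zeta> ip) E F p + lie2 (br \<zeta> W) ip E F p = - 4 * c * g_hor p (E p) (F p)"
    if "E \<in> vf" "F \<in> vf" for E F p
  proof -
    have "lie2 W (lie2 \<zeta> ip) E F p = lie2 W (\<lambda>E F p. - 2 * g_hor_fun E F p) E F p"
      by (rule lie2_cong) (simp_all add: fun_eq_iff lie2_zeta_ip that W)
    also have "\<dots> = - 2 * lie2 W g_hor_fun E F p"
      by (rule lie2_cmult) (rule smooth_g_hor[OF that])
    also have "lie2 W g_hor_fun E F p = lie2 W ip E F p"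
      using lie_g_hor[OF W that, of p] nuW by simp
    finally have 1: "lie2 W (lie2 \<zeta> ip) E F p = - 2 * lie2 W ip E F p" .
    have br: "br (\<lambda>p. 2 *\<^sub>R W p + (2 * c) *\<^sub>R \<zeta> p) X p = 2 *\<^sub>R br W X p + (2 * c) *\<^sub>R br \<zeta> X p"
      if "X \<in> vf" for X
      by (simp add: br_add1 br_scale1 vf_cmult W zeta_vf that)
    have "lie2 (br \<zeta> W) ip E F p = 2 * lie2 W ip E F p + 2 * c * lie2 \<zeta> ip E F p"
      using that unfolding zW lie2_def
      by (simp add: br deriv_along_field_add deriv_along_field_scaleR smooth_inner)
         (simp add: algebra_simps)
    then show ?thesis using 1 by (simp add: lie2_zeta_ip that)
  qed
  obtain v w :: "real ^ 'n" where vw: "g_hor undefined v w \<noteq> 0"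
    using g_hor_nonzero by blast
  let ?E = "extend_vec A undefined v" and ?F = "extend_vec A undefined w"
  have "4 * c * g_hor undefined (?E undefined) (?F undefined) = 0"
    using lie2_commutator[OF zeta_vf W, of ?E ?F undefined] left[of ?E ?F undefined] right[of ?E ?F undefined]
    by simp
  then show ?thesis using vw by (simp add: c_def)
qed

end

theorem theorem3p1:
  fixes A :: "('a::{t2_space, second_countable_topology}, 'n::finite) chart set"
    and \<phi> :: "'a \<Rightarrow> real ^ 'n \<Rightarrow> real ^ 'n"
    and \<zeta> K :: "('a, 'n) vfield"
    and \<nu> :: "'a \<Rightarrow> real ^ 'n \<Rightarrow> real"
    and g :: "'a \<Rightarrow> real ^ 'n \<Rightarrow> real ^ 'n \<Rightarrow> real"
    and D :: "('a, 'n) vfield \<Rightarrow> ('a, 'n) vfield \<Rightarrow> ('a, 'n) vfield"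
    and \<Lambda> \<sigma> \<rho> r :: real
  assumes "lp_kenmotsu A \<phi> \<zeta> \<nu> g D"
    and "\<forall>p. scalar_curvature A g D p = r"
    and "ricci_yamabe_soliton A g D K \<Lambda> \<sigma> \<rho>"
  shows "\<Lambda> = \<rho> * real CARD('n) * (real CARD('n) - 1) / 2 - \<sigma> * (real CARD('n) - 1)"
proof -
  interpret lp_kenmotsu_manifold A g D \<phi> \<zeta> \<nu>
    using assms(1)
    by unfold_locales (auto simp: lp_kenmotsu_def lorentzian_almost_paracontact_def)
  have const: "scalar_curvature A g D = (\<lambda>p. r)"
    using assms(2) by auto
  have "2 * r - 2 * real CARD('n) * (real CARD('n) - 1) = 0"
    using drv_zeta_scalar_curvature[of undefined] by (simp add: const)
  then have r: "r = real CARD('n) * (real CARD('n) - 1)" by simp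
  have "\<sigma> * (real CARD('n) - 1) + (\<Lambda> - \<rho> * r / 2) = 0"
  proof (rule soliton_constant_zero[of K])
    show "K \<in> vector_fields A"
      using assms(3) by (simp add: ricci_yamabe_soliton_def)
    show "lie2 K (\<lambda>X Y p. g p (X p) (Y p)) E F p
        = - 2 * \<sigma> * ricci A D p (E p) (F p) - 2 * (\<Lambda> - \<rho> * r / 2) * g p (E p) (F p)"
      if "E \<in> vector_fields A" "F \<in> vector_fields A" for E F p
    proof -
      have "lie_derivative_metric A K g E F p + 2 * \<sigma> * ricci A D p (E p) (F p)
          + (2 * \<Lambda> - \<rho> * r) * g p (E p) (F p) = 0"
        using assms(3) that by (simp add: ricci_yamabe_soliton_def const)
      moreover have "lie_derivative_metric A K g E F p = lie2 K (\<lambda>X Y p. g p (X p) (Y p)) E F p"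
        by (simp add: lie_derivative_metric_def lie2_def)
      ultimately show ?thesis by (simp add: algebra_simps)
    qed
  qed
  then show ?thesis by (simp add: r algebra_simps)
qed

end
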